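(* Let $p>2$ be a prime. If $\mathfrak{p}$ is a bilateral $\tilde{O}$-ideal of norm $p$, then $\mathbb{Z}+\mathfrak{p}$ is an order of index $p$ in $\tilde{O}$. Conversely, if $O'\subset\tilde{O}$ is an order with $[\tilde{O}:O']=p$, then $L=\{x\in O':p\mid\mathrm{Tr}(x)\}$ is a bilateral $\tilde{O}$-ideal of norm $p$.
   Context: Let $B$ be the quaternion algebra over $\mathbb{Q}$ ramified exactly at $p$ and $\infty$, with reduced norm $N$, reduced trace $\mathrm{Tr}$, and $\Delta x:=\mathrm{Tr}(x)^2-4N(x)$. Let $O\subset B$ be a maximal order and $\tilde{O}=\{x\in O:p\mid\Delta x\}$ the unique order of index $p$ in $O$. The norm of a lattice $\mathfrak{a}\subset B$ is the positive rational gcd of the $N(x)$, $x\in\mathfrak{a}$. A left $\tilde{O}$-ideal is a lattice $\mathfrak{a}\subset B$ with $\mathfrak{a}_\ell=\tilde{O}_\ell x_\ell$, $x_\ell\in B_\ell^\times$, for every prime $\ell$; it is bilateral if its right order $\{x\in B:\mathfrak{a}x\subseteq\mathfrak{a}\}$ equals $\tilde{O}$. *)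

theory Defs
  imports
    "HOL-Computational_Algebra.Computational_Algebra"
    "HOL-Algebra.Algebra"
    "HOL-Algebra.Algebraic_Closure_Type"
begin

section \<open>The field of l-adic numbers\<close>

text \<open>
  The prime l is a variable of the statement, so the field of l-adic numbers has to be a ring
  record depending on l rather than a type. It is the completion of the rationals for the l-adic
  absolute value: Cauchy sequences modulo null sequences.
\<close>

definition padic_val :: "nat \<Rightarrow> rat \<Rightarrow> int" where
  "padic_val l r =
     int (multiplicity (int l) (fst (quotient_of r))) - int (multiplicity (int l) (snd (quotient_of r)))"

definition padic_abs :: "nat \<Rightarrow> rat \<Rightarrow> rat" where
  "padic_abs l r = (if r = 0 then 0 else of_nat l powi (- padic_val l r))"

definition padic_Cauchy :: "nat \<Rightarrow> (nat \<Rightarrow> rat) \<Rightarrow> bool" where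
  "padic_Cauchy l s \<longleftrightarrow> (\<forall>e>0. \<exists>M. \<forall>m\<ge>M. \<forall>n\<ge>M. padic_abs l (s m - s n) < e)"

definition padic_null :: "nat \<Rightarrow> (nat \<Rightarrow> rat) \<Rightarrow> bool" where
  "padic_null l s \<longleftrightarrow> (\<forall>e>0. \<exists>M. \<forall>n\<ge>M. padic_abs l (s n) < e)"

definition padic_Cauchy_ring :: "nat \<Rightarrow> (nat \<Rightarrow> rat) ring" where
  "padic_Cauchy_ring l =
     \<lparr>carrier = {s. padic_Cauchy l s}, monoid.mult = (\<lambda>s t n. s n * t n), monoid.one = (\<lambda>n. 1),
      ring.zero = (\<lambda>n. 0), ring.add = (\<lambda>s t n. s n + t n)\<rparr>"

definition Qp :: "nat \<Rightarrow> (nat \<Rightarrow> rat) set ring" where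
  "Qp l = padic_Cauchy_ring l Quot {s. padic_null l s}"

definition Qp_of_rat :: "nat \<Rightarrow> rat \<Rightarrow> (nat \<Rightarrow> rat) set" where
  "Qp_of_rat l r = {s. padic_null l s} +>\<^bsub>padic_Cauchy_ring l\<^esub> (\<lambda>n. r)"

text \<open>The closed unit ball: a class has absolute value at most 1 iff it contains a sequence
  all of whose terms do.\<close>

definition Zp :: "nat \<Rightarrow> (nat \<Rightarrow> rat) set set" where
  "Zp l = {c \<in> carrier (Qp l). \<exists>s\<in>c. \<forall>n. padic_abs l (s n) \<le> 1}"


section \<open>Quaternion algebras\<close>

datatype 'a quat = Quat (q_1: 'a) (q_i: 'a) (q_j: 'a) (q_k: 'a)

text \<open>
  The quaternion algebra \<open>(a, b | K)\<close>, with basis \<open>1, i, j, k\<close> and relations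
  \<open>i\<^sup>2 = a\<close>, \<open>j\<^sup>2 = b\<close>, \<open>k = i j = - j i\<close>.
\<close>

definition quat_alg :: "('a, 'm) ring_scheme \<Rightarrow> 'a \<Rightarrow> 'a \<Rightarrow> 'a quat ring" where
  "quat_alg K a b =
     \<lparr>carrier = {x. set_quat x \<subseteq> carrier K},
      monoid.mult = (\<lambda>x y. Quat
        (q_1 x \<otimes>\<^bsub>K\<^esub> q_1 y \<oplus>\<^bsub>K\<^esub> a \<otimes>\<^bsub>K\<^esub> (q_i x \<otimes>\<^bsub>K\<^esub> q_i y) \<oplus>\<^bsub>K\<^esub> b \<otimes>\<^bsub>K\<^esub> (q_j x \<otimes>\<^bsub>K\<^esub> q_j y)
           \<ominus>\<^bsub>K\<^esub> a \<otimes>\<^bsub>K\<^esub> b \<otimes>\<^bsub>K\<^esub> (q_k x \<otimes>\<^bsub>K\<^esub> q_k y))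
        (q_1 x \<otimes>\<^bsub>K\<^esub> q_i y \<oplus>\<^bsub>K\<^esub> q_i x \<otimes>\<^bsub>K\<^esub> q_1 y \<oplus>\<^bsub>K\<^esub> b \<otimes>\<^bsub>K\<^esub> (q_k x \<otimes>\<^bsub>K\<^esub> q_j y \<ominus>\<^bsub>K\<^esub> q_j x \<otimes>\<^bsub>K\<^esub> q_k y))
        (q_1 x \<otimes>\<^bsub>K\<^esub> q_j y \<oplus>\<^bsub>K\<^esub> q_j x \<otimes>\<^bsub>K\<^esub> q_1 y \<oplus>\<^bsub>K\<^esub> a \<otimes>\<^bsub>K\<^esub> (q_i x \<otimes>\<^bsub>K\<^esub> q_k y \<ominus>\<^bsub>K\<^esub> q_k x \<otimes>\<^bsub>K\<^esub> q_i y))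
        (q_1 x \<otimes>\<^bsub>K\<^esub> q_k y \<oplus>\<^bsub>K\<^esub> q_k x \<otimes>\<^bsub>K\<^esub> q_1 y \<oplus>\<^bsub>K\<^esub> (q_i x \<otimes>\<^bsub>K\<^esub> q_j y \<ominus>\<^bsub>K\<^esub> q_j x \<otimes>\<^bsub>K\<^esub> q_i y))),
      monoid.one = Quat \<one>\<^bsub>K\<^esub> \<zero>\<^bsub>K\<^esub> \<zero>\<^bsub>K\<^esub> \<zero>\<^bsub>K\<^esub>,
      ring.zero = Quat \<zero>\<^bsub>K\<^esub> \<zero>\<^bsub>K\<^esub> \<zero>\<^bsub>K\<^esub> \<zero>\<^bsub>K\<^esub>,
      ring.add = (\<lambda>x y. Quat (q_1 x \<oplus>\<^bsub>K\<^esub> q_1 y) (q_i x \<oplus>\<^bsub>K\<^esub> q_i y) (q_j x \<oplus>\<^bsub>K\<^esub> q_j y) (q_k x \<oplus>\<^bsub>K\<^esub> q_k y))\<rparr>"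

definition quat_scalar :: "('a, 'm) ring_scheme \<Rightarrow> 'a \<Rightarrow> 'a quat" where
  "quat_scalar K c = Quat c \<zero>\<^bsub>K\<^esub> \<zero>\<^bsub>K\<^esub> \<zero>\<^bsub>K\<^esub>"

text \<open>Every quaternion algebra over the rationals is isomorphic to some \<open>quat_Q a b\<close> with
  \<open>a, b\<close> nonzero; its base changes to the completions are the following two.\<close>

definition quat_Q :: "rat \<Rightarrow> rat \<Rightarrow> rat quat ring" where
  "quat_Q a b = quat_alg ring_of_type_algebra a b"

definition quat_R :: "rat \<Rightarrow> rat \<Rightarrow> real quat ring" where
  "quat_R a b = quat_alg ring_of_type_algebra (of_rat a) (of_rat b)"

definition quat_Qp :: "nat \<Rightarrow> rat \<Rightarrow> rat \<Rightarrow> (nat \<Rightarrow> rat) set quat ring" where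
  "quat_Qp l a b = quat_alg (Qp l) (Qp_of_rat l a) (Qp_of_rat l b)"

definition is_division_ring :: "('a, 'm) ring_scheme \<Rightarrow> bool" where
  "is_division_ring R \<longleftrightarrow> ring R \<and> Units R = carrier R - {\<zero>\<^bsub>R\<^esub>}"

definition ramified_exactly_at_p_infinity :: "nat \<Rightarrow> rat \<Rightarrow> rat \<Rightarrow> bool" where
  "ramified_exactly_at_p_infinity p a b \<longleftrightarrow>
     is_division_ring (quat_R a b) \<and>
     (\<forall>l. Factorial_Ring.prime l \<longrightarrow> (is_division_ring (quat_Qp l a b) \<longleftrightarrow> l = p))"

definition red_norm :: "rat \<Rightarrow> rat \<Rightarrow> rat quat \<Rightarrow> rat" where
  "red_norm a b x = (q_1 x)^2 - a * (q_i x)^2 - b * (q_j x)^2 + a * b * (q_k x)^2"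

definition red_trace :: "rat quat \<Rightarrow> rat" where
  "red_trace x = 2 * q_1 x"

definition red_disc :: "rat \<Rightarrow> rat \<Rightarrow> rat quat \<Rightarrow> rat" where
  "red_disc a b x = (red_trace x)^2 - 4 * red_norm a b x"

text \<open>The quotient has to be an integer; on the rationals \<open>dvd\<close> itself
  is the trivial divisibility of a field.\<close>

definition int_dvd :: "rat \<Rightarrow> rat \<Rightarrow> bool" where
  "int_dvd d r \<longleftrightarrow> (\<exists>k::int. r = of_int k * d)"


section \<open>Lattices, orders and ideals\<close>

text \<open>The submodule generated by \<open>G\<close> over a ring of central scalars \<open>S\<close> of \<open>A\<close>.\<close>

definition scalar_span :: "('a, 'm) ring_scheme \<Rightarrow> 'a set \<Rightarrow> 'a set \<Rightarrow> 'a set" where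
  "scalar_span A S G = generate (add_monoid A) (S <#>\<^bsub>A\<^esub> G)"

definition is_lattice :: "rat \<Rightarrow> rat \<Rightarrow> rat quat set \<Rightarrow> bool" where
  "is_lattice a b L \<longleftrightarrow>
     (\<exists>G. finite G \<and> G \<subseteq> carrier (quat_Q a b) \<and> L = generate (add_monoid (quat_Q a b)) G) \<and>
     scalar_span (quat_Q a b) (range (quat_scalar ring_of_type_algebra)) L = carrier (quat_Q a b)"

definition is_order :: "rat \<Rightarrow> rat \<Rightarrow> rat quat set \<Rightarrow> bool" where
  "is_order a b R \<longleftrightarrow> is_lattice a b R \<and> subring R (quat_Q a b)"

definition is_maximal_order :: "rat \<Rightarrow> rat \<Rightarrow> rat quat set \<Rightarrow> bool" where
  "is_maximal_order a b R \<longleftrightarrow> is_order a b R \<and> (\<forall>R'. is_order a b R' \<longrightarrow> R \<subseteq> R' \<longrightarrow> R' = R)"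

text \<open>The index of a subgroup \<open>M\<close> of \<open>L\<close>; it is 0 if the index is infinite.\<close>

definition lattice_index :: "rat \<Rightarrow> rat \<Rightarrow> rat quat set \<Rightarrow> rat quat set \<Rightarrow> nat" where
  "lattice_index a b L M = card (a_rcosets\<^bsub>(quat_Q a b)\<lparr>carrier := L\<rparr>\<^esub> M)"

text \<open>\<open>d\<close> is the positive rational gcd of the set \<open>S\<close>.\<close>

definition is_rat_gcd :: "rat set \<Rightarrow> rat \<Rightarrow> bool" where
  "is_rat_gcd S d \<longleftrightarrow>
     d > 0 \<and> (\<forall>s\<in>S. int_dvd d s) \<and> (\<forall>e. (\<forall>s\<in>S. int_dvd e s) \<longrightarrow> int_dvd e d)"

definition has_norm :: "rat \<Rightarrow> rat \<Rightarrow> rat quat set \<Rightarrow> rat \<Rightarrow> bool" where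
  "has_norm a b L d \<longleftrightarrow> is_rat_gcd (red_norm a b ` L) d"

definition localize :: "nat \<Rightarrow> rat \<Rightarrow> rat \<Rightarrow> rat quat set \<Rightarrow> (nat \<Rightarrow> rat) set quat set" where
  "localize l a b L =
     scalar_span (quat_Qp l a b) (quat_scalar (Qp l) ` Zp l) (map_quat (Qp_of_rat l) ` L)"

definition is_left_ideal :: "rat \<Rightarrow> rat \<Rightarrow> rat quat set \<Rightarrow> rat quat set \<Rightarrow> bool" where
  "is_left_ideal a b R L \<longleftrightarrow>
     is_lattice a b L \<and>
     (\<forall>l. Factorial_Ring.prime l \<longrightarrow> (\<exists>x \<in> Units (quat_Qp l a b).
        localize l a b L = localize l a b R #>\<^bsub>quat_Qp l a b\<^esub> x))"

definition right_order :: "rat \<Rightarrow> rat \<Rightarrow> rat quat set \<Rightarrow> rat quat set" where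
  "right_order a b L =
     {x \<in> carrier (quat_Q a b). L #>\<^bsub>quat_Q a b\<^esub> x \<subseteq> L}"

definition is_bilateral_ideal :: "rat \<Rightarrow> rat \<Rightarrow> rat quat set \<Rightarrow> rat quat set \<Rightarrow> bool" where
  "is_bilateral_ideal a b R L \<longleftrightarrow> is_left_ideal a b R L \<and> right_order a b L = R"

text \<open>For \<open>R\<close> a maximal order this is the order of index \<open>p\<close> in \<open>R\<close>.\<close>

definition O_tilde :: "nat \<Rightarrow> rat \<Rightarrow> rat \<Rightarrow> rat quat set \<Rightarrow> rat quat set" where
  "O_tilde p a b R = {x \<in> R. int_dvd (of_nat p) (red_disc a b x)}"

definition Z_plus :: "rat \<Rightarrow> rat \<Rightarrow> rat quat set \<Rightarrow> rat quat set" where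
  "Z_plus a b L =
     range (\<lambda>n::int. add_pow (quat_Q a b) n \<one>\<^bsub>quat_Q a b\<^esub>) <+>\<^bsub>quat_Q a b\<^esub> L"

end

theory Submission
  imports Defs
begin

text \<open>
  Everything is decided locally, and at the ramified prime \<open>p\<close> by the valuation \<open>N\<close>. Since the completion at
  \<open>p\<close> is a division algebra, Hensel's lemma shows that the maximal order is locally \<open>{x. N(x) integral}\<close>, and
  \<open>V k = {x. p\<^sup>k | N(x)}\<close> are its two-sided ideals. An anisotropic form modulo \<open>p\<close> has at most two variables, so
  both \<open>V 0 / V 1\<close> and \<open>V 1 / V 2\<close> are planes over the field with \<open>p\<close> elements, and the small order is locally
  \<open>Z + V 1\<close>. A bilateral ideal of norm \<open>p\<close> is locally at \<open>p\<close> of the form \<open>Z y + V 2\<close> with \<open>y\<close> of valuation 1,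
  and conversely a suborder of index \<open>p\<close> meets \<open>V 1\<close> in such a lattice. Away from \<open>p\<close>, a bilateral ideal of
  norm 1 is generated by an element \<open>y\<close> of unit norm normalising the maximal order \<open>R\<close>; the trace of
  conjugation by \<open>y\<close> is \<open>Tr(y)\<^sup>2 / N(y)\<close>, so \<open>y\<close> is integral, \<open>R + R y\<close> is an order, and \<open>y\<close> lies in \<open>R\<close>.
\<close>

section \<open>Quaternions and lattices\<close>

text \<open>The generators in the definition of an ideal live in the completions, while orders,
  norms and indices live in the rational algebra. This gap shapes the preparations:
  \<open>loc L\<close> allows denominators prime to l inside the rational algebra and determines the
  l-adic span of L, and an element of L whose norm has least valuation already generates L at l, so
  that generators can be taken rational. In the direct implication an ideal is stable under
  \<open>O_tilde\<close> only from the right, and nothing places it inside R. Left stability follows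
  from local principality. Containment in R is immediate at p, where R is cut out by the norm; at
  the other primes an integral norm does not make an element integral, and the normaliser argument
  fills this gap. In the converse the obstacle is that a suborder of index p must contain all of R
  in \<open>V 2\<close>; the index alone does not give this, and products inside the suborder have
  to be used. That p is odd makes 2 a unit, so that orthogonal projections and trace-free parts
  exist at p.\<close>

instantiation quat :: (ab_group_add) ab_group_add
begin

definition "0 = Quat 0 0 0 0"
definition "x + y = Quat (q_1 x + q_1 y) (q_i x + q_i y) (q_j x + q_j y) (q_k x + q_k y)"
definition "- x = Quat (- q_1 x) (- q_i x) (- q_j x) (- q_k x)"
definition "x - y = Quat (q_1 x - q_1 y) (q_i x - q_i y) (q_j x - q_j y) (q_k x - q_k y)"

instance
  by standard
    (auto simp: zero_quat_def plus_quat_def uminus_quat_def minus_quat_def intro!: quat.expand)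

end

lemma quat_eqI:
  "q_1 x = q_1 y \<Longrightarrow> q_i x = q_i y \<Longrightarrow> q_j x = q_j y \<Longrightarrow> q_k x = q_k y \<Longrightarrow> x = y"
  by (cases x; cases y) auto

definition scl :: "'a::times \<Rightarrow> 'a quat \<Rightarrow> 'a quat" where
  "scl r x = Quat (r * q_1 x) (r * q_i x) (r * q_j x) (r * q_k x)"

text \<open>The product depends on a and b, so unlike addition it cannot be a type class
  operation.\<close>

definition qmul :: "'a::comm_ring_1 \<Rightarrow> 'a \<Rightarrow> 'a quat \<Rightarrow> 'a quat \<Rightarrow> 'a quat" where
  "qmul a b x y = Quat
     (q_1 x * q_1 y + a * (q_i x * q_i y) + b * (q_j x * q_j y) - a * b * (q_k x * q_k y))
     (q_1 x * q_i y + q_i x * q_1 y + b * (q_k x * q_j y - q_j x * q_k y))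
     (q_1 x * q_j y + q_j x * q_1 y + a * (q_i x * q_k y - q_k x * q_i y))
     (q_1 x * q_k y + q_k x * q_1 y + (q_i x * q_j y - q_j x * q_i y))"

definition qcnj :: "'a::uminus quat \<Rightarrow> 'a quat" where
  "qcnj x = Quat (q_1 x) (- q_i x) (- q_j x) (- q_k x)"

definition qone :: "'a::{zero,one} quat" where
  "qone = Quat 1 0 0 0"

lemma quat_coords [simp]:
  "q_1 (0::'a::ab_group_add quat) = 0" "q_i (0::'a quat) = 0" "q_j (0::'a quat) = 0" "q_k (0::'a quat) = 0"
  "q_1 (x + y :: 'a quat) = q_1 x + q_1 y" "q_i (x + y) = q_i x + q_i y"
  "q_j (x + y) = q_j x + q_j y" "q_k (x + y) = q_k x + q_k y"
  "q_1 (- x) = - q_1 x" "q_i (- x) = - q_i x" "q_j (- x) = - q_j x" "q_k (- x) = - q_k x"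
  "q_1 (x - y) = q_1 x - q_1 y" "q_i (x - y) = q_i x - q_i y"
  "q_j (x - y) = q_j x - q_j y" "q_k (x - y) = q_k x - q_k y"
  by (auto simp: zero_quat_def plus_quat_def uminus_quat_def minus_quat_def)

lemma scl_coords [simp]:
  "q_1 (scl r x) = r * q_1 x" "q_i (scl r x) = r * q_i x"
  "q_j (scl r x) = r * q_j x" "q_k (scl r x) = r * q_k x"
  by (auto simp: scl_def)

lemma qcnj_coords [simp]:
  "q_1 (qcnj x) = q_1 x" "q_i (qcnj x) = - q_i x" "q_j (qcnj x) = - q_j x" "q_k (qcnj x) = - q_k x"
  by (auto simp: qcnj_def)

lemma qone_coords [simp]:
  "q_1 qone = 1" "q_i qone = 0" "q_j qone = 0" "q_k qone = 0"
  by (auto simp: qone_def)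

lemma qmul_coords [simp]:
  "q_1 (qmul a b x y) = q_1 x * q_1 y + a * (q_i x * q_i y) + b * (q_j x * q_j y) - a * b * (q_k x * q_k y)"
  "q_i (qmul a b x y) = q_1 x * q_i y + q_i x * q_1 y + b * (q_k x * q_j y - q_j x * q_k y)"
  "q_j (qmul a b x y) = q_1 x * q_j y + q_j x * q_1 y + a * (q_i x * q_k y - q_k x * q_i y)"
  "q_k (qmul a b x y) = q_1 x * q_k y + q_k x * q_1 y + (q_i x * q_j y - q_j x * q_i y)"
  by (auto simp: qmul_def)

lemma scl_scl [simp]: "scl r (scl s x) = scl (r * s) (x :: 'a::comm_ring_1 quat)"
  and scl_1 [simp]: "scl 1 x = (x :: 'a::comm_ring_1 quat)"
  and scl_0 [simp]: "scl 0 x = (0 :: 'a::comm_ring_1 quat)"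
  and scl_zero [simp]: "scl r 0 = (0 :: 'a::comm_ring_1 quat)"
  and scl_minus [simp]: "scl (- r) x = - scl r (x :: 'a::comm_ring_1 quat)"
  by (rule quat_eqI; simp add: algebra_simps)+

lemma scl_add_left: "scl (r + s) x = scl r x + scl s (x :: 'a::comm_ring_1 quat)"
  and scl_diff_left: "scl (r - s) x = scl r x - scl s (x :: 'a::comm_ring_1 quat)"
  and scl_add_right: "scl r (x + y) = scl r x + scl r (y :: 'a::comm_ring_1 quat)"
  and scl_diff_right: "scl r (x - y) = scl r x - scl r (y :: 'a::comm_ring_1 quat)"
  and scl_minus_right: "scl r (- x) = - scl r (x :: 'a::comm_ring_1 quat)"
  by (rule quat_eqI; simp add: algebra_simps)+

lemma qmul_assoc: "qmul a b (qmul a b x y) z = qmul a b x (qmul a b y z)"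
  by (rule quat_eqI; simp add: algebra_simps)

lemma qmul_add_left: "qmul a b (x + y) z = qmul a b x z + qmul a b y z"
  and qmul_add_right: "qmul a b x (y + z) = qmul a b x y + qmul a b x z"
  and qmul_diff_left: "qmul a b (x - y) z = qmul a b x z - qmul a b y z"
  and qmul_diff_right: "qmul a b x (y - z) = qmul a b x y - qmul a b x z"
  and qmul_minus_left: "qmul a b (- x) z = - qmul a b x z"
  and qmul_minus_right: "qmul a b x (- z) = - qmul a b x z"
  and qmul_scl_left [simp]: "qmul a b (scl r x) z = scl r (qmul a b x z)"
  and qmul_scl_right [simp]: "qmul a b x (scl r z) = scl r (qmul a b x z)"
  and qmul_0_left [simp]: "qmul a b 0 x = 0"
  and qmul_0_right [simp]: "qmul a b x 0 = 0"
  and qmul_1_left [simp]: "qmul a b qone x = x"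
  and qmul_1_right [simp]: "qmul a b x qone = x"
  by (rule quat_eqI; simp add: algebra_simps)+

lemma qcnj_qmul: "qcnj (qmul a b x y) = qmul a b (qcnj y) (qcnj x)"
  by (rule quat_eqI; simp add: algebra_simps)

lemma qcnj_simps [simp]:
  "qcnj (qcnj x) = (x :: 'a::comm_ring_1 quat)"
  "qcnj (scl r x) = scl r (qcnj x :: 'a::comm_ring_1 quat)"
  "qcnj qone = (qone :: 'a::comm_ring_1 quat)"
  by (rule quat_eqI; simp)+

lemma qmul_qcnj_right: "qmul a b x (qcnj x) = scl (red_norm a b x) qone"
  and qmul_qcnj_left: "qmul a b (qcnj x) x = scl (red_norm a b x) qone"
  by (rule quat_eqI; simp add: red_norm_def power2_eq_square algebra_simps)+

lemma qcnj_eq: "qcnj x = scl (red_trace x) qone - x"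
  by (rule quat_eqI; simp add: red_trace_def)

lemma red_norm_qmul: "red_norm a b (qmul a b x y) = red_norm a b x * red_norm a b y"
  unfolding red_norm_def by (simp add: power2_eq_square algebra_simps)

lemma red_norm_simps [simp]:
  "red_norm a b (scl r x) = r\<^sup>2 * red_norm a b x"
  "red_norm a b (qcnj x) = red_norm a b x"
  "red_norm a b (- x) = red_norm a b x"
  "red_norm a b qone = 1"
  "red_norm a b 0 = 0"
  unfolding red_norm_def by (simp_all add: power_mult_distrib algebra_simps)

lemma red_norm_add:
  "red_norm a b (x + y) = red_norm a b x + red_norm a b y + red_trace (qmul a b x (qcnj y))"
  and red_norm_diff:
  "red_norm a b (x - y) = red_norm a b x + red_norm a b y - red_trace (qmul a b x (qcnj y))"
  unfolding red_norm_def red_trace_def by (simp_all add: power2_eq_square algebra_simps)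

lemma red_trace_simps [simp]:
  "red_trace (scl r x) = r * red_trace x"
  "red_trace (x + y) = red_trace x + red_trace y"
  "red_trace (x - y) = red_trace x - red_trace y"
  "red_trace (- x) = - red_trace x"
  "red_trace (qcnj x) = red_trace x"
  "red_trace qone = 2"
  "red_trace 0 = 0"
  unfolding red_trace_def by (simp_all add: algebra_simps)

text \<open>Cayley-Hamilton. It yields the traces of squares at p and reduces \<open>y y\<close>
  when \<open>R + R y\<close> is shown to be closed under products.\<close>

lemma qmul_self: "qmul a b x x = scl (red_trace x) x - scl (red_norm a b x) qone"
  by (rule quat_eqI; simp add: red_trace_def red_norm_def power2_eq_square algebra_simps)


section \<open>The ring records of the statement in terms of type class operations\<close>

lemma a_inv_type_algebra [simp]:
  "\<ominus>\<^bsub>(ring_of_type_algebra :: 'a::comm_ring_1 ring)\<^esub> x = - x"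
proof -
  interpret ring "ring_of_type_algebra :: 'a ring" by (rule ring_from_type_algebra)
  show ?thesis
    by (rule minus_equality) (auto simp: ring_of_type_algebra_def)
qed

lemma type_algebra_simps [simp]:
  "carrier (ring_of_type_algebra :: 'a::comm_ring_1 ring) = UNIV"
  "x \<oplus>\<^bsub>(ring_of_type_algebra :: 'a ring)\<^esub> y = x + y"
  "x \<otimes>\<^bsub>(ring_of_type_algebra :: 'a ring)\<^esub> y = x * y"
  "x \<ominus>\<^bsub>(ring_of_type_algebra :: 'a ring)\<^esub> y = x - y"
  "\<one>\<^bsub>(ring_of_type_algebra :: 'a ring)\<^esub> = 1"
  "\<zero>\<^bsub>(ring_of_type_algebra :: 'a ring)\<^esub> = 0"
  unfolding a_minus_def a_inv_type_algebra unfolding ring_of_type_algebra_def by simp_all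

lemma quat_Q_simps [simp]:
  "carrier (quat_Q a b) = UNIV"
  "ring.add (quat_Q a b) = (+)"
  "monoid.mult (quat_Q a b) = qmul a b"
  "\<one>\<^bsub>quat_Q a b\<^esub> = qone"
  "\<zero>\<^bsub>quat_Q a b\<^esub> = 0"
  by (simp_all add: quat_Q_def quat_alg_def plus_quat_def zero_quat_def qone_def qmul_def fun_eq_iff)

lemma comm_group_quat_Q: "comm_group (add_monoid (quat_Q a b))"
  by (rule comm_groupI) (auto simp: algebra_simps intro: exI[of _ "- _"])

lemma inv_quat_Q [simp]:
  "inv\<^bsub>\<lparr>carrier = UNIV, monoid.mult = (+), one = 0\<rparr>\<^esub> x = - (x :: rat quat)"
proof -
  interpret comm_group "add_monoid (quat_Q a b)" for a b by (rule comm_group_quat_Q)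
  have "inv\<^bsub>add_monoid (quat_Q 0 0)\<^esub> x = - x" by (rule inv_equality) auto
  then show ?thesis by simp
qed

lemma ring_quat_Q: "ring (quat_Q a b)"
proof (rule ringI)
  show "abelian_group (quat_Q a b)"
    using comm_group_quat_Q
    by (simp add: abelian_group_def abelian_group_axioms_def abelian_monoid_def comm_group_def)
  show "monoid (quat_Q a b)"
    by (rule monoidI) (auto simp: qmul_assoc)
qed (auto simp: qmul_add_left qmul_add_right)

lemma quat_scalar_type_algebra [simp]: "quat_scalar ring_of_type_algebra c = scl (c :: 'a::comm_ring_1) qone"
  by (simp add: quat_scalar_def scl_def)

section \<open>Additive subgroups and lattices in the rational algebra\<close>

definition addsub :: "'a::ab_group_add set \<Rightarrow> bool" where
  "addsub L \<longleftrightarrow> 0 \<in> L \<and> (\<forall>x\<in>L. \<forall>y\<in>L. x - y \<in> L)"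

lemma addsubD:
  assumes "addsub L"
  shows "0 \<in> L" "x \<in> L \<Longrightarrow> y \<in> L \<Longrightarrow> x - y \<in> L" "x \<in> L \<Longrightarrow> - x \<in> L"
    "x \<in> L \<Longrightarrow> y \<in> L \<Longrightarrow> x + y \<in> L"
proof -
  show 0: "0 \<in> L" and d: "\<And>x y. x \<in> L \<Longrightarrow> y \<in> L \<Longrightarrow> x - y \<in> L"
    using assms by (auto simp: addsub_def)
  show m: "\<And>x. x \<in> L \<Longrightarrow> - x \<in> L" using d[OF 0] by simp
  show "x \<in> L \<Longrightarrow> y \<in> L \<Longrightarrow> x + y \<in> L" using d[of x "- y"] m by simp
qed

lemma addsub_scl_int:
  fixes L :: "'a::comm_ring_1 quat set"
  assumes "addsub L" "x \<in> L"
  shows "scl (of_int n) x \<in> L"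
proof -
  have nat: "scl (of_nat m) x \<in> L" for m
    by (induction m) (auto simp: scl_add_left addsubD[OF assms(1)] assms(2))
  show ?thesis
  proof (cases n)
    case (nonneg m) then show ?thesis using nat[of m] by simp
  next
    case (neg m)
    then show ?thesis using addsubD(3)[OF assms(1) nat[of "Suc m"]]
      by (simp add: scl_minus[symmetric] del: scl_minus)
  qed
qed

lemma addsub_scl_Ints:
  fixes L :: "rat quat set"
  assumes "addsub L" "x \<in> L" "r \<in> \<int>"
  shows "scl r x \<in> L"
  using assms by (auto elim!: Ints_cases intro: addsub_scl_int)

lemma addsub_generate: "addsub (generate (add_monoid (quat_Q a b)) G)"
  and generate_least: "addsub L \<Longrightarrow> G \<subseteq> L \<Longrightarrow> generate (add_monoid (quat_Q a b)) G \<subseteq> L"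
proof -
  interpret comm_group "add_monoid (quat_Q a b)" by (rule comm_group_quat_Q)
  have sg: "subgroup (generate (add_monoid (quat_Q a b)) G) (add_monoid (quat_Q a b))"
    by (rule generate_is_subgroup) auto
  show "addsub (generate (add_monoid (quat_Q a b)) G)"
    using subgroup.one_closed[OF sg] subgroup.m_closed[OF sg] subgroup.m_inv_closed[OF sg]
    by (fastforce simp: addsub_def diff_conv_add_uminus simp del: add_uminus_conv_diff)
  assume L: "addsub L" "G \<subseteq> L"
  have "x \<in> L" if "x \<in> generate (add_monoid (quat_Q a b)) G" for x
    using that by (induction) (use L in \<open>auto intro: addsubD\<close>)
  then show "generate (add_monoid (quat_Q a b)) G \<subseteq> L" by blast
qed

text \<open>The standard lattice spanned by 1, i, j, k, with which all others are compared. It need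
  not be a ring, a and b being arbitrary rationals.\<close>

definition intq :: "rat quat \<Rightarrow> bool" where
  "intq x \<longleftrightarrow> q_1 x \<in> \<int> \<and> q_i x \<in> \<int> \<and> q_j x \<in> \<int> \<and> q_k x \<in> \<int>"

lemma Ints_common_denominator:
  fixes r :: rat
  shows "\<exists>m::int. m > 0 \<and> of_int m * r \<in> \<int>"
proof (cases r)
  case (Fract n d)
  then show ?thesis by (intro exI[of _ d]) (auto simp: Fract_of_int_quotient)
qed

lemma intq_scl: "intq x \<Longrightarrow> r \<in> \<int> \<Longrightarrow> intq (scl r x)"
  by (auto simp: intq_def)

lemma intq_common_denominator: "\<exists>m::int. m > 0 \<and> intq (scl (of_int m) x)"
proof -
  obtain m1 m2 m3 m4 :: int where m: "m1 > 0" "m2 > 0" "m3 > 0" "m4 > 0"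
    and i: "of_int m1 * q_1 x \<in> \<int>" "of_int m2 * q_i x \<in> \<int>" "of_int m3 * q_j x \<in> \<int>" "of_int m4 * q_k x \<in> \<int>"
    using Ints_common_denominator by metis
  have "of_int (m2*m3*m4) * (of_int m1 * q_1 x) \<in> \<int>" "of_int (m1*m3*m4) * (of_int m2 * q_i x) \<in> \<int>"
    "of_int (m1*m2*m4) * (of_int m3 * q_j x) \<in> \<int>" "of_int (m1*m2*m3) * (of_int m4 * q_k x) \<in> \<int>"
    using i by (blast intro: Ints_mult Ints_of_int)+
  then have "intq (scl (of_int (m1*m2*m3*m4)) x)"
    by (auto simp: intq_def algebra_simps)
  then show ?thesis using m by (intro exI[of _ "m1*m2*m3*m4"]) auto
qed

text \<open>\<open>full\<close> and \<open>bdd\<close> are the two halves of being commensurable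
  with the standard lattice. They are kept apart because the first passes to larger sets and the
  second to smaller ones.\<close>

definition full :: "rat quat set \<Rightarrow> bool" where
  "full L \<longleftrightarrow> (\<exists>D::int. D > 0 \<and> (\<forall>x. intq x \<longrightarrow> scl (of_int D) x \<in> L))"

definition bdd :: "rat quat set \<Rightarrow> bool" where
  "bdd L \<longleftrightarrow> (\<exists>M::int. M > 0 \<and> (\<forall>x\<in>L. intq (scl (of_int M) x)))"

lemma bdd_finite: "finite G \<Longrightarrow> bdd G"
proof (induction rule: finite_induct)
  case empty
  show ?case unfolding bdd_def by (intro exI[of _ 1]) auto
next
  case (insert x G)
  then obtain M :: int where M: "M > 0" "\<forall>x\<in>G. intq (scl (of_int M) x)" by (auto simp: bdd_def)
  obtain m :: int where m: "m > 0" "intq (scl (of_int m) x)" using intq_common_denominator by blast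
  have "intq (scl (of_int (M * m)) y)" if "y \<in> insert x G" for y
  proof (cases "y = x")
    case True
    then show ?thesis using intq_scl[OF m(2), of "of_int M"] by simp
  next
    case False
    then show ?thesis using M(2) that intq_scl[of "scl (of_int M) y" "of_int m"] by (simp add: mult.commute)
  qed
  then show ?case unfolding bdd_def using M m by (intro exI[of _ "M * m"]) auto
qed

lemma addsub_intq: "addsub {x. intq (scl r x)}"
  by (auto simp: addsub_def intq_def algebra_simps)

lemma bdd_generate:
  assumes "bdd G" shows "bdd (generate (add_monoid (quat_Q a b)) G)"
proof -
  obtain M :: int where M: "M > 0" "G \<subseteq> {x. intq (scl (of_int M) x)}" using assms by (auto simp: bdd_def)
  have "generate (add_monoid (quat_Q a b)) G \<subseteq> {x. intq (scl (of_int M) x)}"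
    by (rule generate_least[OF addsub_intq M(2)])
  then show ?thesis unfolding bdd_def using M(1) by blast
qed

lemma fullI:
  assumes L: "addsub L" and D: "\<And>x. \<exists>D::int. D > 0 \<and> scl (of_int D) x \<in> L"
  shows "full L"
proof -
  obtain d1 d2 d3 d4 :: int where d: "d1 > 0" "d2 > 0" "d3 > 0" "d4 > 0"
    and i: "scl (of_int d1) (Quat 1 0 0 0) \<in> L" "scl (of_int d2) (Quat 0 1 0 0) \<in> L"
      "scl (of_int d3) (Quat 0 0 1 0) \<in> L" "scl (of_int d4) (Quat 0 0 0 1) \<in> L"
    using D by metis
  have "scl (of_int (d1*d2*d3*d4)) x \<in> L" if x: "intq x" for x
  proof -
    have "scl (of_int (d2*d3*d4) * q_1 x) (scl (of_int d1) (Quat 1 0 0 0)) +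
      scl (of_int (d1*d3*d4) * q_i x) (scl (of_int d2) (Quat 0 1 0 0)) +
      scl (of_int (d1*d2*d4) * q_j x) (scl (of_int d3) (Quat 0 0 1 0)) +
      scl (of_int (d1*d2*d3) * q_k x) (scl (of_int d4) (Quat 0 0 0 1)) \<in> L" (is "?s \<in> _")
      by (intro addsubD(4)[OF L] addsub_scl_Ints[OF L] i) (use x in \<open>auto simp: intq_def\<close>)
    also have "?s = scl (of_int (d1*d2*d3*d4)) x"
      by (rule quat_eqI; simp add: algebra_simps)
    finally show ?thesis .
  qed
  then show ?thesis unfolding full_def using d by (intro exI[of _ "d1*d2*d3*d4"]) auto
qed

lemma fullD:
  assumes "full L"
  shows "\<exists>D::int. D > 0 \<and> scl (of_int D) x \<in> L"
proof -
  obtain D :: int where D: "D > 0" "\<And>x. intq x \<Longrightarrow> scl (of_int D) x \<in> L" using assms by (auto simp: full_def)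
  obtain m :: int where m: "m > 0" "intq (scl (of_int m) x)" using intq_common_denominator by blast
  show ?thesis using D(2)[OF m(2)] D(1) m(1) by (intro exI[of _ "D * m"]) auto
qed

lemma scalar_set_mult:
  "range (quat_scalar ring_of_type_algebra) <#>\<^bsub>quat_Q a b\<^esub> L = {scl r x | r x. x \<in> L}"
  by (auto simp: set_mult_def)

text \<open>The difficult point from right to left is finite generation. L contains D times the
  standard lattice; subtracting an element of the latter brings all coordinates into [0, D], and
  denominators being bounded, only finitely many such elements of L exist.\<close>

lemma is_lattice_iff: "is_lattice a b L \<longleftrightarrow> addsub L \<and> full L \<and> bdd L"
proof
  assume lat: "is_lattice a b L"
  then obtain G where G: "finite G" "L = generate (add_monoid (quat_Q a b)) G" by (auto simp: is_lattice_def)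
  have L: "addsub L" using G addsub_generate by blast
  have "\<exists>D::int. D > 0 \<and> scl (of_int D) x \<in> L" for x
  proof -
    define H where "H = {scl r x | r x. x \<in> L}"
    have "x \<in> generate (add_monoid (quat_Q a b)) H"
      using lat unfolding is_lattice_def scalar_span_def scalar_set_mult H_def by simp
    then show ?thesis
    proof induction
      case one
      show ?case using addsubD(1)[OF L] by (intro exI[of _ 1]) auto
    next
      case (incl h)
      then obtain r x where h: "h = scl r x" "x \<in> L" by (auto simp: H_def)
      obtain m :: int where "m > 0" "of_int m * r \<in> \<int>" using Ints_common_denominator by blast
      then show ?case using addsub_scl_Ints[OF L h(2)] h by auto
    next
      case (inv h)
      then obtain r x where h: "h = scl r x" "x \<in> L" by (auto simp: H_def)
      obtain m :: int where "m > 0" "of_int m * r \<in> \<int>" using Ints_common_denominator by blast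
      then show ?case using addsubD(3)[OF L addsub_scl_Ints[OF L h(2)]] h
        by (auto simp: scl_minus_right)
    next
      case (eng h1 h2)
      then obtain m n :: int where m: "m > 0" "scl (of_int m) h1 \<in> L" and n: "n > 0" "scl (of_int n) h2 \<in> L"
        by blast
      have "scl (of_int n) (scl (of_int m) h1) + scl (of_int m) (scl (of_int n) h2) \<in> L"
        by (intro addsubD(4)[OF L] addsub_scl_int[OF L] m n)
      then show ?case using m n
        by (intro exI[of _ "m * n"]) (auto simp: scl_add_right mult.commute)
    qed
  qed
  then have "full L" by (rule fullI[OF L])
  then show "addsub L \<and> full L \<and> bdd L"
    using L bdd_generate[OF bdd_finite[OF G(1)]] G(2) by simp
next
  assume "addsub L \<and> full L \<and> bdd L"
  then have L: "addsub L" and f: "full L" and "bdd L" by auto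
  obtain D :: int where D: "D > 0" "\<And>x. intq x \<Longrightarrow> scl (of_int D) x \<in> L" using f by (auto simp: full_def)
  obtain M :: int where M: "M > 0" "\<And>x. x \<in> L \<Longrightarrow> intq (scl (of_int M) x)" using \<open>bdd L\<close> by (auto simp: bdd_def)
  \<comment> \<open>The fractions with denominator M between 0 and D: all coordinates that a reduced
    element of L can have.\<close>
  define B where "B = (\<lambda>n::int. of_int n / of_int M :: rat) ` {0..M * D}"
  have BI: "r \<in> B" if "of_int M * r \<in> \<int>" "0 \<le> r" "r \<le> of_int D" for r
  proof -
    obtain n where n: "of_int M * r = of_int n" using \<open>of_int M * r \<in> \<int>\<close> by (auto elim: Ints_cases)
    have "(0::rat) \<le> of_int n" unfolding n[symmetric] using M that by simp
    moreover have "(of_int n::rat) \<le> of_int (M * D)" unfolding n[symmetric] using M that by simp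
    ultimately have "n \<in> {0..M*D}" by (simp only: of_int_0_le_iff of_int_le_iff atLeastAtMost_iff simp_thms)
    moreover have "r = of_int n / of_int M" using n M by (simp add: field_simps)
    ultimately show ?thesis by (auto simp: B_def)
  qed
  define G where "G = L \<inter> (\<lambda>(r,s,t,u). Quat r s t u) ` (B \<times> B \<times> B \<times> B)"
  have fin: "finite G" by (auto simp: G_def B_def)
  have GI: "x \<in> G" if "x \<in> L" "0 \<le> q_1 x" "q_1 x \<le> of_int D" "0 \<le> q_i x" "q_i x \<le> of_int D"
    "0 \<le> q_j x" "q_j x \<le> of_int D" "0 \<le> q_k x" "q_k x \<le> of_int D" for x
  proof -
    have "(q_1 x, q_i x, q_j x, q_k x) \<in> B \<times> B \<times> B \<times> B"
      using M(2)[OF that(1)] that by (auto intro!: BI simp: intq_def)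
    then show ?thesis using that(1) unfolding G_def by (auto intro!: image_eqI[of _ _ "(q_1 x, q_i x, q_j x, q_k x)"])
  qed
  let ?S = "generate (add_monoid (quat_Q a b)) G"
  have S: "addsub ?S" by (rule addsub_generate)
  have e: "scl (of_int D) (Quat 1 0 0 0) \<in> ?S" "scl (of_int D) (Quat 0 1 0 0) \<in> ?S"
    "scl (of_int D) (Quat 0 0 1 0) \<in> ?S" "scl (of_int D) (Quat 0 0 0 1) \<in> ?S"
    using D by (auto intro!: generate.incl GI D(2) simp: intq_def)
  have "L \<subseteq> ?S"
  proof
    fix x assume x: "x \<in> L"
    define f where "f = (\<lambda>r::rat. of_int \<lfloor>r / of_int D\<rfloor> :: rat)"
    have f: "f r \<in> \<int>" "0 \<le> r - of_int D * f r" "r - of_int D * f r \<le> of_int D" for r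
    proof -
      show "f r \<in> \<int>" by (simp add: f_def)
      have 1: "r = of_int D * (r / of_int D)" using D by simp
      have "f r \<le> r / of_int D" by (simp add: f_def)
      then have "of_int D * f r \<le> of_int D * (r / of_int D)" using D by (intro mult_left_mono) auto
      then show "0 \<le> r - of_int D * f r" using 1 by simp
      have "r / of_int D \<le> f r + 1" unfolding f_def by linarith
      then have "of_int D * (r / of_int D) \<le> of_int D * (f r + 1)" using D by (intro mult_left_mono) auto
      then show "r - of_int D * f r \<le> of_int D" using 1 by (simp add: algebra_simps)
    qed
    define y where "y = Quat (f (q_1 x)) (f (q_i x)) (f (q_j x)) (f (q_k x))"
    have y: "intq y" using f(1) by (simp add: intq_def y_def)
    have "x - scl (of_int D) y \<in> G"
      by (rule GI) (use f x y in \<open>auto intro!: addsubD[OF L] D simp: y_def\<close>)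
    then have 1: "x - scl (of_int D) y \<in> ?S" by (rule generate.incl)
    have "scl (f (q_1 x)) (scl (of_int D) (Quat 1 0 0 0)) + scl (f (q_i x)) (scl (of_int D) (Quat 0 1 0 0)) +
      scl (f (q_j x)) (scl (of_int D) (Quat 0 0 1 0)) + scl (f (q_k x)) (scl (of_int D) (Quat 0 0 0 1)) \<in> ?S" (is "?s \<in> _")
      by (intro addsubD(4)[OF S] addsub_scl_Ints[OF S] e f)
    also have "?s = scl (of_int D) y"
      by (rule quat_eqI; simp add: y_def)
    finally have "(x - scl (of_int D) y) + scl (of_int D) y \<in> ?S" by (intro addsubD(4)[OF S] 1)
    then show "x \<in> ?S" by simp
  qed
  moreover have "?S \<subseteq> L" by (rule generate_least[OF L]) (auto simp: G_def)
  ultimately have "L = ?S" by blast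
  moreover have "x \<in> scalar_span (quat_Q a b) (range (quat_scalar ring_of_type_algebra)) L" for x
  proof -
    obtain n :: int where n: "n > 0" "scl (of_int n) x \<in> L" using fullD[OF f] by blast
    then have "x = scl (1 / of_int n) (scl (of_int n) x)" by simp
    then show ?thesis unfolding scalar_span_def scalar_set_mult using n(2) by (blast intro: generate.incl)
  qed
  ultimately show "is_lattice a b L" unfolding is_lattice_def using fin by auto
qed

lemma is_order_iff:
  "is_order a b L \<longleftrightarrow> addsub L \<and> full L \<and> bdd L \<and> qone \<in> L \<and> (\<forall>x\<in>L. \<forall>y\<in>L. qmul a b x y \<in> L)"
proof -
  interpret ring "quat_Q a b" by (rule ring_quat_Q)
  have [simp]: "\<ominus>\<^bsub>quat_Q a b\<^esub> x = - x" for x by (simp add: a_inv_def)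
  have "subring L (quat_Q a b) \<longleftrightarrow> addsub L \<and> qone \<in> L \<and> (\<forall>x\<in>L. \<forall>y\<in>L. qmul a b x y \<in> L)"
  proof
    assume s: "subring L (quat_Q a b)"
    then show "addsub L \<and> qone \<in> L \<and> (\<forall>x\<in>L. \<forall>y\<in>L. qmul a b x y \<in> L)"
      using subringE[OF s]
      by (fastforce simp: addsub_def diff_conv_add_uminus simp del: add_uminus_conv_diff)
  next
    assume "addsub L \<and> qone \<in> L \<and> (\<forall>x\<in>L. \<forall>y\<in>L. qmul a b x y \<in> L)"
    then show "subring L (quat_Q a b)"
      by (intro subringI) (auto intro: addsubD)
  qed
  then show ?thesis unfolding is_order_def is_lattice_iff by blast
qed


section \<open>Rationals integral at a prime\<close>

text \<open>The local ring of the rationals at l. The encoding by an integer multiplier prime to l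
  treats 0 like any other element and carries over to quaternions in \<open>loc\<close>.\<close>

definition lint :: "nat \<Rightarrow> rat set" where
  "lint l = {r. \<exists>m::int. \<not> int l dvd m \<and> of_int m * r \<in> \<int>}"

definition vge :: "nat \<Rightarrow> nat \<Rightarrow> rat \<Rightarrow> bool" where
  "vge l k r \<longleftrightarrow> r / of_nat l ^ k \<in> lint l"

locale rational_prime =
  fixes l :: nat
  assumes prime: "Factorial_Ring.prime l"
begin

lemma prime_int: "Factorial_Ring.prime (int l)"
  using prime by simp

lemma gt_1: "l > 1"
  using prime by (rule prime_gt_1_nat)

lemma of_nat_pos [simp]: "(of_nat l :: rat) > 0" "(of_nat l :: rat) \<noteq> 0" "l \<noteq> 0" "l > 0"
  using gt_1 by auto

lemma not_dvd_mult: "\<not> int l dvd m \<Longrightarrow> \<not> int l dvd n \<Longrightarrow> \<not> int l dvd m * n"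
  using prime_int by (simp add: prime_dvd_mult_iff)

lemma not_dvd_1 [simp]: "\<not> int l dvd 1" "l \<noteq> Suc 0"
  using gt_1 by (auto simp: zdvd1_eq)

lemma lint_Ints: "r \<in> \<int> \<Longrightarrow> r \<in> lint l"
  unfolding lint_def by (auto intro!: exI[of _ 1])

lemma lint_of_int [simp]: "of_int n \<in> lint l" "of_nat k \<in> lint l" "0 \<in> lint l" "1 \<in> lint l" "numeral w \<in> lint l"
  by (auto intro: lint_Ints)

lemma lint_add [intro]: "r \<in> lint l \<Longrightarrow> s \<in> lint l \<Longrightarrow> r + s \<in> lint l"
proof -
  assume "r \<in> lint l" "s \<in> lint l"
  then obtain m n where mn: "\<not> int l dvd m" "of_int m * r \<in> \<int>" "\<not> int l dvd n" "of_int n * s \<in> \<int>"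
    unfolding lint_def by auto
  have "of_int n * (of_int m * r) + of_int m * (of_int n * s) \<in> \<int>"
    by (rule Ints_add[OF Ints_mult[OF Ints_of_int mn(2)] Ints_mult[OF Ints_of_int mn(4)]])
  then have "of_int (m * n) * (r + s) \<in> \<int>" by (simp add: algebra_simps)
  then show ?thesis using not_dvd_mult[OF mn(1,3)] unfolding lint_def by blast
qed

lemma lint_mult [intro]: "r \<in> lint l \<Longrightarrow> s \<in> lint l \<Longrightarrow> r * s \<in> lint l"
proof -
  assume "r \<in> lint l" "s \<in> lint l"
  then obtain m n where mn: "\<not> int l dvd m" "of_int m * r \<in> \<int>" "\<not> int l dvd n" "of_int n * s \<in> \<int>"
    unfolding lint_def by auto
  have "(of_int m * r) * (of_int n * s) \<in> \<int>" by (rule Ints_mult[OF mn(2,4)])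
  then have "of_int (m * n) * (r * s) \<in> \<int>" by (simp add: algebra_simps)
  then show ?thesis using not_dvd_mult[OF mn(1,3)] unfolding lint_def by blast
qed

lemma lint_minus [simp]: "- r \<in> lint l \<longleftrightarrow> r \<in> lint l"
  unfolding lint_def by simp

lemma lint_diff [intro]: "r \<in> lint l \<Longrightarrow> s \<in> lint l \<Longrightarrow> r - s \<in> lint l"
  using lint_add[of r "- s"] by simp

lemma lint_power [intro]: "r \<in> lint l \<Longrightarrow> r ^ k \<in> lint l"
  by (induction k) auto

lemma lint_of_nat_power [simp]: "of_nat l ^ c \<in> lint l"
  by (rule lint_power) simp

lemma lint_inverse_int: "\<not> int l dvd m \<Longrightarrow> 1 / of_int m \<in> lint l"
  unfolding lint_def by (auto intro!: exI[of _ m])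

lemma lint_div_int: "\<not> int l dvd m \<Longrightarrow> r \<in> lint l \<Longrightarrow> r / of_int m \<in> lint l"
  using lint_mult[OF lint_inverse_int[of m], of r] by simp

lemma vge_0 [simp]: "vge l 0 r \<longleftrightarrow> r \<in> lint l"
  by (simp add: vge_def)

lemma vge_zero [simp]: "vge l k 0"
  by (simp add: vge_def)

lemma vge_add [intro]: "vge l k r \<Longrightarrow> vge l k s \<Longrightarrow> vge l k (r + s)"
  by (auto simp: vge_def add_divide_distrib)

lemma vge_minus [simp]: "vge l k (- r) \<longleftrightarrow> vge l k r"
  by (simp add: vge_def)

lemma vge_diff [intro]: "vge l k r \<Longrightarrow> vge l k s \<Longrightarrow> vge l k (r - s)"
  by (auto simp: vge_def diff_divide_distrib)

lemma vge_mult: "vge l j r \<Longrightarrow> vge l k s \<Longrightarrow> vge l (j + k) (r * s)"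
  using lint_mult[of "r / of_nat l ^ j" "s / of_nat l ^ k"] by (simp add: vge_def power_add)

lemma vge_mult_left: "r \<in> lint l \<Longrightarrow> vge l k s \<Longrightarrow> vge l k (r * s)"
  using vge_mult[of 0 r k s] by simp

lemma vge_mult_right: "vge l k r \<Longrightarrow> s \<in> lint l \<Longrightarrow> vge l k (r * s)"
  using vge_mult[of k r 0 s] by simp

lemma vge_lint: "vge l k r \<Longrightarrow> r \<in> lint l"
  using lint_mult[OF _ lint_power[OF lint_of_int(2)], of "r / of_nat l ^ k" l k] by (simp add: vge_def)

lemma vge_mono: "vge l k r \<Longrightarrow> j \<le> k \<Longrightarrow> vge l j r"
proof -
  assume "vge l k r" "j \<le> k"
  then obtain d where d: "k = j + d" using le_Suc_ex by blast
  have "r / of_nat l ^ j = (r / of_nat l ^ k) * of_nat l ^ d" by (simp add: d power_add)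
  moreover have "(r / of_nat l ^ k) * of_nat l ^ d \<in> lint l"
    using \<open>vge l k r\<close> unfolding vge_def by (intro lint_mult lint_power) auto
  ultimately show ?thesis by (simp add: vge_def)
qed

lemma vge_of_nat_power [simp]: "vge l k (of_nat l ^ k)"
  by (simp add: vge_def)

lemma vge_of_nat_power_mult: "vge l (k + j) (of_nat l ^ k * r) \<longleftrightarrow> vge l j r"
  by (simp add: vge_def power_add)

lemma vge_of_nat [simp]: "vge l (Suc 0) (of_nat l)"
  by (simp add: vge_def)

lemma vge_of_int_iff: "vge l k (of_int n) \<longleftrightarrow> int l ^ k dvd n"
proof
  assume "vge l k (of_int n)"
  then obtain m j where m: "\<not> int l dvd m" and "of_int m * (of_int n / of_nat l ^ k) = (of_int j :: rat)"
    by (auto simp: vge_def lint_def elim!: Ints_cases)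
  then have "(of_int (m * n) :: rat) = of_int (j * int l ^ k)" by (simp add: field_simps)
  then have "m * n = j * int l ^ k" by (simp only: of_int_eq_iff)
  then have "int l ^ k dvd m * n" by simp
  moreover have "coprime (int l ^ k) m"
    using m prime_int by (simp add: prime_imp_coprime)
  ultimately show "int l ^ k dvd n" by (simp add: coprime_dvd_mult_right_iff)
next
  assume "int l ^ k dvd n"
  then obtain j where "n = int l ^ k * j" by blast
  then show "vge l k (of_int n)" by (simp add: vge_def)
qed

text \<open>The part of the denominator prime to l does not affect either side, and the l-part
  shifts the exponent; what remains is divisibility of the numerator.\<close>

lemma padic_val_le_iff:
  assumes "r \<noteq> 0"
  shows "vge l k r \<longleftrightarrow> int k \<le> padic_val l r"
proof -
  obtain n d where q: "quotient_of r = (n, d)" by (cases "quotient_of r")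
  have r: "r = of_int n / of_int d" and d: "d > 0" and n: "n \<noteq> 0"
    using quotient_of_div[OF q] quotient_of_denom_pos[OF q] assms by auto
  have ni: "\<not> is_unit (int l)" using prime_int by (simp add: not_prime_unit)
  obtain d' where d': "d = int l ^ multiplicity (int l) d * d'" "\<not> int l dvd d'"
    using multiplicity_decompose'[of d "int l"] d ni by auto
  let ?f = "multiplicity (int l) d" and ?e = "multiplicity (int l) n"
  have d'0: "d' \<noteq> 0" using d' d by auto
  have rd: "of_int d' * r = of_int n / of_nat l ^ ?f"
    using d'0 by (subst r, subst d'(1)) simp
  have "vge l k r \<longleftrightarrow> vge l k (of_int d' * r)"
  proof
    assume "vge l k (of_int d' * r)"
    then have "vge l k (1 / of_int d' * (of_int d' * r))" by (rule vge_mult_left[OF lint_inverse_int[OF d'(2)]])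
    then show "vge l k r" using d'0 by simp
  qed (auto intro: vge_mult_left)
  also have "\<dots> \<longleftrightarrow> vge l (?f + k) (of_nat l ^ ?f * (of_int n / of_nat l ^ ?f))"
    unfolding rd vge_of_nat_power_mult ..
  also have "\<dots> \<longleftrightarrow> int l ^ (?f + k) dvd n" by (simp add: vge_of_int_iff)
  also have "\<dots> \<longleftrightarrow> ?f + k \<le> ?e" using n ni by (simp add: power_dvd_iff_le_multiplicity)
  also have "\<dots> \<longleftrightarrow> int k \<le> padic_val l r" by (auto simp: padic_val_def q)
  finally show ?thesis .
qed

section \<open>Absolute value, Cauchy sequences and null sequences in terms of exponents\<close>

lemma padic_abs_le_iff: "padic_abs l r \<le> of_nat l powi (- int k) \<longleftrightarrow> vge l k r"
proof (cases "r = 0")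
  case False
  have "(1::rat) < of_nat l" using gt_1 by simp
  then have "(of_nat l :: rat) powi (- padic_val l r) \<le> of_nat l powi (- int k) \<longleftrightarrow> - padic_val l r \<le> - int k"
    by (meson not_le power_int_increasing power_int_strict_increasing less_imp_le)
  then show ?thesis using False by (simp add: padic_abs_def padic_val_le_iff)
qed (simp add: padic_abs_def)

lemma padic_abs_le_1_iff: "padic_abs l r \<le> 1 \<longleftrightarrow> r \<in> lint l"
  using padic_abs_le_iff[of r 0] by simp

text \<open>Since k < 2^k \<le> l^k, some power of 1/l is below e. This replaces every epsilon by an
  exponent.\<close>

lemma eventually_small:
  assumes "(e::rat) > 0"
  shows "\<exists>k. \<forall>r. vge l k r \<longrightarrow> padic_abs l r < e"
proof -
  obtain k where k: "inverse (of_nat (Suc k)) < e" using reals_Archimedean[OF assms] by blast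
  have "of_nat (Suc k) \<le> (of_nat l ^ Suc k :: rat)"
  proof -
    have "Suc k < 2 ^ Suc k" by (rule less_exp)
    also have "\<dots> \<le> l ^ Suc k" using gt_1 by (intro power_mono) auto
    finally have "Suc k \<le> l ^ Suc k" by simp
    then show ?thesis by (metis of_nat_le_iff of_nat_power)
  qed
  then have "inverse (of_nat l ^ Suc k :: rat) \<le> inverse (of_nat (Suc k))"
    by (intro le_imp_inverse_le) auto
  then have "inverse (of_nat l ^ Suc k :: rat) < e" using k by (rule le_less_trans)
  then have "of_nat l powi (- int (Suc k)) < e" unfolding power_int_minus power_int_of_nat .
  then show ?thesis using padic_abs_le_iff[of _ "Suc k"] by (intro exI[of _ "Suc k"]) (auto intro: le_less_trans)
qed

lemma padic_small_vge: "padic_abs l r < of_nat l powi (- int k) \<Longrightarrow> vge l k r"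
  using padic_abs_le_iff[of r k] by simp

lemma padic_Cauchy_iff:
  "padic_Cauchy l s \<longleftrightarrow> (\<forall>k. \<exists>M. \<forall>m\<ge>M. \<forall>n\<ge>M. vge l k (s m - s n))"
proof
  assume C: "padic_Cauchy l s"
  show "\<forall>k. \<exists>M. \<forall>m\<ge>M. \<forall>n\<ge>M. vge l k (s m - s n)"
  proof
    fix k
    have "(of_nat l powi (- int k) :: rat) > 0" by simp
    then show "\<exists>M. \<forall>m\<ge>M. \<forall>n\<ge>M. vge l k (s m - s n)"
      using C unfolding padic_Cauchy_def by (meson padic_small_vge)
  qed
qed (unfold padic_Cauchy_def, meson eventually_small)

lemma padic_null_iff:
  "padic_null l s \<longleftrightarrow> (\<forall>k. \<exists>M. \<forall>n\<ge>M. vge l k (s n))"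
proof
  assume C: "padic_null l s"
  show "\<forall>k. \<exists>M. \<forall>n\<ge>M. vge l k (s n)"
  proof
    fix k
    have "(of_nat l powi (- int k) :: rat) > 0" by simp
    then show "\<exists>M. \<forall>n\<ge>M. vge l k (s n)"
      using C unfolding padic_null_def by (meson padic_small_vge)
  qed
qed (unfold padic_null_def, meson eventually_small)

lemma lint_bounded: "\<exists>c. of_nat l ^ c * r \<in> lint l"
proof -
  obtain m :: int where m: "m > 0" "of_int m * r \<in> \<int>" using Ints_common_denominator by blast
  have ni: "\<not> is_unit (int l)" using prime_int by (simp add: not_prime_unit)
  obtain m' where m': "m = int l ^ multiplicity (int l) m * m'" "\<not> int l dvd m'"
    using multiplicity_decompose'[of m "int l"] m(1) ni by auto
  have "of_int m' * (of_nat l ^ multiplicity (int l) m * r) \<in> \<int>"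
    using m(2) by (subst (asm) m'(1)) (simp add: mult_ac)
  then show ?thesis using m'(2) unfolding lint_def by blast
qed

lemma lint_bounded_mono: "of_nat l ^ c * r \<in> lint l \<Longrightarrow> c \<le> d \<Longrightarrow> of_nat l ^ d * r \<in> lint l"
  using lint_mult[OF lint_of_nat_power, of "of_nat l ^ c * r" "d - c"]
  by (simp add: mult.assoc[symmetric] power_add[symmetric])

lemma Cauchy_bounded:
  assumes "padic_Cauchy l s"
  shows "\<exists>c. \<forall>n. of_nat l ^ c * s n \<in> lint l"
proof -
  obtain M where M: "\<forall>m\<ge>M. \<forall>n\<ge>M. vge l 0 (s m - s n)" using assms unfolding padic_Cauchy_iff by blast
  obtain f where f: "\<And>n. of_nat l ^ f n * s n \<in> lint l"
    using choice[of "\<lambda>n c. of_nat l ^ c * s n \<in> lint l"] lint_bounded by blast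
  define c where "c = Max (f ` {..M})"
  have small: "of_nat l ^ c * s n \<in> lint l" if "n \<le> M" for n
    by (rule lint_bounded_mono[OF f[of n]]) (use that in \<open>auto simp: c_def\<close>)
  have "of_nat l ^ c * s n \<in> lint l" if "n \<ge> M" for n
  proof -
    have "of_nat l ^ c * (s n - s M) + of_nat l ^ c * s M \<in> lint l"
      using M that by (intro lint_add small lint_mult[OF lint_of_nat_power]) auto
    then show ?thesis by (simp add: algebra_simps)
  qed
  then show ?thesis using small nat_le_linear by blast
qed

lemma Cauchy_const [simp]: "padic_Cauchy l (\<lambda>n. r)"
  by (simp add: padic_Cauchy_iff)

lemma Cauchy_add: 
  assumes "padic_Cauchy l s" "padic_Cauchy l t" shows "padic_Cauchy l (\<lambda>n. s n + t n)"
  unfolding padic_Cauchy_iff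
proof
  fix k
  obtain M N where "\<forall>m\<ge>M. \<forall>n\<ge>M. vge l k (s m - s n)" "\<forall>m\<ge>N. \<forall>n\<ge>N. vge l k (t m - t n)"
    using assms unfolding padic_Cauchy_iff by blast
  then have "\<forall>m\<ge>max M N. \<forall>n\<ge>max M N. vge l k ((s m - s n) + (t m - t n))" by auto
  then show "\<exists>M. \<forall>m\<ge>M. \<forall>n\<ge>M. vge l k (s m + t m - (s n + t n))"
    by (intro exI[of _ "max M N"]) (simp add: algebra_simps)
qed

lemma Cauchy_minus: "padic_Cauchy l s \<Longrightarrow> padic_Cauchy l (\<lambda>n. - s n)"
  unfolding padic_Cauchy_iff using vge_minus[of _ "s m - s n" for m n] by (simp add: algebra_simps)

lemma Cauchy_diff: "padic_Cauchy l s \<Longrightarrow> padic_Cauchy l t \<Longrightarrow> padic_Cauchy l (\<lambda>n. s n - t n)"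
  using Cauchy_add[OF _ Cauchy_minus] by simp

lemma vge_mult_bounded:
  assumes "of_nat l ^ c * r \<in> lint l" "vge l (c + k) s"
  shows "vge l k (r * s)"
proof -
  have "vge l (c + k) ((of_nat l ^ c * r) * s)" by (rule vge_mult_left[OF assms])
  then show ?thesis by (simp add: mult.assoc vge_of_nat_power_mult)
qed

lemma Cauchy_mult:
  assumes "padic_Cauchy l s" "padic_Cauchy l t" shows "padic_Cauchy l (\<lambda>n. s n * t n)"
  unfolding padic_Cauchy_iff
proof
  fix k
  obtain c d where c: "\<forall>n. of_nat l ^ c * s n \<in> lint l" and d: "\<forall>n. of_nat l ^ d * t n \<in> lint l"
    using Cauchy_bounded[OF assms(1)] Cauchy_bounded[OF assms(2)] by blast
  obtain M N where M: "\<forall>m\<ge>M. \<forall>n\<ge>M. vge l (d + k) (s m - s n)" and N: "\<forall>m\<ge>N. \<forall>n\<ge>N. vge l (c + k) (t m - t n)"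
    using assms unfolding padic_Cauchy_iff by blast
  have "vge l k (s m * t m - s n * t n)" if "m \<ge> max M N" "n \<ge> max M N" for m n
  proof -
    have "vge l k (s m * (t m - t n) + t n * (s m - s n))"
      using c d M N that by (intro vge_add vge_mult_bounded[of c] vge_mult_bounded[of d]) auto
    then show ?thesis by (simp add: algebra_simps)
  qed
  then show "\<exists>M. \<forall>m\<ge>M. \<forall>n\<ge>M. vge l k (s m * t m - s n * t n)" by blast
qed

lemma null_Cauchy: assumes "padic_null l s" shows "padic_Cauchy l s"
  unfolding padic_Cauchy_iff
proof
  fix k
  obtain M where "\<forall>n\<ge>M. vge l k (s n)" using assms unfolding padic_null_iff by blast
  then show "\<exists>M. \<forall>m\<ge>M. \<forall>n\<ge>M. vge l k (s m - s n)" by blast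
qed

lemma null_zero [simp]: "padic_null l (\<lambda>n. 0)"
  by (simp add: padic_null_iff)

lemma null_add:
  assumes "padic_null l s" "padic_null l t" shows "padic_null l (\<lambda>n. s n + t n)"
  unfolding padic_null_iff
proof
  fix k
  obtain M N where "\<forall>n\<ge>M. vge l k (s n)" "\<forall>n\<ge>N. vge l k (t n)"
    using assms unfolding padic_null_iff by blast
  then have "\<forall>n\<ge>max M N. vge l k (s n + t n)" by auto
  then show "\<exists>M. \<forall>n\<ge>M. vge l k (s n + t n)" by blast
qed

lemma null_minus: "padic_null l s \<Longrightarrow> padic_null l (\<lambda>n. - s n)"
  unfolding padic_null_iff by simp

lemma null_diff: "padic_null l s \<Longrightarrow> padic_null l t \<Longrightarrow> padic_null l (\<lambda>n. s n - t n)"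
  using null_add[OF _ null_minus] by simp

lemma null_mult_left:
  assumes "padic_Cauchy l s" "padic_null l t" shows "padic_null l (\<lambda>n. s n * t n)"
  unfolding padic_null_iff
proof
  fix k
  obtain c where c: "\<forall>n. of_nat l ^ c * s n \<in> lint l" using Cauchy_bounded assms by blast
  obtain M where "\<forall>n\<ge>M. vge l (c + k) (t n)" using assms unfolding padic_null_iff by blast
  then show "\<exists>M. \<forall>n\<ge>M. vge l k (s n * t n)" using c vge_mult_bounded by blast
qed

lemma null_mult_right:
  "padic_null l s \<Longrightarrow> padic_Cauchy l t \<Longrightarrow> padic_null l (\<lambda>n. s n * t n)"
  using null_mult_left[of t s] by (simp add: mult.commute)

section \<open>Integrality criteria and residues in the local ring\<close>

lemma vge_inverse:
  assumes "r \<notin> lint l"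
  shows "vge l 1 (1 / r)"
proof -
  have r0: "r \<noteq> 0" using assms by auto
  obtain n d where q: "quotient_of r = (n, d)" by (cases "quotient_of r")
  have rr: "r = of_int n / of_int d" and d: "d > 0" and cop: "coprime n d"
    using quotient_of_div[OF q] quotient_of_denom_pos[OF q] quotient_of_coprime[OF q] by auto
  have "int l dvd d"
  proof (rule ccontr)
    assume "\<not> int l dvd d"
    then have "r \<in> lint l" unfolding rr by (rule lint_div_int) simp
    then show False using assms by simp
  qed
  then have nn: "\<not> int l dvd n" using cop prime_int by (meson coprime_common_divisor not_prime_unit)
  have "vge l 1 (of_int d)" using \<open>int l dvd d\<close> by (subst vge_of_int_iff) simp
  then have "vge l 1 (of_int d * (1 / of_int n))" by (rule vge_mult_right[OF _ lint_inverse_int[OF nn]])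
  then show ?thesis by (simp add: rr)
qed

text \<open>If r had a pole, then \<open>c = (1/r)^k * (r^k * c)\<close> would have valuation at
  least k for every k. Integrality of norms and traces is deduced from this: powers with a common
  denominator come from an integral element.\<close>

lemma lint_all_powers:
  assumes c: "c \<noteq> 0" and r: "\<And>k. r ^ k * c \<in> lint l"
  shows "r \<in> lint l"
proof (rule ccontr)
  assume n: "r \<notin> lint l"
  then have r0: "r \<noteq> 0" by auto
  have "vge l 1 (inverse r)" using vge_inverse[OF n] by (simp add: inverse_eq_divide)
  then have pw: "vge l k (inverse r ^ k)" for k
  proof (induction k)
    case (Suc k)
    have "vge l (1 + k) (inverse r * inverse r ^ k)"
      using Suc.IH Suc.prems by (intro vge_mult) auto
    then show ?case by simp
  qed simp
  have "vge l k c" for k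
  proof -
    have "vge l k ((inverse r ^ k) * (r ^ k * c))" by (rule vge_mult_right[OF pw r])
    then show ?thesis using r0 by (simp add: field_simps)
  qed
  then have "int k \<le> padic_val l c" for k using padic_val_le_iff[OF c] by blast
  from this[of "Suc (nat (padic_val l c))"] show False by linarith
qed

lemma lint_of_square: "r * r \<in> lint l \<Longrightarrow> r \<in> lint l"
proof (rule ccontr)
  assume r: "r * r \<in> lint l" and n: "r \<notin> lint l"
  obtain c where c: "of_nat l ^ c * r \<in> lint l" using lint_bounded by blast
  have "r ^ k * of_nat l ^ c \<in> lint l" for k
  proof (cases "even k")
    case True
    then obtain j where "k = 2 * j" by blast
    then have "r ^ k = (r * r) ^ j" by (simp add: power_mult power2_eq_square)
    then show ?thesis using lint_mult[OF lint_power[OF r, of j] lint_of_nat_power] by simp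
  next
    case False
    then obtain j where "k = 2 * j + 1" by (elim oddE)
    then have "r ^ k * of_nat l ^ c = (r * r) ^ j * (of_nat l ^ c * r)"
      by (simp add: power_mult power2_eq_square)
    then show ?thesis using lint_mult[OF lint_power[OF r, of j] c] by (simp add: mult_ac)
  qed
  then show False using lint_all_powers[of "of_nat l ^ c" r] n by simp
qed

text \<open>Bezout inverts the denominator modulo l, so residues of local integers are residues of
  integers.\<close>

lemma lint_int_repr:
  assumes "r \<in> lint l"
  shows "\<exists>n::int. vge l 1 (r - of_int n)"
proof -
  obtain m j where m: "\<not> int l dvd m" and j: "of_int m * r = of_int j"
    using assms by (auto simp: lint_def elim!: Ints_cases)
  have "coprime m (int l)" using prime_imp_coprime[OF prime_int m] by (simp add: coprime_commute)
  then obtain u v where uv: "u * m + v * int l = 1"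
    by (metis bezout_int coprime_iff_gcd_eq_1)
  have "r = of_int (u * m + v * int l) * r" by (simp add: uv)
  also have "\<dots> = of_int u * (of_int m * r) + of_nat l * (of_int v * r)" by (simp add: algebra_simps)
  finally have "r - of_int (u * j) = of_nat l * (of_int v * r)" by (simp add: j)
  moreover have "vge l 1 (of_nat l * (of_int v * r))"
    using assms by (intro vge_mult_right) auto
  ultimately show ?thesis by metis
qed

lemma lint_prime_cases:
  assumes "r \<in> lint l" "s \<in> lint l" "vge l 1 (r * s)"
  shows "vge l 1 r \<or> vge l 1 s"
proof -
  obtain m n where m: "vge l 1 (r - of_int m)" and n: "vge l 1 (s - of_int n)"
    using lint_int_repr assms by blast
  have "vge l 1 (r * s - (s * (r - of_int m) + of_int m * (s - of_int n)))"
    by (intro vge_diff vge_add vge_mult_left assms m n) auto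
  then have "vge l 1 (of_int (m * n))" by (simp add: algebra_simps)
  then have "int l dvd m \<or> int l dvd n"
    using prime_int by (simp add: vge_of_int_iff prime_dvd_mult_iff del: of_int_mult)
  then have "vge l 1 (of_int m) \<or> vge l 1 (of_int n)" by (simp add: vge_of_int_iff)
  then show ?thesis using vge_add[OF m, of "of_int m"] vge_add[OF n, of "of_int n"] by auto
qed

lemma lint_unit_inverse:
  assumes "r \<in> lint l" "\<not> vge l 1 r"
  shows "1 / r \<in> lint l"
proof -
  obtain m j where m: "\<not> int l dvd m" and j: "of_int m * r = of_int j"
    using assms by (auto simp: lint_def elim!: Ints_cases)
  have "m \<noteq> 0" using m by auto
  then have r: "r = of_int j / of_int m" using j by (simp add: field_simps)
  have "\<not> int l dvd j"
  proof
    assume "int l dvd j"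
    then have "vge l 1 (of_int j)" by (simp add: vge_of_int_iff)
    then have "vge l 1 (of_int j * (1 / of_int m))" by (rule vge_mult_right[OF _ lint_inverse_int[OF m]])
    then show False using assms(2) r by simp
  qed
  then have "of_int m / of_int j \<in> lint l" by (intro lint_div_int) auto
  then show ?thesis by (simp add: r)
qed

end


section \<open>Localisation of lattices\<close>

context rational_prime
begin

section \<open>The field of l-adic numbers through representing sequences\<close>

abbreviation C where "C \<equiv> padic_Cauchy_ring l"
abbreviation Null where "Null \<equiv> {t. padic_null l t}"

definition cls :: "(nat \<Rightarrow> rat) \<Rightarrow> (nat \<Rightarrow> rat) set" where
  "cls s = Null +>\<^bsub>C\<^esub> s"

lemma C_simps [simp]:
  "carrier C = {s. padic_Cauchy l s}"
  "monoid.mult C = (\<lambda>s t n. s n * t n)"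
  "ring.add C = (\<lambda>s t n. s n + t n)"
  "\<one>\<^bsub>C\<^esub> = (\<lambda>n. 1)"
  "\<zero>\<^bsub>C\<^esub> = (\<lambda>n. 0)"
  by (simp_all add: padic_Cauchy_ring_def)

lemma cring_C: "cring C"
proof (rule cringI)
  show "abelian_group C"
  proof (rule abelian_groupI)
    fix s assume "s \<in> carrier C"
    then show "\<exists>t\<in>carrier C. t \<oplus>\<^bsub>C\<^esub> s = \<zero>\<^bsub>C\<^esub>"
      by (intro bexI[of _ "\<lambda>n. - s n"]) (auto intro: Cauchy_minus)
  qed (auto intro: Cauchy_add simp: fun_eq_iff)
  show "comm_monoid C"
    by (rule comm_monoidI) (auto intro: Cauchy_mult simp: fun_eq_iff)
qed (auto simp: fun_eq_iff algebra_simps)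

sublocale C: cring C by (rule cring_C)

lemma a_inv_C: "padic_Cauchy l s \<Longrightarrow> \<ominus>\<^bsub>C\<^esub> s = (\<lambda>n. - s n)"
  by (rule C.minus_equality) (auto intro: Cauchy_minus)

lemma ideal_Null: "ideal Null C"
proof (rule idealI)
  show "ring C" by unfold_locales
  show "subgroup Null (add_monoid C)"
  proof
    fix x assume "x \<in> Null"
    then show "inv\<^bsub>add_monoid C\<^esub> x \<in> Null"
      using a_inv_C[of x] by (auto simp: a_inv_def null_Cauchy null_minus)
  qed (auto intro: null_Cauchy null_add)
qed (auto intro: null_mult_left null_mult_right)

sublocale N: ideal Null C by (rule ideal_Null)

lemma Qp_eq: "Qp l = C Quot Null"
  by (simp add: Qp_def)

lemma cls_hom: "cls \<in> ring_hom C (Qp l)"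
  unfolding cls_def[abs_def] Qp_eq by (rule N.rcos_ring_hom)

lemma cring_Qp: "cring (Qp l)"
  unfolding Qp_eq by (rule N.quotient_is_cring[OF cring_C])

sublocale Q: cring "Qp l" by (rule cring_Qp)

lemma cls_add: "padic_Cauchy l s \<Longrightarrow> padic_Cauchy l t \<Longrightarrow> cls s \<oplus>\<^bsub>Qp l\<^esub> cls t = cls (\<lambda>n. s n + t n)"
  using ring_hom_add[OF cls_hom, of s t] by simp

lemma cls_mult: "padic_Cauchy l s \<Longrightarrow> padic_Cauchy l t \<Longrightarrow> cls s \<otimes>\<^bsub>Qp l\<^esub> cls t = cls (\<lambda>n. s n * t n)"
  using ring_hom_mult[OF cls_hom, of s t] by simp

lemma cls_one: "\<one>\<^bsub>Qp l\<^esub> = cls (\<lambda>n. 1)"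
  using ring_hom_one[OF cls_hom] by simp

lemma cls_zero: "\<zero>\<^bsub>Qp l\<^esub> = cls (\<lambda>n. 0)"
  using ring_hom_zero[OF cls_hom C.ring_axioms Q.ring_axioms] by simp

lemma cls_closed: "padic_Cauchy l s \<Longrightarrow> cls s \<in> carrier (Qp l)"
  using ring_hom_closed[OF cls_hom, of s] by simp

lemma cls_uminus: "padic_Cauchy l s \<Longrightarrow> \<ominus>\<^bsub>Qp l\<^esub> cls s = cls (\<lambda>n. - s n)"
  by (rule Q.minus_equality) (auto simp: cls_add cls_zero Cauchy_minus cls_closed)

lemma cls_minus: "padic_Cauchy l s \<Longrightarrow> padic_Cauchy l t \<Longrightarrow> cls s \<ominus>\<^bsub>Qp l\<^esub> cls t = cls (\<lambda>n. s n - t n)"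
  by (simp add: a_minus_def cls_uminus cls_add Cauchy_minus)

lemma carrier_Qp: "carrier (Qp l) = cls ` {s. padic_Cauchy l s}"
  by (auto simp: Qp_eq FactRing_def A_RCOSETS_def' cls_def)

lemma mem_cls: "t \<in> cls s \<longleftrightarrow> padic_null l (\<lambda>n. t n - s n)"
proof -
  have "t \<in> cls s \<longleftrightarrow> (\<exists>h. padic_null l h \<and> t = (\<lambda>n. h n + s n))"
    by (auto simp: cls_def a_r_coset_def')
  also have "\<dots> \<longleftrightarrow> padic_null l (\<lambda>n. t n - s n)"
    by (auto intro!: exI[of _ "\<lambda>n. t n - s n"] simp: fun_eq_iff)
  finally show ?thesis .
qed

lemma cls_eq_iff: "cls s = cls t \<longleftrightarrow> padic_null l (\<lambda>n. s n - t n)"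
proof
  assume "cls s = cls t"
  moreover have "s \<in> cls s" by (simp add: mem_cls)
  ultimately show "padic_null l (\<lambda>n. s n - t n)" by (simp add: mem_cls)
next
  assume n: "padic_null l (\<lambda>n. s n - t n)"
  show "cls s = cls t"
  proof (intro Set.set_eqI)
    fix u
    show "u \<in> cls s \<longleftrightarrow> u \<in> cls t"
      using null_add[OF _ n, of "\<lambda>n. u n - s n"] null_diff[OF _ n, of "\<lambda>n. u n - t n"]
      by (auto simp: mem_cls)
  qed
qed

lemma Qp_of_rat_cls: "Qp_of_rat l r = cls (\<lambda>n. r)"
  by (simp add: Qp_of_rat_def cls_def)

text \<open>The sequence with integral terms in a class differs from a Cauchy sequence by a null
  sequence, so it is itself Cauchy and represents the class.\<close>

lemma Zp_iff: "z \<in> Zp l \<longleftrightarrow> (\<exists>s. padic_Cauchy l s \<and> (\<forall>n. s n \<in> lint l) \<and> z = cls s)"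
proof
  assume "z \<in> Zp l"
  then obtain t s where t: "z = cls t" "padic_Cauchy l t" and s: "s \<in> z" "\<And>n. s n \<in> lint l"
    unfolding Zp_def carrier_Qp by (auto simp: padic_abs_le_1_iff)
  have st: "padic_null l (\<lambda>n. s n - t n)" using s(1) t(1) by (simp add: mem_cls)
  have "padic_Cauchy l s" using Cauchy_add[OF null_Cauchy[OF st] t(2)] by simp
  moreover have "z = cls s" using st t(1) null_minus[OF st] by (simp add: cls_eq_iff)
  ultimately show "\<exists>s. padic_Cauchy l s \<and> (\<forall>n. s n \<in> lint l) \<and> z = cls s" using s(2) by blast
next
  assume "\<exists>s. padic_Cauchy l s \<and> (\<forall>n. s n \<in> lint l) \<and> z = cls s"
  then obtain s where s: "padic_Cauchy l s" "\<And>n. s n \<in> lint l" "z = cls s" by auto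
  moreover have "s \<in> cls s" by (simp add: mem_cls)
  ultimately show "z \<in> Zp l" unfolding Zp_def carrier_Qp by (auto simp: padic_abs_le_1_iff)
qed

section \<open>Quaternions over the l-adic numbers\<close>

definition qC :: "(nat \<Rightarrow> rat quat) \<Rightarrow> bool" where
  "qC S \<longleftrightarrow> padic_Cauchy l (\<lambda>n. q_1 (S n)) \<and> padic_Cauchy l (\<lambda>n. q_i (S n)) \<and>
    padic_Cauchy l (\<lambda>n. q_j (S n)) \<and> padic_Cauchy l (\<lambda>n. q_k (S n))"

definition qN :: "(nat \<Rightarrow> rat quat) \<Rightarrow> bool" where
  "qN S \<longleftrightarrow> padic_null l (\<lambda>n. q_1 (S n)) \<and> padic_null l (\<lambda>n. q_i (S n)) \<and>
    padic_null l (\<lambda>n. q_j (S n)) \<and> padic_null l (\<lambda>n. q_k (S n))"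

text \<open>One sequence of rational quaternions represents an element of the completed algebra, so
  that identities for \<open>qmul\<close> can be applied term by term.\<close>

definition qcls :: "(nat \<Rightarrow> rat quat) \<Rightarrow> (nat \<Rightarrow> rat) set quat" where
  "qcls S = Quat (cls (\<lambda>n. q_1 (S n))) (cls (\<lambda>n. q_i (S n))) (cls (\<lambda>n. q_j (S n))) (cls (\<lambda>n. q_k (S n)))"

lemma qC_const [simp]: "qC (\<lambda>n. x)"
  by (simp add: qC_def)

lemma qC_add: "qC S \<Longrightarrow> qC T \<Longrightarrow> qC (\<lambda>n. S n + T n)"
  and qC_diff: "qC S \<Longrightarrow> qC T \<Longrightarrow> qC (\<lambda>n. S n - T n)"
  and qC_minus: "qC S \<Longrightarrow> qC (\<lambda>n. - S n)"
  and qC_qmul: "qC S \<Longrightarrow> qC T \<Longrightarrow> qC (\<lambda>n. qmul a b (S n) (T n))"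
  and qC_scl: "padic_Cauchy l s \<Longrightarrow> qC S \<Longrightarrow> qC (\<lambda>n. scl (s n) (S n))"
  by (auto simp: qC_def intro!: Cauchy_add Cauchy_diff Cauchy_minus Cauchy_mult)

lemma qcls_add: "qC S \<Longrightarrow> qC T \<Longrightarrow> qcls S \<oplus>\<^bsub>quat_Qp l a b\<^esub> qcls T = qcls (\<lambda>n. S n + T n)"
  by (simp add: quat_Qp_def quat_alg_def qcls_def qC_def cls_add)

lemma qcls_mult: "qC S \<Longrightarrow> qC T \<Longrightarrow>
    qcls S \<otimes>\<^bsub>quat_Qp l a b\<^esub> qcls T = qcls (\<lambda>n. qmul a b (S n) (T n))"
  by (simp add: quat_Qp_def quat_alg_def qcls_def qC_def cls_add cls_mult cls_minus Qp_of_rat_cls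
      Cauchy_add Cauchy_mult Cauchy_diff)

lemma qcls_one: "\<one>\<^bsub>quat_Qp l a b\<^esub> = qcls (\<lambda>n. qone)"
  by (simp add: quat_Qp_def quat_alg_def qcls_def cls_one cls_zero)

lemma qcls_zero: "\<zero>\<^bsub>quat_Qp l a b\<^esub> = qcls (\<lambda>n. 0)"
  by (simp add: quat_Qp_def quat_alg_def qcls_def cls_zero)

lemma carrier_quat_Qp: "carrier (quat_Qp l a b) = qcls ` {S. qC S}"
proof
  show "qcls ` {S. qC S} \<subseteq> carrier (quat_Qp l a b)"
    by (auto simp: quat_Qp_def quat_alg_def qcls_def qC_def cls_closed)
  show "carrier (quat_Qp l a b) \<subseteq> qcls ` {S. qC S}"
  proof
    fix x assume "x \<in> carrier (quat_Qp l a b)"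
    then have "set_quat x \<subseteq> cls ` {s. padic_Cauchy l s}"
      by (simp add: quat_Qp_def quat_alg_def carrier_Qp)
    then obtain s t u v where x: "x = Quat (cls s) (cls t) (cls u) (cls v)"
      and "padic_Cauchy l s" "padic_Cauchy l t" "padic_Cauchy l u" "padic_Cauchy l v"
      by (cases x) auto
    then have "qC (\<lambda>n. Quat (s n) (t n) (u n) (v n))" by (simp add: qC_def)
    moreover have "x = qcls (\<lambda>n. Quat (s n) (t n) (u n) (v n))" by (simp add: x qcls_def)
    ultimately show "x \<in> qcls ` {S. qC S}" by blast
  qed
qed

lemma qcls_eq_iff: "qcls S = qcls T \<longleftrightarrow> qN (\<lambda>n. S n - T n)"
  by (simp add: qcls_def cls_eq_iff qN_def)

lemma map_Qp_of_rat: "map_quat (Qp_of_rat l) x = qcls (\<lambda>n. x)"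
  by (cases x) (simp add: qcls_def Qp_of_rat_cls)

lemma quat_scalar_Qp: "quat_scalar (Qp l) (cls s) = qcls (\<lambda>n. scl (s n) qone)"
  by (simp add: quat_scalar_def qcls_def cls_zero)

lemma comm_group_quat_Qp: "comm_group (add_monoid (quat_Qp l a b))"
proof (rule comm_groupI)
  fix x assume "x \<in> carrier (add_monoid (quat_Qp l a b))"
  then obtain S where S: "qC S" "x = qcls S" by (auto simp: carrier_quat_Qp)
  then have "qcls (\<lambda>n. - S n) \<oplus>\<^bsub>quat_Qp l a b\<^esub> x = qcls (\<lambda>n. 0)"
    by (simp add: qcls_add qC_minus)
  moreover have "qcls (\<lambda>n. - S n) \<in> carrier (quat_Qp l a b)"
    using S by (auto simp: carrier_quat_Qp qC_minus)
  ultimately show "\<exists>y\<in>carrier (add_monoid (quat_Qp l a b)). y \<otimes>\<^bsub>add_monoid (quat_Qp l a b)\<^esub> x =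
      \<one>\<^bsub>add_monoid (quat_Qp l a b)\<^esub>"
    by (auto simp: qcls_zero)
qed (auto simp: carrier_quat_Qp qcls_add qcls_zero qC_add ac_simps)

lemma inv_quat_Qp: 
  assumes "qC S"
  shows "inv\<^bsub>add_monoid (quat_Qp l a b)\<^esub> (qcls S) = qcls (\<lambda>n. - S n)"
proof -
  interpret comm_group "add_monoid (quat_Qp l a b)" by (rule comm_group_quat_Qp)
  show ?thesis
    by (rule inv_equality) (use assms in \<open>auto simp: carrier_quat_Qp qcls_add qC_minus qcls_zero\<close>)
qed

lemma qcls_mult_assoc:
  assumes "x \<in> carrier (quat_Qp l a b)" "y \<in> carrier (quat_Qp l a b)" "z \<in> carrier (quat_Qp l a b)"
  shows "x \<otimes>\<^bsub>quat_Qp l a b\<^esub> y \<otimes>\<^bsub>quat_Qp l a b\<^esub> z = x \<otimes>\<^bsub>quat_Qp l a b\<^esub> (y \<otimes>\<^bsub>quat_Qp l a b\<^esub> z)"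
  using assms by (auto simp: carrier_quat_Qp qcls_mult qC_qmul qmul_assoc)

text \<open>The form in which the division hypothesis is used: stated for sequences, it covers
  constant quaternions as well as factors converging to a root.\<close>

lemma division_no_zero_divisors:
  assumes div: "is_division_ring (quat_Qp l a b)" and S: "qC S" and T: "qC T"
    and ST: "qN (\<lambda>n. qmul a b (S n) (T n))"
  shows "qN S \<or> qN T"
proof (rule ccontr)
  assume n: "\<not> (qN S \<or> qN T)"
  let ?A = "quat_Qp l a b"
  interpret A: ring ?A using div by (simp add: is_division_ring_def)
  have c: "qcls S \<in> carrier ?A" "qcls T \<in> carrier ?A" using S T by (auto simp: carrier_quat_Qp)
  have "qcls S \<noteq> \<zero>\<^bsub>?A\<^esub>" using n by (simp add: qcls_zero qcls_eq_iff)
  then have "qcls S \<in> Units ?A" using div c by (simp add: is_division_ring_def)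
  moreover have "qcls S \<otimes>\<^bsub>?A\<^esub> qcls T = qcls S \<otimes>\<^bsub>?A\<^esub> \<zero>\<^bsub>?A\<^esub>"
    using S T ST c by (simp add: qcls_mult) (simp add: qcls_zero qcls_eq_iff)
  ultimately have "qcls T = \<zero>\<^bsub>?A\<^esub>" using c A.Units_l_cancel by blast
  then show False using n by (simp add: qcls_zero qcls_eq_iff)
qed


text \<open>The localisation of L at the prime ideal of l, taken inside the rational algebra and not
  in its completion.\<close>

definition loc :: "rat quat set \<Rightarrow> rat quat set" where
  "loc L = {x. \<exists>m::int. \<not> int l dvd m \<and> scl (of_int m) x \<in> L}"

lemma locI: "\<not> int l dvd m \<Longrightarrow> scl (of_int m) x \<in> L \<Longrightarrow> x \<in> loc L"
  unfolding loc_def by blast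

lemma locE:
  assumes "x \<in> loc L"
  obtains m :: int where "\<not> int l dvd m" "scl (of_int m) x \<in> L"
  using assms unfolding loc_def by blast

lemma loc_superset: "x \<in> L \<Longrightarrow> x \<in> loc L"
  by (rule locI[of 1]) auto

lemma loc_mono: "L \<subseteq> M \<Longrightarrow> loc L \<subseteq> loc M"
  unfolding loc_def by blast

lemma addsub_loc: assumes L: "addsub L" shows "addsub (loc L)"
  unfolding addsub_def
proof (intro conjI ballI)
  show "0 \<in> loc L" by (rule loc_superset) (rule addsubD[OF L])
  fix x y assume "x \<in> loc L" "y \<in> loc L"
  then obtain m n where m: "\<not> int l dvd m" "scl (of_int m) x \<in> L" and n: "\<not> int l dvd n" "scl (of_int n) y \<in> L"
    unfolding loc_def by blast
  have "scl (of_int n) (scl (of_int m) x) - scl (of_int m) (scl (of_int n) y) \<in> L"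
    by (intro addsubD(2)[OF L] addsub_scl_int[OF L] m n)
  then show "x - y \<in> loc L"
    by (intro locI[of "m * n"] not_dvd_mult m n) (simp add: scl_diff_right mult.commute)
qed

lemma loc_loc: "x \<in> loc (loc L) \<Longrightarrow> x \<in> loc L"
proof -
  assume "x \<in> loc (loc L)"
  then obtain m n where "\<not> int l dvd m" "\<not> int l dvd n" "scl (of_int n) (scl (of_int m) x) \<in> L"
    unfolding loc_def by blast
  then show ?thesis by (intro locI[of "n * m"] not_dvd_mult) auto
qed

lemma loc_scl: assumes L: "addsub L" and x: "x \<in> loc L" and r: "r \<in> lint l" shows "scl r x \<in> loc L"
proof -
  from x obtain m where m: "\<not> int l dvd m" "scl (of_int m) x \<in> L" by (rule locE)
  obtain n where n: "\<not> int l dvd n" "of_int n * r \<in> \<int>" using r unfolding lint_def by blast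
  have "scl (of_int n * r) (scl (of_int m) x) \<in> L" by (rule addsub_scl_Ints[OF L m(2) n(2)])
  then show ?thesis by (intro locI[of "n * m"] not_dvd_mult n m) (simp add: mult_ac)
qed

definition qsmall :: "nat \<Rightarrow> rat quat \<Rightarrow> bool" where
  "qsmall k x \<longleftrightarrow> vge l k (q_1 x) \<and> vge l k (q_i x) \<and> vge l k (q_j x) \<and> vge l k (q_k x)"

text \<open>\<open>loc L\<close> is open for the l-adic topology. Hence a sufficiently good
  approximation of an element of the lattice stays in the lattice.\<close>

lemma full_loc:
  assumes "addsub L" "full L"
  shows "\<exists>k. \<forall>x. qsmall k x \<longrightarrow> x \<in> loc L"
proof -
  obtain D :: int where D: "D > 0" "\<And>x. intq x \<Longrightarrow> scl (of_int D) x \<in> L" using assms(2) by (auto simp: full_def)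
  obtain c where c: "of_nat l ^ c * (1 / of_int D) \<in> lint l" using lint_bounded by blast
  have "x \<in> loc L" if x: "qsmall c x" for x
  proof -
    have "r / of_int D \<in> lint l" if "vge l c r" for r
      using lint_mult[OF c, of "r / of_nat l ^ c"] that by (simp add: vge_def)
    then have co: "q_1 x / of_int D \<in> lint l" "q_i x / of_int D \<in> lint l"
      "q_j x / of_int D \<in> lint l" "q_k x / of_int D \<in> lint l"
      using x by (auto simp: qsmall_def)
    have e: "scl (of_int D) (Quat 1 0 0 0) \<in> loc L" "scl (of_int D) (Quat 0 1 0 0) \<in> loc L"
      "scl (of_int D) (Quat 0 0 1 0) \<in> loc L" "scl (of_int D) (Quat 0 0 0 1) \<in> loc L"
      by (auto intro!: loc_superset D simp: intq_def)
    have "scl (q_1 x / of_int D) (scl (of_int D) (Quat 1 0 0 0)) + scl (q_i x / of_int D) (scl (of_int D) (Quat 0 1 0 0))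
      + scl (q_j x / of_int D) (scl (of_int D) (Quat 0 0 1 0)) + scl (q_k x / of_int D) (scl (of_int D) (Quat 0 0 0 1)) \<in> loc L" (is "?s \<in> _")
      by (intro addsubD(4)[OF addsub_loc] loc_scl co e assms)
    also have "?s = x"
      using D(1) by (intro quat_eqI) simp_all
    finally show ?thesis .
  qed
  then show ?thesis by blast
qed

lemma qN_qsmall: "qN S \<longleftrightarrow> (\<forall>k. \<exists>M. \<forall>n\<ge>M. qsmall k (S n))"
proof
  assume N: "qN S"
  show "\<forall>k. \<exists>M. \<forall>n\<ge>M. qsmall k (S n)"
  proof
    fix k
    obtain M1 M2 M3 M4 where "\<forall>n\<ge>M1. vge l k (q_1 (S n))" "\<forall>n\<ge>M2. vge l k (q_i (S n))"
      "\<forall>n\<ge>M3. vge l k (q_j (S n))" "\<forall>n\<ge>M4. vge l k (q_k (S n))"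
      using N unfolding qN_def padic_null_iff by metis
    then show "\<exists>M. \<forall>n\<ge>M. qsmall k (S n)"
      by (intro exI[of _ "max (max M1 M2) (max M3 M4)"]) (auto simp: qsmall_def)
  qed
next
  assume "\<forall>k. \<exists>M. \<forall>n\<ge>M. qsmall k (S n)"
  then show "qN S" unfolding qN_def padic_null_iff qsmall_def by meson
qed

lemma qC_qsmall: assumes "qC S" shows "\<exists>M. \<forall>n\<ge>M. qsmall k (S n - S M)"
proof -
  have C: "\<exists>M. \<forall>m\<ge>M. \<forall>n\<ge>M. vge l k (f (S m) - f (S n))" if "f \<in> {q_1, q_i, q_j, q_k}" for f
    using assms that unfolding qC_def padic_Cauchy_iff by blast
  obtain M1 M2 M3 M4 where "\<forall>m\<ge>M1. \<forall>n\<ge>M1. vge l k (q_1 (S m) - q_1 (S n))"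
     "\<forall>m\<ge>M2. \<forall>n\<ge>M2. vge l k (q_i (S m) - q_i (S n))" "\<forall>m\<ge>M3. \<forall>n\<ge>M3. vge l k (q_j (S m) - q_j (S n))"
     "\<forall>m\<ge>M4. \<forall>n\<ge>M4. vge l k (q_k (S m) - q_k (S n))"
    using C[of q_1] C[of q_i] C[of q_j] C[of q_k] by auto
  then show ?thesis
    by (intro exI[of _ "max (max M1 M2) (max M3 M4)"]) (auto simp: qsmall_def)
qed

lemma scalars_set_mult:
  "quat_scalar (Qp l) ` Zp l <#>\<^bsub>quat_Qp l a b\<^esub> (map_quat (Qp_of_rat l) ` L) =
    {qcls (\<lambda>n. scl (s n) x) | s x. padic_Cauchy l s \<and> (\<forall>n. s n \<in> lint l) \<and> x \<in> L}" (is "?A = ?B")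
proof -
  have e: "quat_scalar (Qp l) (cls s) \<otimes>\<^bsub>quat_Qp l a b\<^esub> map_quat (Qp_of_rat l) x = qcls (\<lambda>n. scl (s n) x)"
    if "padic_Cauchy l s" for s x
    using that by (simp add: quat_scalar_Qp map_Qp_of_rat qcls_mult qC_scl)
  show ?thesis
  proof (intro equalityI subsetI)
    fix u assume "u \<in> ?A"
    then obtain z x where "z \<in> Zp l" "x \<in> L"
      "u = quat_scalar (Qp l) z \<otimes>\<^bsub>quat_Qp l a b\<^esub> map_quat (Qp_of_rat l) x"
      unfolding set_mult_def by blast
    then show "u \<in> ?B" using e unfolding Zp_iff by blast
  next
    fix u assume "u \<in> ?B"
    then obtain s x where "padic_Cauchy l s" "\<forall>n. s n \<in> lint l" "x \<in> L" "u = qcls (\<lambda>n. scl (s n) x)" by blast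
    then have "cls s \<in> Zp l" "u = quat_scalar (Qp l) (cls s) \<otimes>\<^bsub>quat_Qp l a b\<^esub> map_quat (Qp_of_rat l) x"
      unfolding Zp_iff by (blast, simp add: e)
    then show "u \<in> ?A" unfolding set_mult_def using \<open>x \<in> L\<close> by blast
  qed
qed

text \<open>Left to right is induction over the span. For the other inclusion, a sequence in
  \<open>loc L\<close> is a fixed term \<open>S M\<close> plus a small remainder; the term becomes
  an element of L after multiplication by an integer prime to l, and the remainder is an l-integral
  combination of D, D i, D j, D k, all of which lie in L.\<close>

lemma localize_eq:
  assumes L: "addsub L" and f: "full L"
  shows "localize l a b L = {qcls S | S. qC S \<and> (\<forall>n. S n \<in> loc L)}"
proof
  let ?A = "add_monoid (quat_Qp l a b)"
  define H where "H = {qcls (\<lambda>n. scl (s n) x) | s x. padic_Cauchy l s \<and> (\<forall>n. s n \<in> lint l) \<and> x \<in> L}"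
  have loc_eq: "localize l a b L = generate ?A H"
    unfolding localize_def scalar_span_def scalars_set_mult H_def ..
  have H: "\<exists>S. h = qcls S \<and> qC S \<and> (\<forall>n. S n \<in> loc L)" if "h \<in> H" for h
  proof -
    obtain s x where s: "padic_Cauchy l s" "\<And>n. s n \<in> lint l" "x \<in> L" "h = qcls (\<lambda>n. scl (s n) x)"
      using \<open>h \<in> H\<close> unfolding H_def by blast
    then show ?thesis
      by (intro exI[of _ "\<lambda>n. scl (s n) x"]) (auto intro: qC_scl loc_scl[OF L] loc_superset)
  qed
  show "localize l a b L \<subseteq> {qcls S | S. qC S \<and> (\<forall>n. S n \<in> loc L)}"
  proof
    fix x assume "x \<in> localize l a b L"
    then have "x \<in> generate ?A H" by (simp add: loc_eq)
    then have "\<exists>S. x = qcls S \<and> qC S \<and> (\<forall>n. S n \<in> loc L)"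
    proof induction
      case one
      show ?case using addsubD(1)[OF addsub_loc[OF L]] by (intro exI[of _ "\<lambda>n. 0"]) (simp add: qcls_zero)
    next
      case (incl h) then show ?case by (rule H)
    next
      case (inv h)
      then obtain S where "h = qcls S" "qC S" "\<forall>n. S n \<in> loc L" using H by blast
      then show ?case using addsubD(3)[OF addsub_loc[OF L]] inv_quat_Qp qC_minus
        by (intro exI[of _ "\<lambda>n. - S n"]) simp
    next
      case (eng h1 h2)
      then obtain S T where "h1 = qcls S" "qC S" "\<forall>n. S n \<in> loc L" "h2 = qcls T" "qC T" "\<forall>n. T n \<in> loc L" by blast
      then show ?case using addsubD(4)[OF addsub_loc[OF L]]
        by (intro exI[of _ "\<lambda>n. S n + T n"]) (simp add: qcls_add qC_add)
    qed
    then show "x \<in> {qcls S | S. qC S \<and> (\<forall>n. S n \<in> loc L)}" by blast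
  qed
  show "{qcls S | S. qC S \<and> (\<forall>n. S n \<in> loc L)} \<subseteq> localize l a b L"
  proof
    fix x assume "x \<in> {qcls S | S. qC S \<and> (\<forall>n. S n \<in> loc L)}"
    then obtain S where S: "x = qcls S" "qC S" "\<And>n. S n \<in> loc L" by blast
    obtain D :: int where D: "D > 0" "\<And>x. intq x \<Longrightarrow> scl (of_int D) x \<in> L" using f by (auto simp: full_def)
    obtain c where c: "of_nat l ^ c * (1 / of_int D) \<in> lint l" using lint_bounded by blast
    obtain M where M: "\<forall>n\<ge>M. qsmall c (S n - S M)" using qC_qsmall[OF S(2)] by blast
    \<comment> \<open>Replacing the first M terms keeps the class and makes all terms, not just late
      ones, close to \<open>S M\<close>.\<close>
    define T where "T = (\<lambda>n. S (max n M))"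
    define U where "U = (\<lambda>n. T n - S M)"
    have U: "qsmall c (U n)" for n unfolding U_def T_def using M by simp
    have TC: "qC T"
    proof -
      have "padic_Cauchy l (\<lambda>n. s (max n M))" if "padic_Cauchy l s" for s
        using that unfolding padic_Cauchy_iff by (meson max.coboundedI1)
      from this[of "\<lambda>n. q_1 (S n)"] this[of "\<lambda>n. q_i (S n)"] this[of "\<lambda>n. q_j (S n)"] this[of "\<lambda>n. q_k (S n)"]
      show ?thesis using S(2) by (simp add: qC_def T_def)
    qed
    have UC: "qC U" unfolding U_def by (intro qC_diff TC qC_const)
    have gen: "qcls (\<lambda>n. scl (s n) y) \<in> generate ?A H" if "padic_Cauchy l s" "\<And>n. s n \<in> lint l" "y \<in> L" for s y
      by (rule generate.incl) (use that in \<open>auto simp: H_def\<close>)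
    have D_lint: "r / of_int D \<in> lint l" if "vge l c r" for r
      using lint_mult[OF c, of "r / of_nat l ^ c"] that by (simp add: vge_def)
    have CD: "padic_Cauchy l (\<lambda>n. s n / of_int D)" if "padic_Cauchy l s" for s
      using Cauchy_mult[OF Cauchy_const that, of "1 / of_int D"] by simp
    have gen': "qcls (\<lambda>n. scl (s n / of_int D) (scl (of_int D) y)) \<in> generate ?A H"
      if "padic_Cauchy l s" "\<And>n. vge l c (s n)" "intq y" for s y
      by (rule gen[OF CD D_lint D(2)]) (use that in auto)
    have e: "qcls (\<lambda>n. scl (q_1 (U n) / of_int D) (scl (of_int D) (Quat 1 0 0 0))) \<in> generate ?A H"
      "qcls (\<lambda>n. scl (q_i (U n) / of_int D) (scl (of_int D) (Quat 0 1 0 0))) \<in> generate ?A H"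
      "qcls (\<lambda>n. scl (q_j (U n) / of_int D) (scl (of_int D) (Quat 0 0 1 0))) \<in> generate ?A H"
      "qcls (\<lambda>n. scl (q_k (U n) / of_int D) (scl (of_int D) (Quat 0 0 0 1))) \<in> generate ?A H"
      using U UC unfolding qsmall_def qC_def by (intro gen'; simp add: intq_def)+
    from S(3)[of M] obtain m where m: "\<not> int l dvd m" "scl (of_int m) (S M) \<in> L" by (rule locE)
    have "qcls (\<lambda>n. scl (1 / of_int m) (scl (of_int m) (S M))) \<in> generate ?A H"
      by (rule gen) (use m lint_inverse_int in auto)
    moreover have "m \<noteq> 0" using m by auto
    ultimately have SM: "qcls (\<lambda>n. S M) \<in> generate ?A H" by simp
    have eng: "qcls (\<lambda>n. V n + W n) \<in> generate ?A H" if "qcls V \<in> generate ?A H" "qcls W \<in> generate ?A H" "qC V" "qC W" for V W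
      using generate.eng[OF that(1,2)] that by (simp add: qcls_add)
    have "qcls (\<lambda>n. scl (q_1 (U n) / of_int D) (scl (of_int D) (Quat 1 0 0 0))
       + scl (q_i (U n) / of_int D) (scl (of_int D) (Quat 0 1 0 0))
       + scl (q_j (U n) / of_int D) (scl (of_int D) (Quat 0 0 1 0))
       + scl (q_k (U n) / of_int D) (scl (of_int D) (Quat 0 0 0 1)) + S M) \<in> generate ?A H"
      (is "qcls ?U \<in> _")
      using UC by (intro eng e SM qC_add qC_scl CD) (auto simp: qC_def)
    also have "?U = T"
      using D(1) by (intro ext quat_eqI) (simp_all add: U_def)
    finally have "qcls T \<in> generate ?A H" .
    moreover have "qcls T = x"
      unfolding S(1) qcls_eq_iff qN_qsmall T_def
      by (intro allI exI[of _ M]) (simp add: qsmall_def)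
    ultimately show "x \<in> localize l a b L" by (simp add: loc_eq)
  qed
qed

lemma localize_superset:
  "addsub L \<Longrightarrow> full L \<Longrightarrow> x \<in> loc L \<Longrightarrow> qcls (\<lambda>n. x) \<in> localize l a b L"
  by (subst localize_eq) auto

text \<open>Descent from the completion: x is a term of a sequence in \<open>loc L\<close> plus an
  error that lies in \<open>loc L\<close> by openness.\<close>

lemma localize_Int:
  assumes "addsub L" "full L" "qcls (\<lambda>n. x) \<in> localize l a b L"
  shows "x \<in> loc L"
proof -
  obtain S where S: "qcls (\<lambda>n. x) = qcls S" "\<And>n. S n \<in> loc L" using assms by (subst (asm) localize_eq) auto
  obtain k where k: "\<And>x. qsmall k x \<Longrightarrow> x \<in> loc L" using full_loc[OF assms(1,2)] by blast
  obtain M where "qsmall k (x - S M)" using S(1) unfolding qcls_eq_iff qN_qsmall by blast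
  then have "(x - S M) + S M \<in> loc L" by (intro addsubD(4)[OF addsub_loc[OF assms(1)]] k S)
  then show ?thesis by simp
qed

lemma qN_eventually_scl:
  assumes "addsub L" "full L" "qN S"
  shows "\<exists>M. \<forall>n\<ge>M. \<exists>z\<in>loc L. S n = scl (of_nat l ^ j) z"
proof -
  obtain k where k: "\<And>x. qsmall k x \<Longrightarrow> x \<in> loc L" using full_loc[OF assms(1,2)] by blast
  obtain M where M: "\<forall>n\<ge>M. qsmall (j + k) (S n)" using assms(3) unfolding qN_qsmall by blast
  have "\<exists>z\<in>loc L. S n = scl (of_nat l ^ j) z" if "n \<ge> M" for n
  proof (intro bexI)
    show "S n = scl (of_nat l ^ j) (scl (1 / of_nat l ^ j) (S n))" by simp
    show "scl (1 / of_nat l ^ j) (S n) \<in> loc L"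
      using M that by (intro k) (simp add: qsmall_def vge_def power_add)
  qed
  then show ?thesis by blast
qed

text \<open>A criterion for local principality with a rational generator. The inverse of x is its
  conjugate over its norm, and multiplication by it is applied to whole sequences.\<close>

lemma localize_coset:
  assumes L: "addsub L" "full L" and R: "addsub R" "full R" and x: "red_norm a b x \<noteq> 0"
    and RxL: "\<And>y. y \<in> R \<Longrightarrow> qmul a b y x \<in> loc L"
    and LRx: "\<And>w. w \<in> L \<Longrightarrow> \<exists>y\<in>loc R. w = qmul a b y x"
  shows "\<exists>x \<in> Units (quat_Qp l a b). localize l a b L = localize l a b R #>\<^bsub>quat_Qp l a b\<^esub> x"
proof (intro bexI)
  let ?x = "qcls (\<lambda>n. x)"
  let ?n = "red_norm a b x"
  have "qcls (\<lambda>n. scl (1 / ?n) (qcnj x)) \<otimes>\<^bsub>quat_Qp l a b\<^esub> ?x = \<one>\<^bsub>quat_Qp l a b\<^esub>"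
    "?x \<otimes>\<^bsub>quat_Qp l a b\<^esub> qcls (\<lambda>n. scl (1 / ?n) (qcnj x)) = \<one>\<^bsub>quat_Qp l a b\<^esub>"
    using x by (simp_all add: qcls_mult qcls_one qmul_qcnj_left qmul_qcnj_right)
  then show "?x \<in> Units (quat_Qp l a b)"
    unfolding Units_def carrier_quat_Qp by (blast intro: qC_const)
  have LRx': "\<exists>y\<in>loc R. w = qmul a b y x" if "w \<in> loc L" for w
  proof -
    from that obtain m where m: "\<not> int l dvd m" "scl (of_int m) w \<in> L" by (rule locE)
    from LRx[OF m(2)] obtain y where y: "y \<in> loc R" "scl (of_int m) w = qmul a b y x" by (rule bexE)
    have m0: "m \<noteq> 0" using m by auto
    then have "w = scl (1 / of_int m) (scl (of_int m) w)" by simp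
    also have "\<dots> = qmul a b (scl (1 / of_int m) y) x" by (simp add: y(2))
    finally show ?thesis using loc_scl[OF R(1) y(1) lint_inverse_int[OF m(1)]] by blast
  qed
  have RxL': "qmul a b y x \<in> loc L" if y: "y \<in> loc R" for y
  proof -
    from y obtain m where m: "\<not> int l dvd m" "scl (of_int m) y \<in> R" by (rule locE)
    have "qmul a b y x \<in> loc (loc L)" by (rule locI[OF m(1)]) (use RxL[OF m(2)] in simp)
    then show ?thesis by (rule loc_loc)
  qed
  show "localize l a b L = localize l a b R #>\<^bsub>quat_Qp l a b\<^esub> ?x"
    unfolding localize_eq[OF L] localize_eq[OF R] r_coset_def
  proof (intro equalityI subsetI)
    fix w assume "w \<in> {qcls S | S. qC S \<and> (\<forall>n. S n \<in> loc L)}"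
    then obtain S where S: "w = qcls S" "qC S" "\<And>n. S n \<in> loc L" by blast
    define T where "T = (\<lambda>n. scl (1 / ?n) (qmul a b (S n) (qcnj x)))"
    have T: "qC T" unfolding T_def by (intro qC_scl qC_qmul S qC_const Cauchy_const)
    have ST: "qmul a b (T n) x = S n" for n
      using x by (simp add: T_def qmul_assoc qmul_qcnj_left)
    have "T n \<in> loc R" for n
    proof -
      obtain y where "y \<in> loc R" "S n = qmul a b y x" using LRx'[OF S(3)] by blast
      then show ?thesis using x by (simp add: T_def qmul_assoc qmul_qcnj_right)
    qed
    moreover have "w = qcls T \<otimes>\<^bsub>quat_Qp l a b\<^esub> ?x" using T by (simp add: qcls_mult ST S(1))
    ultimately show "w \<in> (\<Union>h\<in>{qcls S | S. qC S \<and> (\<forall>n. S n \<in> loc R)}. {h \<otimes>\<^bsub>quat_Qp l a b\<^esub> ?x})"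
      using T by blast
  next
    fix w assume "w \<in> (\<Union>h\<in>{qcls S | S. qC S \<and> (\<forall>n. S n \<in> loc R)}. {h \<otimes>\<^bsub>quat_Qp l a b\<^esub> ?x})"
    then obtain T where T: "qC T" "\<And>n. T n \<in> loc R" "w = qcls T \<otimes>\<^bsub>quat_Qp l a b\<^esub> ?x" by blast
    then have "w = qcls (\<lambda>n. qmul a b (T n) x)" by (simp add: qcls_mult)
    then show "w \<in> {qcls S | S. qC S \<and> (\<forall>n. S n \<in> loc L)}"
      using RxL' T(2) qC_qmul[OF T(1) qC_const] by blast
  qed
qed

text \<open>The coset of x is stable under left multiplication by R. This is seen in the completion,
  where x lives, and brought back by \<open>localize_Int\<close>.\<close>

lemma locally_principal_mult:
  assumes L: "addsub L" "full L" and R: "addsub R" "full R"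
    and Rm: "\<And>x y. x \<in> R \<Longrightarrow> y \<in> R \<Longrightarrow> qmul a b x y \<in> R"
    and x: "x \<in> Units (quat_Qp l a b)" "localize l a b L = localize l a b R #>\<^bsub>quat_Qp l a b\<^esub> x"
    and A: "A \<in> R" and w: "w \<in> L"
  shows "qmul a b A w \<in> loc L"
proof -
  have xc: "x \<in> carrier (quat_Qp l a b)" using x(1) by (simp add: Units_def)
  have "qcls (\<lambda>n. w) \<in> localize l a b R #>\<^bsub>quat_Qp l a b\<^esub> x"
    using localize_superset[OF L loc_superset[OF w]] by (simp add: x(2)[symmetric])
  then obtain T where T: "qC T" "\<And>n. T n \<in> loc R" "qcls (\<lambda>n. w) = qcls T \<otimes>\<^bsub>quat_Qp l a b\<^esub> x"
    unfolding localize_eq[OF R] r_coset_def by blast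
  have AT: "qmul a b A (T n) \<in> loc R" for n
  proof -
    from T(2) obtain m where m: "\<not> int l dvd m" "scl (of_int m) (T n) \<in> R" by (rule locE)
    then show ?thesis using Rm[OF A m(2)] by (intro locI[of m]) simp_all
  qed
  have "qcls (\<lambda>n. qmul a b A w) = qcls (\<lambda>n. A) \<otimes>\<^bsub>quat_Qp l a b\<^esub> qcls (\<lambda>n. w)"
    by (simp add: qcls_mult)
  also have "\<dots> = (qcls (\<lambda>n. A) \<otimes>\<^bsub>quat_Qp l a b\<^esub> qcls T) \<otimes>\<^bsub>quat_Qp l a b\<^esub> x"
    unfolding T(3) by (rule qcls_mult_assoc[symmetric]) (use T(1) xc in \<open>auto simp: carrier_quat_Qp\<close>)
  also have "\<dots> = qcls (\<lambda>n. qmul a b A (T n)) \<otimes>\<^bsub>quat_Qp l a b\<^esub> x" using T(1) by (simp add: qcls_mult)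
  also have "\<dots> \<in> localize l a b R #>\<^bsub>quat_Qp l a b\<^esub> x"
    unfolding localize_eq[OF R] r_coset_def using AT qC_qmul[OF qC_const T(1)] by blast
  finally show ?thesis unfolding x(2)[symmetric] by (rule localize_Int[OF L])
qed

text \<open>A late term Z of a sequence representing the l-adic generator still generates up to any
  prescribed precision j. The same Z has to serve w and y, because the two are later divided by each
  other.\<close>

lemma locally_principal_approx:
  assumes L: "addsub L" "full L" and R: "addsub R" "full R" and 1: "qone \<in> R"
    and x: "x \<in> Units (quat_Qp l a b)" "localize l a b L = localize l a b R #>\<^bsub>quat_Qp l a b\<^esub> x"
    and w: "w \<in> L" and y: "y \<in> L"
  shows "\<exists>Z\<in>loc L. \<exists>A\<in>loc R. \<exists>B\<in>loc R. \<exists>u\<in>loc L. \<exists>v\<in>loc L.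
    w = qmul a b A Z + scl (of_nat l ^ j) u \<and> y = qmul a b B Z + scl (of_nat l ^ j) v"
proof -
  have xc: "x \<in> carrier (quat_Qp l a b)" using x(1) by (simp add: Units_def)
  obtain Z' where Z': "qC Z'" "x = qcls Z'" using xc by (auto simp: carrier_quat_Qp)
  have "\<one>\<^bsub>quat_Qp l a b\<^esub> \<otimes>\<^bsub>quat_Qp l a b\<^esub> x \<in> localize l a b R #>\<^bsub>quat_Qp l a b\<^esub> x"
    unfolding r_coset_def qcls_one using localize_superset[OF R loc_superset[OF 1]] by blast
  moreover have "\<one>\<^bsub>quat_Qp l a b\<^esub> \<otimes>\<^bsub>quat_Qp l a b\<^esub> x = x"
    using Z' by (simp add: qcls_one qcls_mult)
  ultimately have "x \<in> localize l a b L" using x(2) by simp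
  then obtain Z where Z: "qC Z" "\<And>n. Z n \<in> loc L" "x = qcls Z" unfolding localize_eq[OF L] by blast
  have "\<exists>T. qC T \<and> (\<forall>n. T n \<in> loc R) \<and> qN (\<lambda>n. w - qmul a b (T n) (Z n))" if "w \<in> L" for w
  proof -
    have "qcls (\<lambda>n. w) \<in> localize l a b R #>\<^bsub>quat_Qp l a b\<^esub> x"
      using localize_superset[OF L loc_superset[OF that]] by (simp add: x(2)[symmetric])
    then obtain T where "qC T" "\<And>n. T n \<in> loc R" "qcls (\<lambda>n. w) = qcls T \<otimes>\<^bsub>quat_Qp l a b\<^esub> x"
      unfolding localize_eq[OF R] r_coset_def by blast
    then show ?thesis using Z by (auto simp: qcls_mult qcls_eq_iff intro!: exI[of _ T])
  qed
  then obtain T U where T: "\<And>n. T n \<in> loc R" "qN (\<lambda>n. w - qmul a b (T n) (Z n))"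
    and U: "\<And>n. U n \<in> loc R" "qN (\<lambda>n. y - qmul a b (U n) (Z n))" using w y by meson
  obtain M where M: "\<forall>n\<ge>M. \<exists>z\<in>loc L. w - qmul a b (T n) (Z n) = scl (of_nat l ^ j) z"
    using qN_eventually_scl[OF L T(2)] by blast
  obtain N where N: "\<forall>n\<ge>N. \<exists>z\<in>loc L. y - qmul a b (U n) (Z n) = scl (of_nat l ^ j) z"
    using qN_eventually_scl[OF L U(2)] by blast
  let ?n = "max M N"
  obtain u where u: "u \<in> loc L" "w - qmul a b (T ?n) (Z ?n) = scl (of_nat l ^ j) u"
    using M max.cobounded1 by blast
  obtain v where v: "v \<in> loc L" "y - qmul a b (U ?n) (Z ?n) = scl (of_nat l ^ j) v"
    using N max.cobounded2 by blast
  have "w = qmul a b (T ?n) (Z ?n) + scl (of_nat l ^ j) u" "y = qmul a b (U ?n) (Z ?n) + scl (of_nat l ^ j) v"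
    unfolding u(2)[symmetric] v(2)[symmetric] by simp_all
  then show ?thesis using Z(2) T(1) U(1) u(1) v(1) by blast
qed

end


section \<open>Orders\<close>

text \<open>The hypotheses make I an ideal of the integers contained in no prime ideal. It is
  applied to the ideal of multipliers that bring an element into a lattice, or a rational into the
  integers, and so gives the local-global principles.\<close>

lemma int_ideal_one:
  fixes I :: "int set"
  assumes diff: "\<And>m n. m \<in> I \<Longrightarrow> n \<in> I \<Longrightarrow> m - n \<in> I"
    and mult: "\<And>m n. m \<in> I \<Longrightarrow> n * m \<in> I"
    and l: "\<And>l::nat. Factorial_Ring.prime l \<Longrightarrow> \<exists>m\<in>I. \<not> int l dvd m"
  shows "1 \<in> I"
proof -
  \<comment> \<open>The prime 2 serves to produce a nonzero element.\<close>
  obtain m where m: "m \<in> I" "\<not> int 2 dvd m" using l[of 2] by auto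
  then have "m \<noteq> 0" by auto
  then have "\<bar>m\<bar> \<in> I" "\<bar>m\<bar> > 0" using m(1) mult[of m "-1"] by (auto simp: abs_if)
  then have ex: "\<exists>n>0. int n \<in> I" by (intro exI[of _ "nat \<bar>m\<bar>"]) auto
  define d where "d = (LEAST n. n > 0 \<and> int n \<in> I)"
  have d: "d > 0" "int d \<in> I" using LeastI_ex[OF ex] by (auto simp: d_def)
  have dvd: "int d dvd n" if "n \<in> I" for n
  proof (rule ccontr)
    assume nd: "\<not> int d dvd n"
    have "n mod int d \<in> I"
      using diff[OF that mult[OF d(2), of "n div int d"]] by (simp only: minus_div_mult_eq_mod)
    moreover have "n mod int d > 0" 
      using nd d(1) pos_mod_sign[of "int d" n] unfolding dvd_eq_mod_eq_0 by linarith
    ultimately have "d \<le> nat (n mod int d)" unfolding d_def by (intro Least_le) auto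
    then show False using pos_mod_bound[of "int d" n] d(1) \<open>n mod int d > 0\<close> by linarith
  qed
  have "d = 1"
  proof (rule ccontr)
    assume "d \<noteq> 1"
    then obtain l where "Factorial_Ring.prime l" "l dvd d" using prime_factor_nat by blast
    then show False using l[of l] dvd by (meson dvd_trans int_dvd_int_iff)
  qed
  then show ?thesis using d by simp
qed

lemma global_of_local:
  assumes L: "addsub L" and x: "\<And>l. Factorial_Ring.prime l \<Longrightarrow> x \<in> rational_prime.loc l L"
  shows "x \<in> L"
proof -
  have "1 \<in> {m. scl (of_int m) x \<in> L}"
  proof (rule int_ideal_one)
    fix l :: nat assume l: "Factorial_Ring.prime l"
    interpret rational_prime l by unfold_locales (rule l)
    show "\<exists>m\<in>{m. scl (of_int m) x \<in> L}. \<not> int l dvd m" using x[OF l] by (auto elim: locE)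
  qed (auto simp: scl_diff_left intro: addsubD[OF L] dest: addsub_scl_int[OF L])
  then show ?thesis by simp
qed

lemma coprime_scl_mem:
  fixes L :: "rat quat set"
  assumes L: "addsub L" and "scl (of_int m) x \<in> L" "scl (of_int n) x \<in> L" "coprime m n"
  shows "x \<in> L"
proof -
  obtain u v where uv: "u * m + v * n = 1" using \<open>coprime m n\<close> by (metis bezout_int coprime_iff_gcd_eq_1)
  have "scl (of_int u) (scl (of_int m) x) + scl (of_int v) (scl (of_int n) x) \<in> L"
    by (intro addsubD(4)[OF L] addsub_scl_int[OF L] assms)
  also have "scl (of_int u) (scl (of_int m) x) + scl (of_int v) (scl (of_int n) x) = scl (of_int (u * m + v * n)) x"
    by (simp add: scl_add_left)
  finally show ?thesis by (simp add: uv)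
qed

lemma Ints_of_lint:
  assumes "\<And>l. Factorial_Ring.prime l \<Longrightarrow> r \<in> lint l"
  shows "r \<in> \<int>"
proof -
  have "1 \<in> {m::int. of_int m * r \<in> \<int>}"
    by (rule int_ideal_one) (use assms in \<open>auto simp: left_diff_distrib mult.assoc lint_def\<close>)
  then show ?thesis by simp
qed

text \<open>The powers of x stay in R, whose norms have a common denominator E; so all
  \<open>N(x)^k * E\<close> are integers, and N(x) is integral at every prime.\<close>

lemma order_norm_Ints:
  assumes R: "is_order a b R" and x: "x \<in> R"
  shows "red_norm a b x \<in> \<int>"
proof (cases "red_norm a b x = 0")
  case False
  obtain M :: int where M: "M > 0" "\<And>x. x \<in> R \<Longrightarrow> intq (scl (of_int M) x)"
    using R by (auto simp: is_order_iff bdd_def)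
  obtain c d :: int where c: "c > 0" "of_int c * a \<in> \<int>" and d: "d > 0" "of_int d * b \<in> \<int>"
    using Ints_common_denominator by metis
  \<comment> \<open>The factors c and d clear the coefficients of the norm form, and
    \<open>M^2\<close> comes from moving an element of R into the standard lattice.\<close>
  define E :: rat where "E = of_int c * of_int d * of_int M ^ 2"
  have int: "of_int c * of_int d * red_norm a b z \<in> \<int>" if "intq z" for z
  proof -
    obtain a' b' where ab: "of_int c * a = of_int a'" "of_int d * b = of_int b'" using c d by (auto elim!: Ints_cases)
    have "of_int c * of_int d * (q_1 z)^2 - of_int d * of_int a' * (q_i z)^2 - of_int c * of_int b' * (q_j z)^2
      + of_int a' * of_int b' * (q_k z)^2 \<in> \<int>"
      using that unfolding intq_def power2_eq_square
      by (intro Ints_add Ints_diff Ints_mult Ints_of_int) auto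
    then show ?thesis by (simp add: red_norm_def algebra_simps ab[symmetric])
  qed
  have "\<exists>z\<in>R. red_norm a b z = red_norm a b x ^ k" for k
  proof (induction k)
    case 0 then show ?case using R by (intro bexI[of _ qone]) (auto simp: is_order_iff)
  next
    case (Suc k)
    then obtain z where "z \<in> R" "red_norm a b z = red_norm a b x ^ k" by blast
    then show ?case using R x by (intro bexI[of _ "qmul a b x z"]) (auto simp: is_order_iff red_norm_qmul)
  qed
  then have pw: "red_norm a b x ^ k * E \<in> \<int>" for k
    using int M(2) unfolding E_def by (metis (no_types, lifting) mult.commute mult.left_commute red_norm_simps(1))
  show ?thesis
  proof (rule Ints_of_lint)
    fix l :: nat assume "Factorial_Ring.prime l"
    then interpret rational_prime l by unfold_locales
    show "red_norm a b x \<in> lint l"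
      by (rule lint_all_powers[of E]) (use pw M c d in \<open>auto simp: E_def intro!: lint_Ints\<close>)
  qed
qed simp

text \<open>Tr(x) = N(x + 1) - N(x) - 1.\<close>

lemma order_trace_Ints:
  assumes R: "is_order a b R" and x: "x \<in> R"
  shows "red_trace x \<in> \<int>"
proof -
  have "x + qone \<in> R" using R x by (auto simp: is_order_iff intro: addsubD)
  then have "red_norm a b (x + qone) \<in> \<int>" by (rule order_norm_Ints[OF R])
  then have "red_norm a b (x + qone) - red_norm a b x - 1 \<in> \<int>" using order_norm_Ints[OF R x] by auto
  then show ?thesis by (simp add: red_norm_add)
qed

lemma order_qcnj: "is_order a b R \<Longrightarrow> x \<in> R \<Longrightarrow> qcnj x \<in> R"
  unfolding qcnj_eq using order_trace_Ints
  by (auto simp: is_order_iff intro!: addsubD(2) addsub_scl_Ints)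

lemma full_mono: "full L \<Longrightarrow> L \<subseteq> M \<Longrightarrow> full M"
  unfolding full_def by blast

lemma bdd_mono: "bdd M \<Longrightarrow> L \<subseteq> M \<Longrightarrow> bdd L"
  unfolding bdd_def by blast

lemma bdd_scl:
  assumes "bdd M" "k > 0" "\<And>x. x \<in> L \<Longrightarrow> scl (of_int k) x \<in> M"
  shows "bdd L"
proof -
  obtain m :: int where "m > 0" "\<And>x. x \<in> M \<Longrightarrow> intq (scl (of_int m) x)" using assms(1) by (auto simp: bdd_def)
  then show ?thesis using assms unfolding bdd_def by (intro exI[of _ "m * k"]) fastforce
qed

context rational_prime
begin

section \<open>Maximal orders and locally principal ideals at one prime\<close>

lemma decompose: "n > 0 \<Longrightarrow> \<exists>k m. n = int l ^ k * m \<and> \<not> int l dvd m \<and> m > 0"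
proof -
  assume n: "n > 0"
  have "\<not> is_unit (int l)" using prime_int by (simp add: not_prime_unit)
  then obtain m where m: "n = int l ^ multiplicity (int l) n * m" "\<not> int l dvd m"
    using multiplicity_decompose'[of n "int l"] n by auto
  moreover have "m > 0" using m(1) n gt_1 by (metis of_nat_0_less_iff of_nat_pos(4) zero_less_mult_pos zero_less_power)
  ultimately show ?thesis by blast
qed

lemma loc_pow_mem:
  assumes L: "addsub L" and x: "x \<in> loc L" and k: "scl (of_nat l ^ k) x \<in> L"
  shows "x \<in> L"
proof -
  from x obtain m where m: "\<not> int l dvd m" "scl (of_int m) x \<in> L" by (rule locE)
  have "coprime m (int l ^ k)" using prime_imp_coprime[OF prime_int m(1)] by (simp add: coprime_commute)
  then show ?thesis using coprime_scl_mem[OF L m(2), of "int l ^ k"] k by simp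
qed

lemma loc_norm: "is_order a b R \<Longrightarrow> x \<in> loc R \<Longrightarrow> red_norm a b x \<in> lint l"
proof -
  assume R: "is_order a b R" and "x \<in> loc R"
  then obtain m where m: "\<not> int l dvd m" "scl (of_int m) x \<in> R" by (auto elim: locE)
  then have "(of_int m)\<^sup>2 * red_norm a b x \<in> \<int>" using order_norm_Ints[OF R m(2)] by simp
  then have "of_int (m * m) * red_norm a b x \<in> \<int>" by (simp add: power2_eq_square)
  then show ?thesis unfolding lint_def using not_dvd_mult[OF m(1) m(1)] by blast
qed

lemma loc_qmul: "(\<And>x y. x \<in> R \<Longrightarrow> y \<in> L \<Longrightarrow> qmul a b x y \<in> M) \<Longrightarrow> x \<in> loc R \<Longrightarrow> y \<in> loc L \<Longrightarrow> qmul a b x y \<in> loc M"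
proof -
  assume mul: "\<And>x y. x \<in> R \<Longrightarrow> y \<in> L \<Longrightarrow> qmul a b x y \<in> M" and x: "x \<in> loc R" and y: "y \<in> loc L"
  from x obtain m where m: "\<not> int l dvd m" "scl (of_int m) x \<in> R" by (rule locE)
  from y obtain n where n: "\<not> int l dvd n" "scl (of_int n) y \<in> L" by (rule locE)
  show ?thesis using mul[OF m(2) n(2)] by (intro locI[of "m * n"] not_dvd_mult m n) (simp add: mult.commute)
qed

lemma loc_order_qmul: "is_order a b R \<Longrightarrow> x \<in> loc R \<Longrightarrow> y \<in> loc R \<Longrightarrow> qmul a b x y \<in> loc R"
  by (rule loc_qmul[of R R]) (auto simp: is_order_iff)

lemma loc_qcnj: "is_order a b R \<Longrightarrow> x \<in> loc R \<Longrightarrow> qcnj x \<in> loc R"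
  using order_qcnj by (auto elim!: locE intro!: locI) (metis qcnj_simps(2))

text \<open>The elements of \<open>S\<close> with an \<open>l\<close>-power multiple in \<open>R\<close> form an order, which maximality forces to be \<open>R\<close>.\<close>

lemma maximal_order_loc:
  assumes R: "is_maximal_order a b R"
    and S: "addsub S" "\<And>x y. x \<in> S \<Longrightarrow> y \<in> S \<Longrightarrow> qmul a b x y \<in> S" "R \<subseteq> S"
    and K: "K > 0" "\<And>x. x \<in> S \<Longrightarrow> scl (of_int K) x \<in> loc R"
  shows "S \<subseteq> loc R"
proof -
  have RO: "is_order a b R" using R by (simp add: is_maximal_order_def)
  then have Ra: "addsub R" and Rf: "full R" and Rb: "bdd R" and R1: "qone \<in> R"
    and Rm: "\<And>x y. x \<in> R \<Longrightarrow> y \<in> R \<Longrightarrow> qmul a b x y \<in> R" by (auto simp: is_order_iff)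
  define S' where "S' = {x\<in>S. \<exists>k. scl (of_nat l ^ k) x \<in> R}"
  have pow_mono: "scl (of_nat l ^ (k + j)) x \<in> R" if "scl (of_nat l ^ k) x \<in> R" for k j x
    using addsub_scl_Ints[OF Ra that, of "of_nat l ^ j"] by (simp add: power_add mult.commute)
  have sub: "R \<subseteq> S'" using S(3) by (auto simp: S'_def intro!: exI[of _ 0])
  have "addsub S'" unfolding addsub_def
  proof (intro conjI ballI)
    show "0 \<in> S'" using sub addsubD(1)[OF Ra] by blast
    fix x y assume "x \<in> S'" "y \<in> S'"
    then obtain j k where jk: "x \<in> S" "y \<in> S" "scl (of_nat l ^ j) x \<in> R" "scl (of_nat l ^ k) y \<in> R"
      by (auto simp: S'_def)
    have "scl (of_nat l ^ (j + k)) x - scl (of_nat l ^ (k + j)) y \<in> R"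
      by (intro addsubD(2)[OF Ra] pow_mono jk)
    then have "scl (of_nat l ^ (j + k)) (x - y) \<in> R" by (simp add: scl_diff_right add.commute)
    then show "x - y \<in> S'" using addsubD(2)[OF S(1) jk(1,2)] unfolding S'_def by blast
  qed
  moreover have "bdd S'"
  proof (rule bdd_scl[OF Rb K(1)])
    fix x assume "x \<in> S'"
    then obtain k where x: "x \<in> S" "scl (of_nat l ^ k) x \<in> R" by (auto simp: S'_def)
    have "scl (of_nat l ^ k) (scl (of_int K) x) \<in> R"
      using addsub_scl_int[OF Ra x(2), of K] by (simp add: mult.commute)
    \<comment> \<open>\<open>K x\<close> needs at most a denominator prime to l and at most one that
      is a power of l, hence none.\<close>
    then show "scl (of_int K) x \<in> R" by (rule loc_pow_mem[OF Ra K(2)[OF x(1)]])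
  qed
  moreover have "qmul a b x y \<in> S'" if "x \<in> S'" "y \<in> S'" for x y
  proof -
    from that obtain j k where jk: "x \<in> S" "y \<in> S" "scl (of_nat l ^ j) x \<in> R" "scl (of_nat l ^ k) y \<in> R"
      by (auto simp: S'_def)
    have "scl (of_nat l ^ (j + k)) (qmul a b x y) \<in> R"
      using Rm[OF jk(3,4)] by (simp add: power_add mult.commute)
    then show ?thesis using S(2)[OF jk(1,2)] unfolding S'_def by blast
  qed
  ultimately have "is_order a b S'" using full_mono[OF Rf sub] sub R1 by (auto simp: is_order_iff)
  then have eq: "S' = R" using R sub by (simp add: is_maximal_order_def)
  show ?thesis
  proof
    fix x assume x: "x \<in> S"
    obtain n :: int where n: "n > 0" "scl (of_int n) x \<in> R" using fullD[OF Rf] by blast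
    then obtain k m where m: "n = int l ^ k * m" "\<not> int l dvd m" using decompose by blast
    have "scl (of_nat l ^ k) (scl (of_int m) x) \<in> R" using n(2) by (simp add: m(1))
    then have "scl (of_int m) x \<in> S'" using addsub_scl_int[OF S(1) x] unfolding S'_def by blast
    then show "x \<in> loc R" using m(2) eq by (intro locI) auto
  qed
qed

text \<open>Right multiplication by h has bounded denominators on L. Their part prime to l is
  harmless in \<open>loc R\<close>, which leaves a power of l.\<close>

lemma bdd_mult_loc:
  assumes L: "bdd L" and R: "addsub R" "full R"
  shows "\<exists>j>0. \<forall>z\<in>loc L. scl (of_nat l ^ j) (qmul a b z h) \<in> loc R"
proof -
  obtain M :: int where M: "M > 0" "\<And>z. z \<in> L \<Longrightarrow> intq (scl (of_int M) z)" using L by (auto simp: bdd_def)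
  have R': "addsub {z. scl r (qmul a b z h) \<in> R}" for r
    using addsubD[OF R(1)] by (auto simp: addsub_def qmul_diff_left scl_diff_right)
  have D: "\<exists>D>0. scl (of_int D) (qmul a b z h) \<in> R" for z using fullD[OF R(2)] by blast
  have "full {z. qmul a b z h \<in> R}"
    by (rule fullI) (use R'[of 1] D in auto)
  then obtain D :: int where D: "D > 0" "\<And>z. intq z \<Longrightarrow> scl (of_int D) (qmul a b z h) \<in> R"
    by (auto simp: full_def)
  have "D * M > 0" using D(1) M(1) by simp
  from decompose[OF this] obtain k m where m: "D * M = int l ^ k * m" "\<not> int l dvd m" by blast
  \<comment> \<open>\<open>Suc k\<close> keeps the exponent positive, as needed when this precision
    is used to reduce modulo l.\<close>
  have "scl (of_nat l ^ Suc k) (qmul a b z h) \<in> loc R" if "z \<in> loc L" for z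
  proof -
    from that obtain n where n: "\<not> int l dvd n" "scl (of_int n) z \<in> L" by (rule locE)
    have "scl (of_int (D * M)) (qmul a b (scl (of_int n) z) h) \<in> R" using D(2)[OF M(2)[OF n(2)]] by (simp add: mult.assoc)
    then have "scl (of_int (m * n)) (scl (of_nat l ^ k) (qmul a b z h)) \<in> R" unfolding m(1) by (simp add: mult_ac)
    from locI[OF not_dvd_mult[OF m(2) n(1)] this]
    have "scl (of_nat l) (scl (of_nat l ^ k) (qmul a b z h)) \<in> loc R" by (rule loc_scl[OF R(1)]) simp
    then show ?thesis by simp
  qed
  then show ?thesis by blast
qed

text \<open>By \<open>min\<close> the norm of y has least valuation on L. With an approximate
  generator Z, write y as B Z and w as A Z up to multiples of l^j. Minimality makes N(B) a unit, so
  B is invertible in \<open>loc R\<close>, and w is A B^-1 y up to an error that a sufficiently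
  large j moves into \<open>loc R\<close>.\<close>

lemma locally_principal_generator:
  assumes L: "addsub L" "full L" "bdd L" and R: "is_order a b R"
    and x: "\<exists>x \<in> Units (quat_Qp l a b). localize l a b L = localize l a b R #>\<^bsub>quat_Qp l a b\<^esub> x"
    and y: "y \<in> L" "red_norm a b y \<noteq> 0"
    and min: "\<And>w. w \<in> L \<Longrightarrow> red_norm a b w / red_norm a b y \<in> lint l"
    and w: "w \<in> L"
  shows "scl (1 / red_norm a b y) (qmul a b w (qcnj y)) \<in> loc R"
proof -
  have Ra: "addsub R" and Rf: "full R" and R1: "qone \<in> R"
    and Rm: "\<And>x y. x \<in> R \<Longrightarrow> y \<in> R \<Longrightarrow> qmul a b x y \<in> R" using R by (auto simp: is_order_iff)
  let ?n = "red_norm a b y"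
  define h where "h = scl (1 / ?n) (qcnj y)"
  have yh: "qmul a b y h = qone" using y(2) by (simp add: h_def qmul_qcnj_right)
  obtain x where x: "x \<in> Units (quat_Qp l a b)" "localize l a b L = localize l a b R #>\<^bsub>quat_Qp l a b\<^esub> x"
    using x by blast
  have RL: "qmul a b A z \<in> loc L" if "A \<in> loc R" "z \<in> loc L" for A z
    by (rule loc_loc, rule loc_qmul[OF _ that]) (rule locally_principal_mult[OF L(1,2) Ra Rf Rm x])
  have min': "red_norm a b z / ?n \<in> lint l" if z: "z \<in> loc L" for z
  proof -
    from z obtain m where m: "\<not> int l dvd m" "scl (of_int m) z \<in> L" by (rule locE)
    have m0: "m \<noteq> 0" using m by auto
    have "red_norm a b (scl (of_int m) z) / ?n / of_int (m * m) \<in> lint l"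
      by (intro lint_div_int not_dvd_mult m min)
    then show ?thesis using m0 by (simp add: power2_eq_square)
  qed
  have tr: "red_trace (qmul a b u (qcnj v)) / ?n \<in> lint l" if u: "u \<in> loc L" and v: "v \<in> loc L" for u v
  proof -
    have "red_norm a b (u + v) / ?n - red_norm a b u / ?n - red_norm a b v / ?n \<in> lint l"
      by (intro lint_diff min' addsubD(4)[OF addsub_loc[OF L(1)]] u v)
    then show ?thesis by (simp add: red_norm_add diff_divide_distrib[symmetric] add_divide_distrib)
  qed
  obtain j where j: "j > 0" "\<forall>z\<in>loc L. scl (of_nat l ^ j) (qmul a b z h) \<in> loc R"
    using bdd_mult_loc[OF L(3) Ra Rf] by blast
  obtain Z A B u v where loc: "Z \<in> loc L" "A \<in> loc R" "B \<in> loc R" "u \<in> loc L" "v \<in> loc L"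
    and we: "w = qmul a b A Z + scl (of_nat l ^ j) u" and ye: "y = qmul a b B Z + scl (of_nat l ^ j) v"
    using locally_principal_approx[OF L(1,2) Ra Rf R1 x w y(1), of j] by blast
  let ?B = "red_norm a b B"
  let ?q = "red_norm a b Z / ?n"
  let ?e = "red_trace (qmul a b (qmul a b B Z) (qcnj v)) / ?n + of_nat l ^ j * (red_norm a b v / ?n)"
  have "?n = ?B * red_norm a b Z + (of_nat l ^ j)\<^sup>2 * red_norm a b v
      + of_nat l ^ j * red_trace (qmul a b (qmul a b B Z) (qcnj v))"
    by (subst ye) (simp add: red_norm_add red_norm_qmul)
  then have "?n / ?n = (?B * red_norm a b Z + (of_nat l ^ j)\<^sup>2 * red_norm a b v
      + of_nat l ^ j * red_trace (qmul a b (qmul a b B Z) (qcnj v))) / ?n" by (rule arg_cong)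
  \<comment> \<open>Modulo l this reads 1 = N(B) N(Z) / N(y). The last quotient is integral by
    minimality, so N(B) is a unit.\<close>
  then have e: "1 = ?B * ?q + of_nat l ^ j * ?e"
    using y(2) by (simp add: add_divide_distrib power2_eq_square distrib_left mult_ac)
  have el: "?e \<in> lint l"
    by (intro lint_add lint_mult tr min' RL loc) simp
  have "\<not> vge l 1 ?B"
  proof
    assume "vge l 1 ?B"
    moreover have "vge l 1 (of_nat l ^ j)" by (rule vge_mono[OF vge_of_nat_power]) (use j in auto)
    ultimately have "vge l 1 (?B * ?q + of_nat l ^ j * ?e)"
      by (intro vge_add vge_mult_right el min' loc)
    then have "vge l 1 (of_int 1)" unfolding e[symmetric] by simp
    then show False unfolding vge_of_int_iff by simp
  qed
  moreover have Bl: "?B \<in> lint l" by (rule loc_norm[OF R loc(3)])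
  ultimately have Bi: "1 / ?B \<in> lint l" and B0: "?B \<noteq> 0" by (auto intro: lint_unit_inverse)
  let ?C = "scl (1 / ?B) (qmul a b A (qcnj B))"
  have C: "?C \<in> loc R" by (intro loc_scl[OF Ra] loc_order_qmul[OF R] loc_qcnj[OF R] loc Bi)
  have "qmul a b A Z = scl (1 / ?B) (qmul a b A (qmul a b (qmul a b (qcnj B) B) Z))"
    using B0 by (simp add: qmul_qcnj_left)
  also have "\<dots> = qmul a b ?C (qmul a b B Z)" by (simp add: qmul_assoc)
  also have "qmul a b B Z = y - scl (of_nat l ^ j) v" using ye by simp
  finally have "qmul a b w h = qmul a b (qmul a b ?C (y - scl (of_nat l ^ j) v) + scl (of_nat l ^ j) u) h"
    by (subst we) simp
  \<comment> \<open>\<open>?C\<close> is A B^-1. By the choice of j the quotients of l^j u and l^j v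
    by y lie in \<open>loc R\<close>.\<close>
  also have "\<dots> = ?C - qmul a b ?C (scl (of_nat l ^ j) (qmul a b v h)) + scl (of_nat l ^ j) (qmul a b u h)"
    by (simp add: qmul_add_left qmul_diff_left qmul_diff_right qmul_assoc yh scl_diff_right)
  also have "\<dots> \<in> loc R"
    using j loc by (intro addsubD[OF addsub_loc[OF Ra]] loc_order_qmul[OF R] C) auto
  finally show ?thesis by (simp add: h_def)
qed

text \<open>
  Write \<open>\<sigma>\<close> for conjugation by \<open>y\<close>. On the elements \<open>w\<close> with \<open>y w = w y'\<close>, where \<open>y'\<close> is the conjugate
  of \<open>y\<close>, it satisfies \<open>\<sigma>\<^sup>2 w + w = t \<sigma> w\<close> with \<open>t = Tr(y)\<^sup>2 / N(y) - 2\<close>. Hence \<open>w \<mapsto> t \<sigma> w\<close> maps these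
  elements of the localised order to themselves and multiplies their norms by \<open>t\<^sup>2\<close>, so \<open>t\<close> is integral.
\<close>

lemma normalizer_trace:
  assumes R: "is_order a b R" and ab: "a \<noteq> 0" "b \<noteq> 0"
    and aniso: "\<And>x. red_norm a b x = 0 \<Longrightarrow> x = 0"
    and y: "red_norm a b y \<in> lint l" "red_norm a b y \<noteq> 0"
    and conj: "\<And>z. z \<in> loc R \<Longrightarrow> scl (1 / red_norm a b y) (qmul a b (qmul a b y z) (qcnj y)) \<in> loc R"
  shows "red_trace y \<in> lint l"
proof -
  have Ra: "addsub R" and Rf: "full R" using R by (auto simp: is_order_iff)
  let ?n = "red_norm a b y"
  let ?t = "(red_trace y)\<^sup>2 / ?n - 2"
  let ?s = "\<lambda>z. scl (1 / ?n) (qmul a b (qmul a b y z) (qcnj y))"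
  have "?t \<in> lint l \<or> (red_trace y)\<^sup>2 = 4 * ?n"
  proof (cases "q_i y = 0 \<and> q_j y = 0 \<and> q_k y = 0")
    case True
    then show ?thesis by (simp add: red_trace_def red_norm_def power_mult_distrib)
  next
    case False
    \<comment> \<open>A commutator of y with any e anticommutes with the pure part of y, which is
      \<open>yc\<close> below. Taking e = i gives a nonzero one unless y commutes with i; then e = j
      does.\<close>
    define c where "c = (if q_j y = 0 \<and> q_k y = 0 then qmul a b y (Quat 0 0 1 0) - qmul a b (Quat 0 0 1 0) y
      else qmul a b y (Quat 0 1 0 0) - qmul a b (Quat 0 1 0 0) y)"
    have c0: "c \<noteq> 0"
    proof
      assume "c = 0"
      then have "q_i c = 0 \<and> q_j c = 0 \<and> q_k c = 0" by simp
      then show False using False ab by (auto simp: c_def split: if_splits)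
    qed
    have yc: "qmul a b y c = qmul a b c (qcnj y)"
      unfolding c_def by (auto intro!: quat_eqI simp: algebra_simps)
    obtain D :: int where D: "D > 0" "scl (of_int D) c \<in> R" using fullD[OF Rf] by blast
    define W where "W = {w \<in> loc R. qmul a b y w = qmul a b w (qcnj y)}"
    have w0: "scl (of_int D) c \<in> W" using D yc by (auto simp: W_def intro: loc_superset)
    have step: "scl ?t (?s w) \<in> W \<and> red_norm a b (scl ?t (?s w)) = ?t\<^sup>2 * red_norm a b w" if "w \<in> W" for w
    proof (intro conjI)
      have w: "w \<in> loc R" "qmul a b y w = qmul a b w (qcnj y)" using that by (auto simp: W_def)
      let ?c = "qcnj y"
      have w': "qmul a b y (qmul a b w z) = qmul a b w (qmul a b ?c z)" for z
        using arg_cong[OF w(2), of "\<lambda>u. qmul a b u z"] by (simp add: qmul_assoc)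
      have s: "?s w = scl (1 / ?n) (qmul a b w (qmul a b ?c ?c))" by (simp add: w(2) qmul_assoc)
      have ys: "qmul a b y (?s w) = qmul a b (?s w) ?c"
        unfolding s by (simp add: qmul_assoc[symmetric] w(2))
      have cc: "qmul a b ?c ?c = scl (red_trace y) ?c - scl ?n qone"
        using qmul_self[of a b "qcnj y"] by simp
      \<comment> \<open>Cayley-Hamilton for the square of the conjugate of y, which has trace
        Tr(y)^2 - 2 N(y) and norm N(y)^2.\<close>
      have c4: "qmul a b (qmul a b ?c ?c) (qmul a b ?c ?c) + scl (?n * ?n) qone
          = scl ((red_trace y)\<^sup>2 - 2 * ?n) (qmul a b ?c ?c)"
        unfolding cc
        by (simp add: qmul_diff_left qmul_diff_right qmul_qcnj_left cc scl_diff_right)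
          (rule quat_eqI; simp add: algebra_simps power2_eq_square)
      have "?s (?s w) + w = scl (1 / (?n * ?n)) (qmul a b w (qmul a b (qmul a b ?c ?c) (qmul a b ?c ?c) + scl (?n * ?n) qone))"
        using y(2) by (simp only: ys) (simp add: s w' qmul_assoc qmul_add_right scl_add_right)
      also have "\<dots> = scl ?t (?s w)"
        unfolding c4 s using y(2) by (simp add: field_simps)
      finally have ss: "?s (?s w) + w = scl ?t (?s w)" .
      have "scl ?t (?s w) \<in> loc R"
        unfolding ss[symmetric] by (intro addsubD(4)[OF addsub_loc[OF Ra]] conj w)
      moreover have "qmul a b y (scl ?t (?s w)) = qmul a b (scl ?t (?s w)) ?c"
        unfolding qmul_scl_right[of a b y ?t "?s w"] qmul_scl_left[of a b ?t "?s w"] ys ..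
      ultimately show "scl ?t (?s w) \<in> W" unfolding W_def by blast
      show "red_norm a b (scl ?t (?s w)) = ?t\<^sup>2 * red_norm a b w"
        using y(2) by (simp add: red_norm_qmul power2_eq_square)
    qed
    have "\<exists>w\<in>W. red_norm a b w = (?t\<^sup>2) ^ k * red_norm a b (scl (of_int D) c)" for k
    proof (induction k)
      case 0 then show ?case using w0 by (intro bexI[of _ "scl (of_int D) c"]) auto
    next
      case (Suc k)
      then obtain w where w: "w \<in> W" "red_norm a b w = (?t\<^sup>2) ^ k * red_norm a b (scl (of_int D) c)" by blast
      then show ?case using step[OF w(1)] by (intro bexI[of _ "scl ?t (?s w)"]) (simp_all add: mult_ac)
    qed
    then have pw: "(?t\<^sup>2) ^ k * red_norm a b (scl (of_int D) c) \<in> lint l" for k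
      using loc_norm[OF R] unfolding W_def by (metis (mono_tags, lifting) mem_Collect_eq)
    have "red_norm a b (scl (of_int D) c) \<noteq> 0"
      using aniso[of c] c0 D(1) by auto
    from lint_all_powers[OF this pw] have "?t\<^sup>2 \<in> lint l" .
    then show ?thesis using lint_of_square[of ?t] by (simp add: power2_eq_square)
  qed
  then have "(red_trace y)\<^sup>2 \<in> lint l"
  proof
    assume "?t \<in> lint l"
    then have "(?t + 2) * ?n \<in> lint l" using y by (intro lint_mult lint_add) auto
    then show ?thesis using y(2) by simp
  qed (use y in auto)
  then show ?thesis by (rule lint_of_square[OF _, unfolded power2_eq_square[symmetric]])
qed

text \<open>In a product of elements of \<open>R + R y\<close>, the map \<open>s\<close> moves y to
  the right across R, and \<open>y y\<close> is reduced by its characteristic polynomial. The trace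
  coefficient of the latter is integral by \<open>normalizer_trace\<close>.\<close>

lemma normalizer_mem:
  assumes R: "is_maximal_order a b R" and ab: "a \<noteq> 0" "b \<noteq> 0"
    and aniso: "\<And>x. red_norm a b x = 0 \<Longrightarrow> x = 0"
    and y: "red_norm a b y \<in> lint l" "red_norm a b y \<noteq> 0"
    and conj: "\<And>z. z \<in> loc R \<Longrightarrow> scl (1 / red_norm a b y) (qmul a b (qmul a b y z) (qcnj y)) \<in> loc R"
  shows "y \<in> loc R"
proof -
  have RO: "is_order a b R" using R by (simp add: is_maximal_order_def)
  then have Ra: "addsub R" and Rf: "full R" and R1: "qone \<in> R" by (auto simp: is_order_iff)
  have La: "addsub (loc R)" by (rule addsub_loc[OF Ra])
  let ?n = "red_norm a b y"
  define s where "s = (\<lambda>z. scl (1 / ?n) (qmul a b (qmul a b y z) (qcnj y)))"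
  have sy: "qmul a b (s z) y = qmul a b y z" for z using y(2) by (simp add: s_def qmul_assoc qmul_qcnj_left)
  have s: "s z \<in> loc R" if "z \<in> loc R" for z using conj[OF that] by (simp add: s_def)
  have ty: "red_trace y \<in> lint l" by (rule normalizer_trace[OF RO ab aniso y conj])
  define S where "S = {u + qmul a b v y | u v. u \<in> loc R \<and> v \<in> loc R}"
  have SI: "u + qmul a b v y \<in> S" if "u \<in> loc R" "v \<in> loc R" for u v using that by (auto simp: S_def)
  obtain K :: int where K: "K > 0" "scl (of_int K) y \<in> R" using fullD[OF Rf] by blast
  have "S \<subseteq> loc R"
  proof (rule maximal_order_loc[OF R _ _ _ K(1)])
    show "addsub S" unfolding addsub_def
    proof (intro conjI ballI)
      show "0 \<in> S" using SI[OF addsubD(1)[OF La] addsubD(1)[OF La]] by simp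
      fix w z assume "w \<in> S" "z \<in> S"
      then obtain u v u' v' where uv: "u \<in> loc R" "v \<in> loc R" "u' \<in> loc R" "v' \<in> loc R"
        and wz: "w = u + qmul a b v y" "z = u' + qmul a b v' y" by (auto simp: S_def)
      have "w - z = (u - u') + qmul a b (v - v') y" by (simp add: wz qmul_diff_left)
      then show "w - z \<in> S" using SI[OF addsubD(2)[OF La uv(1,3)] addsubD(2)[OF La uv(2,4)]] by simp
    qed
    show "R \<subseteq> S" using SI[OF loc_superset addsubD(1)[OF La]] by auto
    show "qmul a b w z \<in> S" if "w \<in> S" "z \<in> S" for w z
    proof -
      from that obtain u v u' v' where uv: "u \<in> loc R" "v \<in> loc R" "u' \<in> loc R" "v' \<in> loc R"
        and wz: "w = u + qmul a b v y" "z = u' + qmul a b v' y" by (auto simp: S_def)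
      have yy: "qmul a b y y = scl (red_trace y) y - scl ?n qone" by (rule qmul_self)
      have "qmul a b (qmul a b v y) u' = qmul a b (qmul a b v (s u')) y"
        by (simp only: qmul_assoc sy)
      moreover have "qmul a b (qmul a b v y) (qmul a b v' y) = qmul a b (qmul a b v (s v')) (qmul a b y y)"
      proof -
        have "qmul a b (qmul a b v y) (qmul a b v' y) = qmul a b (qmul a b v (qmul a b y v')) y"
          by (simp only: qmul_assoc)
        also have "\<dots> = qmul a b (qmul a b v (qmul a b (s v') y)) y" by (simp only: sy)
        finally show ?thesis by (simp only: qmul_assoc)
      qed
      moreover have "qmul a b (qmul a b v (s v')) (qmul a b y y)
         = qmul a b (scl (red_trace y) (qmul a b v (s v'))) y - scl ?n (qmul a b v (s v'))"
        unfolding yy by (simp add: qmul_diff_right)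
      ultimately have "qmul a b w z = (qmul a b u u' - scl ?n (qmul a b v (s v'))) +
        qmul a b (qmul a b u v' + qmul a b v (s u') + scl (red_trace y) (qmul a b v (s v'))) y"
        unfolding wz qmul_add_left qmul_add_right qmul_assoc[of a b u v' y] by (simp only: algebra_simps)
      then show ?thesis
        by (simp only:) (intro SI addsubD[OF La] loc_scl[OF Ra] loc_order_qmul[OF RO] s uv y ty)
    qed
    show "scl (of_int K) w \<in> loc R" if "w \<in> S" for w
    proof -
      from that obtain u v where uv: "u \<in> loc R" "v \<in> loc R" "w = u + qmul a b v y" by (auto simp: S_def)
      have "scl (of_int K) u + qmul a b v (scl (of_int K) y) \<in> loc R"
        by (intro addsubD(4)[OF La] addsub_scl_int[OF La] loc_order_qmul[OF RO] uv loc_superset K)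
      then show ?thesis by (simp add: uv(3) scl_add_right)
    qed
  qed
  moreover have "y \<in> S" using SI[OF addsubD(1)[OF La] loc_superset[OF R1]] by simp
  ultimately show ?thesis by blast
qed

end


section \<open>The order at the ramified prime\<close>

text \<open>The values of \<open>A x\<^sup>2\<close> and of \<open>- C - B y\<^sup>2\<close> for \<open>0 \<le> x, y \<le> (p - 1) / 2\<close> are \<open>p + 1\<close> residues.\<close>

lemma ternary_form_isotropic_mod:
  fixes A B C :: int
  assumes p: "Factorial_Ring.prime p" "p > 2" and A: "\<not> int p dvd A" and B: "\<not> int p dvd B"
  shows "\<exists>x y. int p dvd A * x\<^sup>2 + B * y\<^sup>2 + C"
proof -
  have odd: "odd p" using p prime_odd_nat by blast
  define h where "h = (p - 1) div 2"
  have h: "p = 2 * h + 1" using odd p(2) by (auto simp: h_def elim: oddE)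
  have pint: "Factorial_Ring.prime (int p)" using p(1) by simp
  have inj: "x = y" if D: "\<not> int p dvd D" and xy: "x \<le> h" "y \<le> h" and
    m: "(D * (int x)\<^sup>2 + E) mod int p = (D * (int y)\<^sup>2 + E) mod int p" for D E :: int and x y :: nat
  proof -
    have "int p dvd (D * (int x)\<^sup>2 + E) - (D * (int y)\<^sup>2 + E)" using m by (simp add: mod_eq_dvd_iff)
    also have "(D * (int x)\<^sup>2 + E) - (D * (int y)\<^sup>2 + E) = D * ((int x - int y) * (int x + int y))"
      by (simp add: power2_eq_square algebra_simps)
    finally have "int p dvd int x - int y \<or> int p dvd int x + int y"
      using D pint by (simp add: prime_dvd_mult_iff)
    then show ?thesis
    proof
      assume "int p dvd int x - int y"
      then show ?thesis using zdvd_imp_le[of "int p" "\<bar>int x - int y\<bar>"] xy h by (cases "x = y") auto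
    next
      assume "int p dvd int x + int y"
      then show ?thesis using zdvd_imp_le[of "int p" "int x + int y"] xy h by (cases "x + y = 0") auto
    qed
  qed
  define f where "f = (\<lambda>x::nat. (A * (int x)\<^sup>2 + 0) mod int p)"
  define g where "g = (\<lambda>y::nat. ((- B) * (int y)\<^sup>2 + (- C)) mod int p)"
  have fi: "inj_on f {..h}" 
    by (rule inj_onI, rule inj[OF A, of _ _ 0]) (auto simp: f_def)
  have gi: "inj_on g {..h}" 
    by (rule inj_onI, rule inj[of "- B" _ _ "- C"]) (use B in \<open>auto simp: g_def\<close>)
  have "f ` {..h} \<union> g ` {..h} \<subseteq> {0..<int p}" using p(2) by (auto simp: f_def g_def)
  then have "card (f ` {..h} \<union> g ` {..h}) \<le> p"
    using card_mono[of "{0..<int p}" "f ` {..h} \<union> g ` {..h}"] by simp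
  then have "f ` {..h} \<inter> g ` {..h} \<noteq> {}"
    using card_Un_disjoint[of "f ` {..h}" "g ` {..h}"] card_image[OF fi] card_image[OF gi] h by auto
  then obtain x y where "f x = g y" by blast
  then have "int p dvd A * (int x)\<^sup>2 - (- B * (int y)\<^sup>2 - C)" by (simp add: f_def g_def mod_eq_dvd_iff)
  then show ?thesis by (intro exI[of _ "int x"] exI[of _ "int y"]) (simp add: algebra_simps)
qed

context rational_prime
begin

lemma vge_all_zero: "(\<And>k. vge l k r) \<Longrightarrow> r = 0"
proof (rule ccontr)
  assume "\<And>k. vge l k r" "r \<noteq> 0"
  then have "int (Suc (nat (padic_val l r))) \<le> padic_val l r" using padic_val_le_iff by blast
  then show False by linarith
qed

text \<open>Squares shift the valuation by even amounts: l^(2c) makes r integral, and dividing by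
  the largest possible l^(2k) leaves valuation 0 or 1.\<close>

lemma square_class_repr:
  assumes "r \<noteq> 0"
  shows "\<exists>e. e \<noteq> 0 \<and> e\<^sup>2 * r \<in> lint l \<and> \<not> vge l 2 (e\<^sup>2 * r)"
proof -
  obtain c where "of_nat l ^ c * r \<in> lint l" using lint_bounded by blast
  then have c: "of_nat l ^ (2 * c) * r \<in> lint l" by (rule lint_bounded_mono) simp
  let ?s = "of_nat l ^ (2 * c) * r"
  have s0: "?s \<noteq> 0" using assms by simp
  have bound: "k \<le> nat (padic_val l ?s)" if "vge l (2 * k) ?s" for k
    using that unfolding padic_val_le_iff[OF s0] by simp
  define k where "k = (GREATEST k. vge l (2 * k) ?s)"
  have k: "vge l (2 * k) ?s"
    unfolding k_def by (rule GreatestI_nat[of _ 0 "nat (padic_val l ?s)"]) (use c bound in auto)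
  have nk: "\<not> vge l (2 * Suc k) ?s"
    using Greatest_le_nat[of "\<lambda>k. vge l (2 * k) ?s" "Suc k" "nat (padic_val l ?s)"] bound
    unfolding k_def by (meson Suc_n_not_le_n)
  have e: "(of_nat l ^ c / of_nat l ^ k)\<^sup>2 * r = ?s / of_nat l ^ (2 * k)"
    by (simp add: power_divide power_mult[symmetric] mult.commute)
  have "\<not> vge l 2 (?s / of_nat l ^ (2 * k))"
    using nk unfolding vge_def by (simp add: power_add[symmetric])
  then show ?thesis
    using k by (intro exI[of _ "of_nat l ^ c / of_nat l ^ k"]) (simp only: e, simp add: vge_def)
qed

end

locale ramified_order = rational_prime p for p :: nat +
  fixes a b :: rat and R :: "rat quat set"
  assumes p_odd: "p > 2"
    and a0: "a \<noteq> 0" and b0: "b \<noteq> 0"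
    and division: "is_division_ring (quat_Qp p a b)"
    and maximal: "is_maximal_order a b R"
begin

abbreviation N where "N \<equiv> red_norm a b"
abbreviation mul (infixl \<open>\<star>\<close> 70) where "x \<star> y \<equiv> qmul a b x y"
abbreviation cst :: "rat \<Rightarrow> rat quat" where "cst c \<equiv> scl c qone"

lemma R_order: "is_order a b R"
  using maximal by (simp add: is_maximal_order_def)

lemma R_add: "addsub R" and R_full: "full R" and R_bdd: "bdd R" and R_one: "qone \<in> R"
  and R_mul: "x \<in> R \<Longrightarrow> y \<in> R \<Longrightarrow> x \<star> y \<in> R"
  using R_order by (auto simp: is_order_iff)

lemma two_unit: "\<not> vge p 1 2" "1 / 2 \<in> lint p"
proof -
  have "\<not> int p dvd 2" using p_odd zdvd_imp_le[of "int p" 2] by auto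
  then show "\<not> vge p 1 2" "1 / 2 \<in> lint p"
    using vge_of_int_iff[of 1 2] lint_inverse_int[of 2] by auto
qed

lemma vge_2_mult_iff: "vge p k (2 * r) \<longleftrightarrow> vge p k r"
  using vge_mult_left[OF two_unit(2), of k "2 * r"] vge_mult_left[of 2 k r] by auto

lemma vge_unit_cancel: "u \<in> lint p \<Longrightarrow> \<not> vge p 1 u \<Longrightarrow> vge p k (u * r) \<Longrightarrow> vge p k r"
  using vge_mult_left[OF lint_unit_inverse, of u k "u * r"] by (cases "u = 0") auto

lemma qN_const: "qN (\<lambda>n. x) \<Longrightarrow> x = 0"
  unfolding qN_def padic_null_iff by (intro quat_eqI) (auto intro!: vge_all_zero)

lemma anisotropic: "N x = 0 \<Longrightarrow> x = 0"
proof -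
  assume "N x = 0"
  then have "qN (\<lambda>n. x) \<or> qN (\<lambda>n. qcnj x)"
    by (intro division_no_zero_divisors[OF division]) (auto simp: qmul_qcnj_right qN_def)
  then have "x = 0 \<or> qcnj x = 0" using qN_const by blast
  then show "x = 0"
  proof
    assume "qcnj x = 0"
    then have "qcnj (qcnj x) = qcnj 0" by simp
    then show ?thesis by (simp add: qcnj_def zero_quat_def)
  qed
qed

text \<open>
  Otherwise Hensel's lemma gives a root \<open>\<rho>\<close> of the reduced characteristic polynomial of \<open>x\<close> in the
  \<open>p\<close>-adic numbers, and \<open>(x - \<rho>) (x' - \<rho>) = 0\<close> for the conjugate \<open>x'\<close> of \<open>x\<close>. Below, the root is \<open>t u\<close>
  for the limit \<open>u\<close> of the iteration \<open>u \<mapsto> 1 - c / u\<close>.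
\<close>

lemma trace_integral:
  assumes Nx: "N x \<in> lint p"
  shows "red_trace x \<in> lint p"
proof (rule ccontr)
  assume T: "red_trace x \<notin> lint p"
  define t where "t = red_trace x"
  \<comment> \<open>Scaling by t turns the characteristic polynomial into U^2 - U + c. As t has a
    pole, c vanishes modulo p and 1 is a simple root there; a fixed point of \<open>u\<close> below
    is a root.\<close>
  define c where "c = N x / t\<^sup>2"
  have t0: "t \<noteq> 0" using T by (auto simp: t_def)
  have "vge p 1 (1 / t)" using vge_inverse T by (simp add: t_def)
  then have "vge p (1 + 1) ((1 / t) * (1 / t))" by (intro vge_mult)
  from vge_mult_left[OF Nx this] have "vge p 2 (N x * ((1 / t) * (1 / t)))" unfolding one_add_one .
  then have c1: "vge p 1 c" by (intro vge_mono[of 2 c 1]) (simp_all add: c_def power2_eq_square)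
  define u where "u = rec_nat (1::rat) (\<lambda>_ u. 1 - c / u)"
  have u0: "u 0 = 1" and uS: "u (Suc n) = 1 - c / u n" for n by (simp_all add: u_def)
  have unit: "r \<in> lint p \<and> 1 / r \<in> lint p \<and> r \<noteq> 0" if "vge p 1 (r - 1)" for r
  proof -
    have r: "r \<in> lint p" using lint_add[OF vge_lint[OF that], of 1] by simp
    moreover have "\<not> vge p 1 r"
    proof
      assume "vge p 1 r"
      then have "vge p 1 (r - (r - 1))" using that by (rule vge_diff)
      then show False using vge_of_int_iff[of 1 1] by simp
    qed
    ultimately show ?thesis using lint_unit_inverse by auto
  qed
  have u1: "vge p 1 (u n - 1)" for n
  proof (induction n)
    case (Suc n)
    have "vge p 1 (c * (1 / u n))" using unit[OF Suc] c1 by (intro vge_mult_right) auto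
    then show ?case by (simp add: uS)
  qed (simp add: u0)
  note un = unit[OF u1]
  have ud: "vge p (Suc n) (u (Suc n) - u n)" for n
  proof (induction n)
    case 0 then show ?case using u1[of 1] by (simp add: u0)
  next
    case (Suc n)
    \<comment> \<open>Each iteration multiplies the previous difference by c and by units, gaining a
      factor p.\<close>
    have "u (Suc (Suc n)) - u (Suc n) = c * (u (Suc n) - u n) * ((1 / u n) * (1 / u (Suc n)))"
      using un[of n] un[of "Suc n"] unfolding uS[of "Suc n"] by (subst uS[of n]) (simp add: field_simps)
    also have "vge p (1 + Suc n) \<dots>"
      using un by (intro vge_mult_right vge_mult c1 Suc lint_mult) auto
    finally show ?case by simp
  qed
  have um: "vge p n (u m - u n)" if "n \<le> m" for m n
    using that
  proof (induction m rule: dec_induct)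
    case (step m)
    have "vge p n ((u (Suc m) - u m) + (u m - u n))"
      using step vge_mono[OF ud[of m], of n] by (intro vge_add) auto
    then show ?case by simp
  qed simp
  have uC: "padic_Cauchy p u" unfolding padic_Cauchy_iff
  proof (intro allI exI impI)
    fix k m n :: nat assume "k \<le> m" "k \<le> n"
    then have "vge p k ((u m - u k) - (u n - u k))" by (intro vge_diff um)
    then show "vge p k (u m - u n)" by simp
  qed
  have nul: "padic_null p (\<lambda>n. u (Suc n) - u n)" unfolding padic_null_iff
  proof (intro allI exI impI)
    fix k n :: nat assume "k \<le> n"
    then show "vge p k (u (Suc n) - u n)" using vge_mono[OF ud[of n]] by simp
  qed
  let ?S = "\<lambda>n. x - scl (t * u n) qone" and ?T = "\<lambda>n. qcnj x - scl (t * u n) qone"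
  have tu: "padic_Cauchy p (\<lambda>n. t * u n)" by (intro Cauchy_mult Cauchy_const uC)
  \<comment> \<open>The product is the characteristic polynomial at \<open>t * u n\<close>. Up to a
    bounded factor this is the increment of \<open>u\<close>, so it tends to 0.\<close>
  have "?S n \<star> ?T n = scl ((- t\<^sup>2 * u n) * (u (Suc n) - u n)) qone" for n
  proof -
    have "t\<^sup>2 * u n * (u (Suc n) - u n) = t\<^sup>2 * u n - N x - t\<^sup>2 * (u n)\<^sup>2"
      using un[of n] t0 by (simp add: uS c_def field_simps power2_eq_square)
    then have "(- t\<^sup>2 * u n) * (u (Suc n) - u n) = N x - t * u n * t + (t * u n)\<^sup>2"
      by (simp add: power2_eq_square algebra_simps)
    moreover have "?S n \<star> ?T n = scl (N x - t * u n * t + (t * u n)\<^sup>2) qone"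
      unfolding t_def by (rule quat_eqI; simp add: red_norm_def red_trace_def power2_eq_square algebra_simps)
    ultimately show ?thesis by simp
  qed
  moreover have "padic_null p (\<lambda>n. (- t\<^sup>2 * u n) * (u (Suc n) - u n))"
    by (intro null_mult_left nul Cauchy_mult Cauchy_const uC)
  ultimately have "qN (\<lambda>n. ?S n \<star> ?T n)" by (simp add: qN_def)
  then have "qN ?S \<or> qN ?T"
    by (rule division_no_zero_divisors[OF division, rotated 2]) (intro qC_diff qC_const qC_scl tu)+
  \<comment> \<open>A scalar is subtracted in both factors, so either being null makes the pure part
    of x, a constant, vanish. Then N(x) is the square of a rational.\<close>
  then have "qN (\<lambda>n. Quat 0 (q_i x) (q_j x) (q_k x))"
    using null_minus[of "\<lambda>n. - q_i x"] null_minus[of "\<lambda>n. - q_j x"] null_minus[of "\<lambda>n. - q_k x"]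
    by (auto simp: qN_def)
  then have "Quat 0 (q_i x) (q_j x) (q_k x) = 0" by (rule qN_const)
  then have "q_i x = 0" "q_j x = 0" "q_k x = 0" by (simp_all add: zero_quat_def)
  then have "q_1 x * q_1 x \<in> lint p" using Nx by (simp add: red_norm_def power2_eq_square)
  then have "q_1 x \<in> lint p" by (rule lint_of_square)
  then have "2 * q_1 x \<in> lint p" by (intro lint_mult) auto
  then show False using T by (simp add: red_trace_def)
qed

section \<open>The filtration by the valuation of the norm\<close>

definition V :: "nat \<Rightarrow> rat quat set" where
  "V k = {x. vge p k (N x)}"

lemma V_iff: "x \<in> V k \<longleftrightarrow> vge p k (N x)"
  by (simp add: V_def)

lemma V_mono: "x \<in> V k \<Longrightarrow> j \<le> k \<Longrightarrow> x \<in> V j"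
  unfolding V_iff by (rule vge_mono)

lemma V_mul: "x \<in> V j \<Longrightarrow> y \<in> V k \<Longrightarrow> x \<star> y \<in> V (j + k)"
  unfolding V_iff red_norm_qmul by (rule vge_mult)

lemma V_scl_p: "scl (of_nat p) x \<in> V (2 + k) \<longleftrightarrow> x \<in> V k"
  unfolding V_iff by (simp add: vge_of_nat_power_mult[of 2, simplified])

lemma V_scl: "c \<in> lint p \<Longrightarrow> x \<in> V k \<Longrightarrow> scl c x \<in> V k"
  unfolding V_iff by (auto intro: vge_mult_left)

lemma V_scl_1: "vge p 1 c \<Longrightarrow> x \<in> V k \<Longrightarrow> scl c x \<in> V (2 + k)"
  unfolding V_iff using vge_mult[OF vge_mult[of 1 c 1 c], of k "N x"] by (simp add: power2_eq_square numeral_2_eq_2)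

lemma V_qcnj: "qcnj x \<in> V k \<longleftrightarrow> x \<in> V k"
  by (simp add: V_iff)

lemma trace_half: "z \<in> V (2 * k) \<Longrightarrow> vge p k (red_trace z)"
proof -
  assume "z \<in> V (2 * k)"
  then have "N (scl (1 / of_nat p ^ k) z) \<in> lint p"
    by (simp add: V_iff vge_def power_divide power_mult mult.commute)
  from trace_integral[OF this] show ?thesis by (simp add: vge_def)
qed

text \<open>The mixed term of the norm is the trace of x times the conjugate of y, an element of
  \<open>V (2 * k)\<close>; \<open>trace_half\<close> bounds its trace.\<close>

lemma V_add: "x \<in> V k \<Longrightarrow> y \<in> V k \<Longrightarrow> x + y \<in> V k"
proof -
  assume x: "x \<in> V k" and y: "y \<in> V k"
  have "x \<star> qcnj y \<in> V (2 * k)" using V_mul[OF x, of "qcnj y" k] y by (simp add: V_qcnj mult_2)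
  then show ?thesis using trace_half x y unfolding V_iff red_norm_add by (intro vge_add)
qed

lemma V_minus: "- x \<in> V k \<longleftrightarrow> x \<in> V k"
  by (simp add: V_iff)

lemma addsub_V: "addsub (V k)"
  unfolding addsub_def using V_add V_minus by (auto simp: V_iff) (metis V_add V_iff V_minus diff_conv_add_uminus)

text \<open>\<open>trace_half\<close> loses information at odd valuation and would only give an
  integral trace. Squaring x makes the valuation even, and Tr(x^2) = Tr(x)^2 - 2 N(x) carries the
  divisibility back.\<close>

lemma trace_V1: "x \<in> V 1 \<Longrightarrow> vge p 1 (red_trace x)"
proof -
  assume x: "x \<in> V 1"
  have "vge p 1 (red_trace (x \<star> x))" using V_mul[OF x x] by (intro trace_half) (simp add: numeral_2_eq_2)
  moreover have "red_trace (x \<star> x) = red_trace x * red_trace x - 2 * N x" by (simp add: qmul_self)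
  moreover have "vge p 1 (2 * N x)" using x by (simp add: V_iff vge_2_mult_iff)
  ultimately have "vge p 1 (red_trace x * red_trace x)" using vge_add by fastforce
  moreover have "red_trace x \<in> lint p" using x by (intro trace_integral) (auto simp: V_iff dest: vge_lint)
  ultimately show ?thesis using lint_prime_cases by blast
qed

lemma cst_V1: "cst c \<in> V 1 \<Longrightarrow> vge p 1 c"
  using trace_V1[of "cst c"] by (simp add: vge_2_mult_iff mult.commute[of c])

lemma cst_V2: "vge p 1 c \<Longrightarrow> cst c \<in> V 2"
  using V_scl_1[of c qone 0] by (simp add: V_iff)

text \<open>\<open>V 0\<close> is a ring containing R, so maximality suffices once its denominators
  at p are bounded. The coordinates of x are multiples of traces of x against 1, i, j, k, and traces
  on \<open>V 0\<close> are integral.\<close>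

lemma loc_R: "loc R = V 0"
proof
  show "loc R \<subseteq> V 0" using loc_norm[OF R_order] by (auto simp: V_iff)
  obtain k where k: "\<And>x. qsmall k x \<Longrightarrow> x \<in> loc R" using full_loc[OF R_add R_full] by blast
  have coef: "\<exists>c. \<forall>x \<in> V 0. of_nat p ^ c * red_trace (x \<star> e) \<in> lint p" for e
  proof -
    obtain D :: int where D: "D > 0" "scl (of_int D) e \<in> R" using fullD[OF R_full] by blast
    obtain c where c: "of_nat p ^ c * (1 / of_int D) \<in> lint p" using lint_bounded by blast
    have "of_nat p ^ c * red_trace (x \<star> e) \<in> lint p" if x: "x \<in> V 0" for x
    proof -
      have "scl (of_int D) e \<in> V 0" using loc_norm[OF R_order loc_superset[OF D(2)]] by (simp add: V_iff)
      then have "x \<star> scl (of_int D) e \<in> V 0" using V_mul[OF x, of "scl (of_int D) e" 0] by simp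
      then have "of_int D * red_trace (x \<star> e) \<in> lint p" using trace_half[of _ 0] by fastforce
      from lint_mult[OF c this] show ?thesis using D(1) by simp
    qed
    then show ?thesis by blast
  qed
  have "\<exists>c. \<forall>x \<in> V 0. of_nat p ^ c * (r * red_trace (x \<star> e)) \<in> lint p" for e r
    using coef[of "scl r e"] by simp
  \<comment> \<open>The dual basis for the trace form: i, j, k have squares a, b, -ab.\<close>
  from this[of "1/2" "Quat 1 0 0 0"] this[of "1/(2*a)" "Quat 0 1 0 0"] this[of "1/(2*b)" "Quat 0 0 1 0"]
    this[of "- 1/(2*a*b)" "Quat 0 0 0 1"]
  obtain c1 c2 c3 c4 where c: "\<forall>x \<in> V 0. of_nat p ^ c1 * q_1 x \<in> lint p" "\<forall>x \<in> V 0. of_nat p ^ c2 * q_i x \<in> lint p"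
    "\<forall>x \<in> V 0. of_nat p ^ c3 * q_j x \<in> lint p" "\<forall>x \<in> V 0. of_nat p ^ c4 * q_k x \<in> lint p"
    using a0 b0 by (auto simp: red_trace_def)
  define c where "c = max (max c1 c2) (max c3 c4)"
  have small: "scl (of_nat p ^ (c + k)) x \<in> loc R" if x: "x \<in> V 0" for x
  proof (rule k)
    have "of_nat p ^ c * q_1 x \<in> lint p" "of_nat p ^ c * q_i x \<in> lint p"
      "of_nat p ^ c * q_j x \<in> lint p" "of_nat p ^ c * q_k x \<in> lint p"
      using c x unfolding c_def by (auto intro: lint_bounded_mono)
    then show "qsmall k (scl (of_nat p ^ (c + k)) x)"
      by (simp add: qsmall_def vge_def power_add)
  qed
  show "V 0 \<subseteq> loc R"
  proof (rule maximal_order_loc[OF maximal addsub_V])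
    show "x \<star> y \<in> V 0" if "x \<in> V 0" "y \<in> V 0" for x y using V_mul[OF that] by simp
    show "R \<subseteq> V 0" using loc_norm[OF R_order loc_superset] by (auto simp: V_iff)
    show "int p ^ (c + k) > 0" by simp
    show "scl (of_int (int p ^ (c + k))) x \<in> loc R" if "x \<in> V 0" for x using small[OF that] by simp
  qed
qed

lemma R_V0: "x \<in> R \<Longrightarrow> x \<in> V 0"
  using loc_superset[of x R] by (simp add: loc_R)

lemma div_p_mem_R:
  assumes "x \<in> R" "x \<in> V (2 + k)"
  shows "\<exists>z\<in>R. z \<in> V k \<and> x = scl (of_nat p) z"
proof (intro bexI conjI)
  let ?z = "scl (1 / of_nat p) x"
  show x: "x = scl (of_nat p) ?z" by simp
  show z: "?z \<in> V k" using assms(2) by (subst (asm) x) (simp only: V_scl_p)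
  show "?z \<in> R"
  proof (rule loc_pow_mem[OF R_add])
    show "?z \<in> loc R" unfolding loc_R by (rule V_mono[OF z]) simp
    show "scl (of_nat p ^ 1) ?z \<in> R" using assms by simp
  qed
qed

section \<open>The residue plane of \<open>V 0\<close> modulo \<open>V 1\<close>\<close>

abbreviation unit :: "rat \<Rightarrow> bool" where "unit r \<equiv> r \<in> lint p \<and> \<not> vge p 1 r"

lemma unit_repr: "unit r \<Longrightarrow> \<exists>n. \<not> int p dvd n \<and> vge p 1 (r - of_int n)"
proof -
  assume r: "unit r"
  then obtain n where n: "vge p 1 (r - of_int n)" using lint_int_repr by blast
  have "\<not> int p dvd n"
  proof
    assume "int p dvd n"
    then have "vge p 1 (of_int n)" by (simp add: vge_of_int_iff)
    then show False using vge_add[OF n, of "of_int n"] r by simp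
  qed
  then show ?thesis using n by blast
qed

text \<open>Modulo p the form in x, y, z has a zero whose last coordinate is 1. The resulting w lies
  in \<open>V 1\<close>, so pairing it with z gives a trace divisible by p; but by orthogonality
  this trace is 2 N(z), a unit.\<close>

lemma no_three_orthogonal_units:
  assumes N: "unit (N x)" "unit (N y)" "unit (N z)"
    and T: "red_trace (x \<star> qcnj y) = 0" "red_trace (x \<star> qcnj z) = 0" "red_trace (y \<star> qcnj z) = 0"
  shows False
proof -
  obtain A B C where A: "\<not> int p dvd A" "vge p 1 (N x - of_int A)" and B: "\<not> int p dvd B" "vge p 1 (N y - of_int B)"
    and C: "vge p 1 (N z - of_int C)" using N unit_repr by metis
  obtain c d where cd: "int p dvd A * c\<^sup>2 + B * d\<^sup>2 + C"
    using ternary_form_isotropic_mod[OF prime p_odd A(1) B(1)] by blast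
  let ?w = "scl (of_int c) x + scl (of_int d) y + z"
  have "N ?w = of_int c ^ 2 * N x + of_int d ^ 2 * N y + N z"
    using T by (simp add: red_norm_add qmul_add_left)
  also have "\<dots> = of_int (c^2) * (N x - of_int A) + of_int (d^2) * (N y - of_int B) + (N z - of_int C)
      + of_int (A * c\<^sup>2 + B * d\<^sup>2 + C)" by (simp add: algebra_simps)
  also have "vge p 1 \<dots>"
    using A B C cd by (intro vge_add vge_mult_left) (simp_all only: vge_of_int_iff lint_of_int power_one_right)
  finally have "?w \<star> qcnj z \<in> V (1 + 0)" using N by (intro V_mul) (auto simp: V_iff)
  then have "vge p 1 (red_trace (?w \<star> qcnj z))" by (intro trace_V1) simp
  also have "red_trace (?w \<star> qcnj z) = 2 * N z"
    using T by (simp add: qmul_add_left qmul_qcnj_right)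
  finally show False using N by (simp add: vge_2_mult_iff)
qed

text \<open>
  Rescale \<open>i, j, k\<close> to norms of valuation 0 or 1. Three of valuation 0 are excluded by the previous lemma,
  three of valuation 1 because \<open>N(i) N(j) N(k)\<close> is a square.
\<close>

lemma exists_unit_uniformizer:
  "\<exists>u \<pi>. u \<in> R \<and> red_trace u = 0 \<and> unit (N u) \<and> \<pi> \<in> R \<and> \<pi> \<in> V 1 \<and> \<pi> \<notin> V 2"
proof -
  have N0: "N (Quat 0 1 0 0) = - a" "N (Quat 0 0 1 0) = - b" "N (Quat 0 0 0 1) = a * b"
    by (simp_all add: red_norm_def)
  obtain e f g where e: "e \<noteq> 0" "e\<^sup>2 * - a \<in> lint p" "\<not> vge p 2 (e\<^sup>2 * - a)"
    and f: "f \<noteq> 0" "f\<^sup>2 * - b \<in> lint p" "\<not> vge p 2 (f\<^sup>2 * - b)"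
    and g: "g \<noteq> 0" "g\<^sup>2 * (a * b) \<in> lint p" "\<not> vge p 2 (g\<^sup>2 * (a * b))"
    using square_class_repr[of "- a"] square_class_repr[of "- b"] square_class_repr[of "a * b"] a0 b0 by auto
  define x y z where xyz: "x = scl e (Quat 0 1 0 0)" "y = scl f (Quat 0 0 1 0)" "z = scl g (Quat 0 0 0 1)"
  have Nx: "N x = e\<^sup>2 * - a" "N y = f\<^sup>2 * - b" "N z = g\<^sup>2 * (a * b)" by (simp_all add: xyz N0)
  have tr: "red_trace x = 0" "red_trace y = 0" "red_trace z = 0"
    "red_trace (x \<star> qcnj y) = 0" "red_trace (x \<star> qcnj z) = 0" "red_trace (y \<star> qcnj z) = 0"
    by (simp_all add: xyz red_trace_def)
  have ex_unit: "\<exists>w\<in>{x,y,z}. unit (N w)"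
  proof (rule ccontr)
    assume "\<not> ?thesis"
    then have v: "vge p 1 (N x)" "vge p 1 (N y)" "vge p 1 (N z)" using e f g by (auto simp: Nx)
    \<comment> \<open>With all three valuations equal to 1, \<open>N x * N y = s * s * N z\<close>
      would equate the even number 2 with an odd one.\<close>
    define s where "s = e * f / g"
    have s: "N x * N y = s * s * N z" using g(1) by (simp add: Nx s_def power2_eq_square field_simps)
    have st: "unit (r / of_nat p)" if "vge p 1 r" "\<not> vge p 2 r" for r
      using that by (auto simp: vge_def power2_eq_square)
    have ux: "unit (N x / of_nat p)" and uy: "unit (N y / of_nat p)" and uz: "unit (N z / of_nat p)"
      using st v e f g by (auto simp: Nx)
    have eq: "of_nat p * ((N x / of_nat p) * (N y / of_nat p)) = (N z / of_nat p) * (s * s)"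
      using s by (simp add: field_simps)
    have "(N x / of_nat p) * (N y / of_nat p) \<in> lint p" using ux uy by blast
    from vge_mult_right[OF vge_of_nat this]
    have "vge p 1 (of_nat p * ((N x / of_nat p) * (N y / of_nat p)))" unfolding One_nat_def .
    then have s1: "vge p 1 (s * s)" unfolding eq using uz vge_unit_cancel by blast
    then have "s \<in> lint p" using lint_of_square vge_lint by blast
    then have "vge p 1 s" using s1 lint_prime_cases by blast
    then have "vge p (1 + 1) (s * s)" by (intro vge_mult)
    then have "vge p (1 + 1) (of_nat p * ((N x / of_nat p) * (N y / of_nat p)))"
      unfolding eq by (rule vge_mult_left[rotated]) (use uz in auto)
    then have "vge p 1 ((N x / of_nat p) * (N y / of_nat p))"
      by (simp only: vge_of_nat_power_mult[of 1 1, unfolded power_one_right])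
    then show False using ux uy lint_prime_cases by blast
  qed
  have ex_unif: "\<exists>w\<in>{x,y,z}. w \<in> V 1"
  proof (rule ccontr)
    assume "\<not> ?thesis"
    then have "unit (N x)" "unit (N y)" "unit (N z)" using e f g by (auto simp: Nx V_iff)
    then show False using no_three_orthogonal_units tr by blast
  qed
  \<comment> \<open>A multiplier prime to p moves an element from \<open>loc R\<close> into R
    without changing the valuation of its norm.\<close>
  have scale: "\<exists>m. \<not> int p dvd m \<and> scl (of_int m) w \<in> R" if "w \<in> V 0" for w
    using that unfolding loc_R[symmetric] loc_def by blast
  have um: "unit (of_int (m * m))" if "\<not> int p dvd m" for m
    using not_dvd_mult[OF that that] vge_of_int_iff[of 1 "m * m"] lint_of_int(1) by (simp del: of_int_mult)
  obtain u where u: "u \<in> {x,y,z}" "unit (N u)" using ex_unit by blast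
  then obtain m where m: "\<not> int p dvd m" "scl (of_int m) u \<in> R" using scale[of u] by (auto simp: V_iff)
  have "unit (of_int (m * m) * N u)" using um[OF m(1)] u(2) lint_prime_cases by blast
  then have "unit (N (scl (of_int m) u))" by (simp add: power2_eq_square)
  moreover have "red_trace (scl (of_int m) u) = 0" using u(1) tr by auto
  moreover obtain \<pi> where \<pi>: "\<pi> \<in> {x,y,z}" "\<pi> \<in> V 1" using ex_unif by blast
  have \<pi>2: "\<pi> \<notin> V 2" using \<pi>(1) e f g by (auto simp: V_iff Nx)
  obtain n where n: "\<not> int p dvd n" "scl (of_int n) \<pi> \<in> R" using scale[OF V_mono[OF \<pi>(2)]] by auto
  have "scl (of_int n) \<pi> \<in> V 1" by (rule V_scl[OF _ \<pi>(2)]) simp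
  moreover have "scl (of_int n) \<pi> \<notin> V 2"
    using \<pi>2 vge_unit_cancel[OF _ _, of "of_int (n * n)" 2 "N \<pi>"] um[OF n(1)]
    by (auto simp: V_iff power2_eq_square)
  ultimately show ?thesis using m(2) n(2) by blast
qed

text \<open>Project x orthogonally away from 1 and u; the coefficients are integral because 2 and
  N(u) are units. The remainder y must lie in \<open>V 1\<close>, for otherwise 1, u, y would be
  three orthogonal elements of unit norm. Rounding the coefficients to integers changes x only
  within \<open>V 2\<close>.\<close>

lemma residue_decomposition:
  assumes u: "u \<in> R" "red_trace u = 0" "unit (N u)" and x: "x \<in> V 0"
  shows "\<exists>c d::int. x - cst (of_int c) - scl (of_int d) u \<in> V 1"
proof -
  define c where "c = red_trace x / 2"
  define d where "d = red_trace (x \<star> qcnj u) / (2 * N u)"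
  define y where "y = x - cst c - scl d u"
  have N0: "N u \<noteq> 0" using u(3) by auto
  have u0: "u \<in> V 0" using u(3) by (simp add: V_iff)
  have cl: "c \<in> lint p" using lint_mult[OF two_unit(2) trace_integral, of x] x by (simp add: c_def V_iff)
  have "red_trace (x \<star> qcnj u) \<in> lint p"
    using V_mul[OF x, of "qcnj u" 0] u0 by (intro trace_integral) (simp add: V_iff)
  then have "(1 / 2) * (1 / N u) * red_trace (x \<star> qcnj u) \<in> lint p"
    using u(3) by (intro lint_mult two_unit lint_unit_inverse) auto
  then have dl: "d \<in> lint p" by (simp add: d_def)
  have one: "qone \<in> V 0" by (simp add: V_iff)
  have y0: "y \<in> V 0" unfolding y_def by (intro addsubD(2)[OF addsub_V] V_scl cl dl x u0 one)
  have ty: "red_trace y = 0" using u(2) by (simp add: y_def c_def)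
  have tyu: "red_trace (u \<star> qcnj y) = 0"
  proof -
    have "red_trace (u \<star> qcnj y) = red_trace (qcnj (u \<star> qcnj y))" by simp
    also have "qcnj (u \<star> qcnj y) = y \<star> qcnj u" by (simp add: qcnj_qmul)
    also have "red_trace (y \<star> qcnj u) = 0"
      using u(2) N0 by (simp add: y_def qmul_diff_left qmul_qcnj_right d_def)
    finally show ?thesis .
  qed
  have y1: "y \<in> V 1"
  proof (rule ccontr)
    assume "y \<notin> V 1"
    then have "unit (N y)" using y0 by (simp add: V_iff)
    moreover have "unit (N qone)" using vge_of_int_iff[of 1 1] by simp
    ultimately show False using no_three_orthogonal_units[of qone u y] u(2,3) ty tyu by simp
  qed
  obtain c' d' where c': "vge p 1 (c - of_int c')" and d': "vge p 1 (d - of_int d')"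
    using lint_int_repr cl dl by blast
  have "y + (cst (c - of_int c') + scl (d - of_int d') u) \<in> V 1"
    using V_scl_1[OF c' one] V_scl_1[OF d' u0] y1 by (intro V_add) (auto intro: V_mono)
  also have "y + (cst (c - of_int c') + scl (d - of_int d') u) = x - cst (of_int c') - scl (of_int d') u"
    by (simp add: y_def scl_diff_left)
  finally show ?thesis by blast
qed

text \<open>The trace does not see u, so p divides c; what is left has norm d^2 N(u).\<close>

lemma residue_independent:
  assumes u: "red_trace u = 0" "unit (N u)" and "c \<in> lint p" "d \<in> lint p" "cst c + scl d u \<in> V 1"
  shows "vge p 1 d"
proof -
  have "vge p 1 (red_trace (cst c + scl d u))" by (rule trace_V1[OF assms(5)])
  then have "vge p 1 c" using u(1) by (simp add: vge_2_mult_iff mult.commute[of c])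
  then have "cst c \<in> V 1" by (intro V_mono[OF cst_V2]) auto
  from addsubD(2)[OF addsub_V assms(5) this] have "vge p 1 (d * d * N u)" by (simp add: V_iff power2_eq_square)
  then have "vge p 1 (d * d)" using lint_prime_cases[of "d * d" "N u"] u(2) assms(4) by auto
  then show ?thesis using lint_prime_cases assms(4) by blast
qed

text \<open>The localisation at \<open>p\<close> of the order \<open>O_tilde p a b R\<close>.\<close>

definition OT :: "rat quat set" where
  "OT = {x. \<exists>c::int. x - cst (of_int c) \<in> V 1}"

abbreviation Ot :: "rat quat set" where "Ot \<equiv> O_tilde p a b R"

lemma OT_I: "c \<in> lint p \<Longrightarrow> x - cst c \<in> V 1 \<Longrightarrow> x \<in> OT"
proof -
  assume c: "c \<in> lint p" and x: "x - cst c \<in> V 1"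
  obtain c' where c': "vge p 1 (c - of_int c')" using lint_int_repr c by blast
  then have "cst (c - of_int c') \<in> V 1" by (intro V_mono[OF cst_V2]) auto
  from V_add[OF x this] show ?thesis unfolding OT_def by (auto simp: scl_diff_left)
qed

lemma OT_V0: "x \<in> OT \<Longrightarrow> x \<in> V 0"
proof -
  assume "x \<in> OT"
  then obtain c where "x - cst (of_int c) \<in> V 1" by (auto simp: OT_def)
  then have "x - cst (of_int c) \<in> V 0" by (rule V_mono) simp
  then have "(x - cst (of_int c)) + cst (of_int c) \<in> V 0" by (rule V_add) (simp add: V_iff lint_power)
  then show ?thesis by simp
qed

lemma int_dvd_iff: "r \<in> \<int> \<Longrightarrow> int_dvd (of_nat p) r \<longleftrightarrow> vge p 1 r"
proof -
  assume "r \<in> \<int>"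
  then obtain n where r: "r = of_int n" by (auto elim: Ints_cases)
  have "int_dvd (of_nat p) r \<longleftrightarrow> (\<exists>k. (of_int n :: rat) = of_int (k * int p))" by (simp add: int_dvd_def r)
  also have "\<dots> \<longleftrightarrow> int p dvd n" unfolding of_int_eq_iff dvd_def by (simp add: mult.commute)
  finally show ?thesis by (simp add: r vge_of_int_iff)
qed

lemma disc_V1_iff: "vge p 1 (red_disc a b x) \<longleftrightarrow> x - cst (red_trace x / 2) \<in> V 1"
proof -
  have "red_disc a b x = - (4 * N (x - cst (red_trace x / 2)))"
    by (simp add: red_disc_def red_norm_diff power2_eq_square algebra_simps)
  moreover have "vge p 1 (4 * r) \<longleftrightarrow> vge p 1 r" for r
    using vge_2_mult_iff[of 1 "2 * r"] vge_2_mult_iff[of 1 r] by simp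
  ultimately show ?thesis by (simp add: V_iff)
qed

text \<open>The discriminant of x is -4 times the norm of its trace-free part. Thus the quadratic
  condition on x becomes congruence to a scalar modulo \<open>V 1\<close>, which is visibly stable
  under sums and products.\<close>

lemma Ot_iff: "x \<in> Ot \<longleftrightarrow> x \<in> R \<and> x \<in> OT"
proof (cases "x \<in> R")
  case True
  have T: "red_trace x \<in> \<int>" and Nx: "N x \<in> \<int>"
    using order_trace_Ints order_norm_Ints R_order True by blast+
  then have "red_disc a b x \<in> \<int>" unfolding red_disc_def by auto
  then have "x \<in> Ot \<longleftrightarrow> x - cst (red_trace x / 2) \<in> V 1"
    using True int_dvd_iff disc_V1_iff by (auto simp only: O_tilde_def mem_Collect_eq)
  also have "\<dots> \<longleftrightarrow> x \<in> OT"
  proof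
    have "red_trace x / 2 \<in> lint p" using lint_mult[OF two_unit(2) lint_Ints[OF T]] by simp
    then show "x - cst (red_trace x / 2) \<in> V 1 \<Longrightarrow> x \<in> OT" by (rule OT_I)
    assume "x \<in> OT"
    then obtain c where c: "x - cst (of_int c) \<in> V 1" by (auto simp: OT_def)
    have "vge p 1 ((1/2) * red_trace (x - cst (of_int c)))" by (intro vge_mult_left two_unit trace_V1 c)
    then have "cst (red_trace x / 2 - of_int c) \<in> V 1" by (intro V_mono[OF cst_V2]) (auto simp: diff_divide_distrib)
    from addsubD(2)[OF addsub_V c this] show "x - cst (red_trace x / 2) \<in> V 1" by (simp add: scl_diff_left)
  qed
  finally show ?thesis using True by simp
qed (simp add: O_tilde_def)

lemma addsub_OT: "addsub OT"
  unfolding addsub_def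
proof (intro conjI ballI)
  show "0 \<in> OT" by (rule OT_I[of 0]) (auto simp: V_iff)
  fix x y assume "x \<in> OT" "y \<in> OT"
  then obtain c d where "x - cst (of_int c) \<in> V 1" "y - cst (of_int d) \<in> V 1" by (auto simp: OT_def)
  then have "(x - cst (of_int c)) - (y - cst (of_int d)) \<in> V 1" by (rule addsubD(2)[OF addsub_V])
  then show "x - y \<in> OT" by (intro OT_I[of "of_int (c - d)"]) (auto simp: scl_diff_left algebra_simps)
qed

lemma OT_mul: "x \<in> OT \<Longrightarrow> y \<in> OT \<Longrightarrow> x \<star> y \<in> OT"
proof -
  assume x: "x \<in> OT" and y: "y \<in> OT"
  then obtain c d where c: "x - cst (of_int c) \<in> V 1" and d: "y - cst (of_int d) \<in> V 1" by (auto simp: OT_def)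
  have "(x - cst (of_int c)) \<star> y \<in> V 1" using V_mul[OF c OT_V0[OF y]] by simp
  moreover have "scl (of_int c) (y - cst (of_int d)) \<in> V 1" by (intro V_scl d) simp
  ultimately have "(x - cst (of_int c)) \<star> y + scl (of_int c) (y - cst (of_int d)) \<in> V 1" by (rule V_add)
  then show ?thesis
    by (intro OT_I[of "of_int (c * d)"]) (auto simp: qmul_diff_left scl_diff_right)
qed

lemma Ot_add: "addsub Ot"
  using R_add addsub_OT by (auto simp: addsub_def Ot_iff)

lemma V1_OT: "x \<in> V 1 \<Longrightarrow> x \<in> OT"
  by (rule OT_I[of 0]) auto

lemma V1_Ot: "x \<in> R \<Longrightarrow> x \<in> V 1 \<Longrightarrow> x \<in> Ot"
  by (simp add: Ot_iff V1_OT)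

lemma p_R_V2: "x \<in> R \<Longrightarrow> scl (of_nat p) x \<in> R" "x \<in> R \<Longrightarrow> scl (of_nat p) x \<in> V 2"
  using addsub_scl_int[OF R_add, of x "int p"] V_scl_p[of x 0] R_V0 by auto

lemma full_of_p: "addsub L \<Longrightarrow> (\<And>x. x \<in> R \<Longrightarrow> scl (of_nat p) x \<in> L) \<Longrightarrow> full L"
proof (rule fullI)
  fix x assume L: "\<And>x. x \<in> R \<Longrightarrow> scl (of_nat p) x \<in> L"
  obtain D :: int where "D > 0" "scl (of_int D) x \<in> R" using fullD[OF R_full] by blast
  then show "\<exists>D::int. D > 0 \<and> scl (of_int D) x \<in> L"
    using L[of "scl (of_int D) x"] by (intro exI[of _ "int p * D"]) auto
qed

lemma Ot_order: "is_order a b Ot"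
  unfolding is_order_iff
proof (intro conjI ballI Ot_add)
  show "full Ot" by (rule full_of_p[OF Ot_add]) (auto intro!: V1_Ot p_R_V2 intro: V_mono[OF p_R_V2(2)])
  show "bdd Ot" by (rule bdd_mono[OF R_bdd]) (auto simp: Ot_iff)
  show "qone \<in> Ot" using R_one by (auto simp: Ot_iff V_iff intro!: OT_I[of 1])
qed (auto simp: Ot_iff R_mul OT_mul)

lemma loc_Ot: "loc Ot = OT"
proof
  show "loc Ot \<subseteq> OT"
  proof
    fix x assume "x \<in> loc Ot"
    then obtain m where m: "\<not> int p dvd m" "scl (of_int m) x \<in> Ot" by (rule locE)
    have m0: "m \<noteq> 0" using m by auto
    obtain c where c: "scl (of_int m) x - cst (of_int c) \<in> V 1" using m(2) by (auto simp: Ot_iff OT_def)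
    have "scl (1 / of_int m) (scl (of_int m) x - cst (of_int c)) \<in> V 1"
      by (intro V_scl c lint_inverse_int m)
    then show "x \<in> OT" using m0 m(1)
      by (intro OT_I[of "of_int c / of_int m"] lint_div_int) (auto simp: scl_diff_right)
  qed
  show "OT \<subseteq> loc Ot"
  proof
    fix x assume x: "x \<in> OT"
    then have "x \<in> loc R" using OT_V0 by (simp add: loc_R)
    then obtain m where m: "\<not> int p dvd m" "scl (of_int m) x \<in> R" by (rule locE)
    have "scl (of_int m) x \<in> OT" by (rule addsub_scl_int[OF addsub_OT x])
    then show "x \<in> loc Ot" using m by (intro locI[of m]) (simp_all add: Ot_iff)
  qed
qed

text \<open>The small order contains p R, and p is invertible at l.\<close>

lemma loc_Ot_other:
  assumes l: "Factorial_Ring.prime l" "l \<noteq> p"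
  shows "rational_prime.loc l Ot = rational_prime.loc l R"
proof -
  interpret L: rational_prime l by unfold_locales (rule l)
  have pl: "\<not> int l dvd int p" using l prime primes_dvd_imp_eq by auto
  show ?thesis
  proof
    show "L.loc Ot \<subseteq> L.loc R" by (rule L.loc_mono) (auto simp: Ot_iff)
    show "L.loc R \<subseteq> L.loc Ot"
    proof
      fix x assume "x \<in> L.loc R"
      then obtain m where m: "\<not> int l dvd m" "scl (of_int m) x \<in> R" by (rule L.locE)
      have "scl (of_nat p) (scl (of_int m) x) \<in> Ot"
        using p_R_V2[OF m(2)] by (intro V1_Ot) (auto intro: V_mono)
      then show "x \<in> L.loc Ot" by (intro L.locI[OF L.not_dvd_mult[OF pl m(1)]]) simp
    qed
  qed
qed

end


section \<open>Index and the two implications\<close>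

lemma lattice_index_eq: "lattice_index a b L M = card ((\<lambda>x. (\<lambda>h. h + x) ` M) ` L)"
  unfolding lattice_index_def A_RCOSETS_def' a_r_coset_def' by (simp add: UNION_singleton_eq_range)

lemma translate_eq_iff:
  assumes M: "addsub M"
  shows "(\<lambda>h. h + x) ` M = (\<lambda>h. h + y) ` M \<longleftrightarrow> x - y \<in> M"
proof
  assume eq: "(\<lambda>h. h + x) ` M = (\<lambda>h. h + y) ` M"
  have "0 + x \<in> (\<lambda>h. h + x) ` M" using addsubD(1)[OF M] by blast
  then obtain h where "h \<in> M" "x = h + y" unfolding eq by auto
  then show "x - y \<in> M" by simp
next
  have sub: "(\<lambda>h. h + x) ` M \<subseteq> (\<lambda>h. h + y) ` M" if "x - y \<in> M" for x y
  proof
    fix z assume "z \<in> (\<lambda>h. h + x) ` M"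
    then obtain h where "h \<in> M" "z = h + x" by blast
    then have "z = (h + (x - y)) + y" "h + (x - y) \<in> M" using addsubD(4)[OF M _ that] by auto
    then show "z \<in> (\<lambda>h. h + y) ` M" by blast
  qed
  assume xy: "x - y \<in> M"
  then have "y - x \<in> M" using addsubD(3)[OF M xy] by simp
  then show "(\<lambda>h. h + x) ` M = (\<lambda>h. h + y) ` M" using sub xy by blast
qed

text \<open>Lagrange in the quotient group. For infinite index the multiplier is 0, and the claim
  still holds.\<close>

lemma index_scl_mem:
  assumes L: "addsub L" and M: "addsub M" "M \<subseteq> L"
    and x: "x \<in> L"
  shows "scl (of_nat (lattice_index a b L M)) x \<in> M"
proof -
  define G :: "rat quat monoid" where "G = \<lparr>carrier = L, monoid.mult = (+), one = 0\<rparr>"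
  have G: "comm_group G"
    by (rule comm_groupI) (auto simp: G_def algebra_simps addsubD[OF L] intro!: bexI[of _ "- _"])
  interpret G: comm_group G by (rule G)
  have inv: "inv\<^bsub>G\<^esub> z = - z" if "z \<in> L" for z
    by (rule G.inv_equality) (use that in \<open>auto simp: G_def addsubD[OF L]\<close>)
  have "subgroup M G"
    by (rule G.subgroupI) (use M inv addsubD[OF M(1)] in \<open>auto simp: G_def\<close>)
  then interpret M: normal M G by (rule G.subgroup_imp_normal)
  interpret Q: group "G Mod M" by (rule M.factorgroup_is_group)
  interpret h: group_hom G "G Mod M" "\<lambda>z. M #>\<^bsub>G\<^esub> z"
    by (intro group_hom.intro group_hom_axioms.intro M.r_coset_hom_Mod) unfold_locales
  have coset: "M #>\<^bsub>G\<^esub> z = (\<lambda>h. h + z) ` M" for z by (auto simp: r_coset_def G_def)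
  have "carrier (G Mod M) = (\<lambda>x. (\<lambda>h. h + x) ` M) ` L"
    by (auto simp: FactGroup_def RCOSETS_def coset) (auto simp: G_def)
  then have ord: "Coset.order (G Mod M) = lattice_index a b L M" by (simp add: Coset.order_def lattice_index_eq)
  have pow: "x [^]\<^bsub>G\<^esub> n = scl (of_nat n) x" for n :: nat
    by (induction n) (auto simp: G_def scl_add_left algebra_simps)
  have xG: "x \<in> carrier G" using x by (simp add: G_def)
  then have "(M #>\<^bsub>G\<^esub> x) [^]\<^bsub>G Mod M\<^esub> Coset.order (G Mod M) = \<one>\<^bsub>G Mod M\<^esub>"
    by (intro Q.pow_order_eq_1) auto
  then have "M #>\<^bsub>G\<^esub> (x [^]\<^bsub>G\<^esub> Coset.order (G Mod M)) = \<one>\<^bsub>G Mod M\<^esub>"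
    using h.hom_nat_pow[OF xG] by simp
  then have "(\<lambda>h. h + scl (of_nat (lattice_index a b L M)) x) ` M = (\<lambda>h. h + 0) ` M"
    unfolding pow ord coset by (simp add: FactGroup_def)
  then show ?thesis by (simp only: translate_eq_iff[OF M(1)] diff_zero)
qed

text \<open>Since \<open>p w\<close> lies in M and w does not, Bezout separates the cosets of 0, w,
  ..., (p - 1) w; there being p of them, they are all.\<close>

lemma prime_index_generator:
  assumes L: "addsub L" and M: "addsub M" "M \<subseteq> L"
    and p: "Factorial_Ring.prime p" and idx: "lattice_index a b L M = p"
    and w: "w \<in> L" "w \<notin> M" and x: "x \<in> L"
  shows "\<exists>k::int. x - scl (of_int k) w \<in> M"
proof -
  have p0: "p > 0" using p by (simp add: prime_gt_0_nat)
  have pw: "scl (of_int (int p)) w \<in> M" using index_scl_mem[OF L M w(1), of a b] idx by simp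
  let ?c = "\<lambda>x. (\<lambda>h. h + x) ` M"
  have inj: "inj_on (\<lambda>k. ?c (scl (of_int k) w)) {0..<int p}"
  proof (rule inj_onI, rule ccontr)
    fix j k assume jk: "j \<in> {0..<int p}" "k \<in> {0..<int p}" "j \<noteq> k"
      and "?c (scl (of_int j) w) = ?c (scl (of_int k) w)"
    then have "scl (of_int (j - k)) w \<in> M" by (simp add: translate_eq_iff[OF M(1)] scl_diff_left)
    moreover have "coprime (j - k) (int p)"
    proof -
      have "\<not> int p dvd j - k" using zdvd_imp_le[of "int p" "\<bar>j - k\<bar>"] jk by auto
      then show ?thesis using p prime_imp_coprime[of "int p" "j - k"] by (simp add: coprime_commute)
    qed
    ultimately show False using coprime_scl_mem[OF M(1) _ pw] w(2) by blast
  qed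
  have fin: "finite (?c ` L)" "card (?c ` L) = p"
    using idx p0 unfolding lattice_index_eq by (auto intro: card_ge_0_finite)
  have "(\<lambda>k. ?c (scl (of_int k) w)) ` {0..<int p} = ?c ` L"
    by (rule card_subset_eq) (use fin card_image[OF inj] addsub_scl_int[OF L w(1)] in auto)
  then obtain k where "?c x = ?c (scl (of_int k) w)" using x by blast
  then show ?thesis by (auto simp: translate_eq_iff[OF M(1)])
qed

lemma index_eqI:
  assumes L: "addsub L" and M: "addsub M" and p: "p > 0"
    and v: "v \<in> L" "scl (of_nat p) v \<in> M" "\<And>k::int. scl (of_int k) v \<in> M \<Longrightarrow> int p dvd k"
    and gen: "\<And>x. x \<in> L \<Longrightarrow> \<exists>k::int. x - scl (of_int k) v \<in> M"
  shows "lattice_index a b L M = p"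
proof -
  let ?c = "\<lambda>x. (\<lambda>h. h + x) ` M"
  let ?f = "\<lambda>k::int. ?c (scl (of_int k) v)"
  have "inj_on ?f {0..<int p}"
  proof (rule inj_onI, rule ccontr)
    fix j k assume jk: "j \<in> {0..<int p}" "k \<in> {0..<int p}" "j \<noteq> k" and "?f j = ?f k"
    then have "scl (of_int (j - k)) v \<in> M" by (simp add: translate_eq_iff[OF M(1)] scl_diff_left)
    then have "int p dvd j - k" by (rule v)
    then show False using zdvd_imp_le[of "int p" "\<bar>j - k\<bar>"] jk by auto
  qed
  then have "card (?f ` {0..<int p}) = p" by (simp add: card_image)
  moreover have "?f ` {0..<int p} = ?c ` L"
  proof
    show "?f ` {0..<int p} \<subseteq> ?c ` L" using addsub_scl_int[OF L v(1)] by auto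
    show "?c ` L \<subseteq> ?f ` {0..<int p}"
    proof
      fix z assume "z \<in> ?c ` L"
      then obtain x where x: "x \<in> L" "z = ?c x" by blast
      obtain k where k: "x - scl (of_int k) v \<in> M" using gen[OF x(1)] by blast
      have "scl (of_int (k div int p)) (scl (of_nat p) v) \<in> M" by (rule addsub_scl_int[OF M v(2)])
      then have "(x - scl (of_int k) v) + scl (of_int (k div int p)) (scl (of_nat p) v) \<in> M"
        by (rule addsubD(4)[OF M k])
      also have "(x - scl (of_int k) v) + scl (of_int (k div int p)) (scl (of_nat p) v)
          = x - scl (of_int (k - (k div int p) * int p)) v"
        by (simp add: scl_diff_left)
      finally have "x - scl (of_int (k mod int p)) v \<in> M" by (simp only: minus_div_mult_eq_mod)
      then have "z = ?f (k mod int p)" by (simp only: x translate_eq_iff[OF M(1)])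
      moreover have "k mod int p \<in> {0..<int p}" using p by simp
      ultimately show "z \<in> ?f ` {0..<int p}" by blast
    qed
  qed
  ultimately show ?thesis by (simp add: lattice_index_eq)
qed

lemma add_pow_quat_Q: "add_pow (quat_Q a b) (n::int) x = scl (of_int n) x"
proof -
  have nat: "x [^]\<^bsub>add_monoid (quat_Q a b)\<^esub> m = scl (of_nat m) x" for m :: nat
    by (induction m) (auto simp: scl_add_left algebra_simps)
  show ?thesis
  proof (cases "n \<ge> 0")
    case True
    then show ?thesis unfolding add_pow_def int_pow_def2 nat by simp
  next
    case False
    then show ?thesis unfolding add_pow_def int_pow_def2 nat by (simp del: scl_minus add: scl_minus[symmetric])
  qed
qed

lemma Z_plus_eq: "Z_plus a b L = {scl (of_int n) qone + w | n w. w \<in> L}"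
  unfolding Z_plus_def set_add_def set_mult_def by (auto simp: add_pow_quat_Q)

context ramified_order
begin

section \<open>Right division by an element of valuation 1\<close>

definition uniformizer :: "rat quat \<Rightarrow> bool" where
  "uniformizer y \<longleftrightarrow> y \<in> V 1 \<and> y \<notin> V 2"

text \<open>z times the inverse of y: it shows z as a left multiple of the generator y.\<close>

definition dv :: "rat quat \<Rightarrow> rat quat \<Rightarrow> rat quat" where
  "dv y z = scl (1 / N y) (z \<star> qcnj y)"

lemma dv_mul: "N y \<noteq> 0 \<Longrightarrow> dv y z \<star> y = z"
  by (simp add: dv_def qmul_assoc qmul_qcnj_left)

lemma dv_mul_right: "N y \<noteq> 0 \<Longrightarrow> dv y (z \<star> y) = z"
  by (simp add: dv_def qmul_assoc qmul_qcnj_right)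

lemma dv_diff: "dv y (w - z) = dv y w - dv y z"
  by (simp add: dv_def qmul_diff_left scl_diff_right)

lemma dv_scl: "dv y (scl c z) = scl c (dv y z)"
  by (simp add: dv_def mult.commute)

lemma dv_self: "N y \<noteq> 0 \<Longrightarrow> dv y y = qone"
  by (simp add: dv_def qmul_qcnj_right)

lemma N_dv: "N y \<noteq> 0 \<Longrightarrow> N (dv y z) = N z / N y"
  by (simp add: dv_def red_norm_qmul power2_eq_square)

lemma uniformizer_nz: "uniformizer y \<Longrightarrow> N y \<noteq> 0"
  by (auto simp: uniformizer_def V_iff)

lemma dv_V: "uniformizer y \<Longrightarrow> dv y z \<in> V k \<longleftrightarrow> z \<in> V (Suc k)"
proof -
  assume y: "uniformizer y"
  note y0 = uniformizer_nz[OF y]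
  let ?u = "N y / of_nat p"
  have u: "unit ?u" using y by (auto simp: uniformizer_def V_iff vge_def power2_eq_square)
  have "vge p k (N z / N y) \<longleftrightarrow> vge p k (N z / of_nat p)"
  proof
    assume "vge p k (N z / N y)"
    then have "vge p k (?u * (N z / N y))" using u by (intro vge_mult_left) auto
    then show "vge p k (N z / of_nat p)" using y0 by simp
  next
    assume "vge p k (N z / of_nat p)"
    then have "vge p k (?u * (N z / N y))" using y0 by simp
    then show "vge p k (N z / N y)" using u vge_unit_cancel by blast
  qed
  then show ?thesis by (simp add: V_iff N_dv[OF y0] vge_def)
qed

lemma mul_uniformizer_V: "uniformizer y \<Longrightarrow> z \<star> y \<in> V (Suc k) \<longleftrightarrow> z \<in> V k"
  using dv_V[of y "z \<star> y" k] by (simp add: dv_mul_right uniformizer_nz)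

text \<open>Multiplying Z + \<open>V 1\<close> by y from the right gives Z y + \<open>V 2\<close>.
  So this describes the left multiples of y by \<open>OT\<close>.\<close>

lemma dv_OT_iff: "uniformizer y \<Longrightarrow> dv y x \<in> OT \<longleftrightarrow> (\<exists>c::int. x - scl (of_int c) y \<in> V 2)"
proof -
  assume y: "uniformizer y"
  have "dv y x - cst (of_int c) \<in> V 1 \<longleftrightarrow> x - scl (of_int c) y \<in> V 2" for c
    using dv_V[OF y, of "x - scl (of_int c) y" 1]
    by (simp add: dv_diff dv_scl dv_self[OF uniformizer_nz[OF y]] numeral_2_eq_2)
  then show ?thesis by (simp add: OT_def)
qed

text \<open>Right multiplication by y carries \<open>V 0\<close> modulo \<open>V 1\<close> onto
  \<open>V 1\<close> modulo \<open>V 2\<close>, so the residues 1 and u become y and u y.\<close>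

lemma mul_uniformizer_approx:
  assumes y: "uniformizer y" and u: "u \<in> R" "red_trace u = 0" "unit (N u)" and z: "z \<in> V 1"
  shows "\<exists>c d::int. z - scl (of_int c) y - scl (of_int d) (u \<star> y) \<in> V 2"
proof -
  have "dv y z \<in> V 0" using dv_V[OF y, of z 0] z by simp
  then obtain c d :: int where "dv y z - cst (of_int c) - scl (of_int d) u \<in> V 1"
    using residue_decomposition[OF u] by blast
  then have "(dv y z - cst (of_int c) - scl (of_int d) u) \<star> y \<in> V (Suc 1)"
    by (simp only: mul_uniformizer_V[OF y])
  then show ?thesis
    by (auto simp: qmul_diff_left dv_mul[OF uniformizer_nz[OF y]] numeral_2_eq_2)
qed

section \<open>From a suborder of index p to a bilateral ideal\<close>

context
  fixes R'
  assumes R': "is_order a b R'" "R' \<subseteq> Ot" "lattice_index a b Ot R' = p"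
begin

definition L where "L = {x \<in> R'. int_dvd (of_nat p) (red_trace x)}"

lemma R'_add: "addsub R'" and R'_mul: "x \<in> R' \<Longrightarrow> y \<in> R' \<Longrightarrow> x \<star> y \<in> R'"
  and R'_one: "qone \<in> R'"
  using R'(1) by (auto simp: is_order_iff)

lemma R'_R: "x \<in> R' \<Longrightarrow> x \<in> R"
  using R'(2) by (auto simp: Ot_iff)

text \<open>An element of the small order is an integer c modulo \<open>V 1\<close>, so its trace is
  2c modulo p.\<close>

lemma L_iff: "x \<in> L \<longleftrightarrow> x \<in> R' \<and> x \<in> V 1"
proof (cases "x \<in> R'")
  case True
  then have "x \<in> OT" using R'(2) Ot_iff by blast
  then obtain c where c: "x - cst (of_int c) \<in> V 1" unfolding OT_def by blast
  have "red_trace x \<in> \<int>" by (rule order_trace_Ints[OF R'(1) True])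
  moreover have "x \<in> V 1" if "vge p 1 (red_trace x)"
  proof -
    have "vge p 1 (red_trace x - red_trace (x - cst (of_int c)))" using that trace_V1[OF c] by (rule vge_diff)
    then have "vge p 1 (of_int c)" by (simp add: mult.commute[of "of_int c"] vge_2_mult_iff)
    then have "cst (of_int c) \<in> V 1" by (intro V_mono[OF cst_V2]) auto
    from V_add[OF c this] show ?thesis by simp
  qed
  ultimately show ?thesis using True trace_V1 int_dvd_iff by (auto simp only: L_def mem_Collect_eq)
qed (simp add: L_def)

lemma L_add: "addsub L"
  using R'_add addsub_V[of 1] by (auto simp: addsub_def L_iff)

lemma p_Ot_R': "x \<in> Ot \<Longrightarrow> scl (of_nat p) x \<in> R'"
  using index_scl_mem[OF Ot_add R'_add R'(2), where a=a and b=b] R'(3) by simp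

lemma Ot_gen: "w \<in> Ot \<Longrightarrow> w \<notin> R' \<Longrightarrow> x \<in> Ot \<Longrightarrow> \<exists>k::int. x - scl (of_int k) w \<in> R'"
  by (rule prime_index_generator[OF Ot_add R'_add R'(2) prime R'(3)])

text \<open>Such an x is p times an element of R in \<open>V 1\<close>, and p annihilates the
  quotient of \<open>Ot\<close> by \<open>R'\<close>.\<close>

lemma V3_R': "x \<in> R \<Longrightarrow> x \<in> V 3 \<Longrightarrow> x \<in> R'"
  using div_p_mem_R[of x 1] by (auto intro!: p_Ot_R' V1_Ot)

lemma Ot_not_subset: "\<not> Ot \<subseteq> R'"
proof
  assume "Ot \<subseteq> R'"
  then have "(\<lambda>x. (\<lambda>h. h + x) ` R') ` Ot = (\<lambda>x. R') ` Ot"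
    using translate_eq_iff[OF R'_add, of _ 0] by (intro image_cong) auto
  also have "\<dots> = {R'}" using addsubD(1)[OF Ot_add] by auto
  finally have "lattice_index a b Ot R' = 1" by (simp add: lattice_index_eq)
  then show False using R'(3) gt_1 by simp
qed

text \<open>Otherwise \<open>R'\<close> would meet \<open>V 1\<close> only in \<open>V 2\<close>,
  and the plane \<open>V 1\<close> modulo \<open>V 2\<close> would inject into a quotient with p
  elements.\<close>

lemma L_uniformizer: "\<exists>x\<in>L. uniformizer x"
proof (rule ccontr)
  assume "\<not> ?thesis"
  then have no: "x \<in> V 2" if "x \<in> L" for x using that by (auto simp: uniformizer_def L_iff)
  obtain u \<pi> where u: "u \<in> R" "red_trace u = 0" "unit (N u)" and \<pi>: "\<pi> \<in> R" "\<pi> \<in> V 1" "\<pi> \<notin> V 2"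
    using exists_unit_uniformizer by blast
  have pu: "uniformizer \<pi>" using \<pi> by (simp add: uniformizer_def)
  have "\<pi> \<notin> R'" using no \<pi> by (auto simp: L_iff)
  moreover have u\<pi>: "u \<star> \<pi> \<in> R" "u \<star> \<pi> \<in> V 1"
    using R_mul u(1) \<pi>(1) V_mul[OF R_V0[OF u(1)] \<pi>(2)] by auto
  ultimately obtain k where k: "u \<star> \<pi> - scl (of_int k) \<pi> \<in> R'"
    using Ot_gen[OF V1_Ot[OF \<pi>(1,2)] _ V1_Ot[OF u\<pi>]] by blast
  have "u \<star> \<pi> - scl (of_int k) \<pi> \<in> V 1"
    by (intro addsubD(2)[OF addsub_V] V_scl u\<pi> \<pi>) simp
  then have "u \<star> \<pi> - scl (of_int k) \<pi> \<in> V 2" using k by (intro no) (simp add: L_iff)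
  then have "(u - cst (of_int k)) \<star> \<pi> \<in> V (Suc 1)" by (simp add: qmul_diff_left numeral_2_eq_2)
  then have "cst (- of_int k) + scl 1 u \<in> V 1" by (simp only: mul_uniformizer_V[OF pu]) simp
  from residue_independent[OF u(2,3) _ _ this] have "vge p 1 1" by simp
  then show False using vge_of_int_iff[of 1 1] by simp
qed

text \<open>If w were missing, its multiples would represent all of \<open>Ot\<close> modulo
  \<open>R'\<close>, in particular u x for a uniformizer x of L. Multiplying that relation by x
  pushes the w term into \<open>V 3\<close>, hence into \<open>R'\<close>; so u x x lies in
  \<open>R'\<close>. But x x and u x x span \<open>V 2\<close> modulo \<open>V 3\<close>, which puts
  w into \<open>R'\<close>.\<close>

lemma R_V2_R':
  assumes w: "w \<in> R" "w \<in> V 2"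
  shows "w \<in> R'"
proof (rule ccontr)
  assume n: "w \<notin> R'"
  obtain x where x: "x \<in> L" "uniformizer x" using L_uniformizer by blast
  then have xR: "x \<in> R'" "x \<in> V 1" by (auto simp: L_iff)
  then have xRR: "x \<in> R" by (auto intro: R'_R)
  obtain u \<pi> where u: "u \<in> R" "red_trace u = 0" "unit (N u)" using exists_unit_uniformizer by blast
  have w1: "w \<in> V 1" by (rule V_mono[OF w(2)]) simp
  have "u \<star> x \<in> Ot"
    using V_mul[OF R_V0[OF u(1)] xR(2)] by (intro V1_Ot R_mul u xRR) simp
  then obtain k where k: "u \<star> x - scl (of_int k) w \<in> R'"
    using Ot_gen[OF V1_Ot[OF w(1) w1] n] by blast
  have "(u \<star> x - scl (of_int k) w) \<star> x \<in> R'" by (rule R'_mul[OF k xR(1)])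
  moreover have "w \<star> x \<in> R'"
    using V_mul[OF w(2) xR(2)] by (intro V3_R' R_mul w xRR) (simp add: numeral_3_eq_3)
  ultimately have "(u \<star> x - scl (of_int k) w) \<star> x + scl (of_int k) (w \<star> x) \<in> R'"
    by (intro addsubD(4)[OF R'_add] addsub_scl_int[OF R'_add])
  then have ux: "u \<star> x \<star> x \<in> R'" by (simp add: qmul_diff_left)
  have "dv x w \<in> V 1" using dv_V[OF x(2), of w 1] w(2) by (simp add: numeral_2_eq_2)
  then obtain c d where cd: "dv x w - scl (of_int c) x - scl (of_int d) (u \<star> x) \<in> V 2"
    using mul_uniformizer_approx[OF x(2) u] by blast
  then have "(dv x w - scl (of_int c) x - scl (of_int d) (u \<star> x)) \<star> x \<in> V (Suc 2)"
    by (simp only: mul_uniformizer_V[OF x(2)])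
  then have v3: "w - scl (of_int c) (x \<star> x) - scl (of_int d) (u \<star> x \<star> x) \<in> V 3"
    by (simp add: qmul_diff_left dv_mul[OF uniformizer_nz[OF x(2)]] numeral_3_eq_3 numeral_2_eq_2)
  have "w - scl (of_int c) (x \<star> x) - scl (of_int d) (u \<star> x \<star> x) \<in> R'"
    by (intro V3_R' v3 addsubD(2)[OF R_add] addsub_scl_int[OF R_add] R_mul u xRR w)
  then have "(w - scl (of_int c) (x \<star> x) - scl (of_int d) (u \<star> x \<star> x)) + scl (of_int d) (u \<star> x \<star> x)
    + scl (of_int c) (x \<star> x) \<in> R'"
    by (intro addsubD(4)[OF R'_add] addsub_scl_int[OF R'_add] R'_mul xR ux)
  then show False using n by simp
qed

lemma R_V2_L: "w \<in> R \<Longrightarrow> w \<in> V 2 \<Longrightarrow> w \<in> L"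
  using R_V2_R' V_mono[of w 2 1] by (simp add: L_iff)

text \<open>\<open>V 1\<close> modulo \<open>V 2\<close> has the basis x, u x. The second vector is
  not in \<open>R'\<close>, since \<open>R'\<close> would then contain \<open>Ot\<close>; so its
  coefficient in an element of L is divisible by p.\<close>

lemma L_approx:
  assumes x: "x \<in> L" "uniformizer x"
  shows "w \<in> L \<longleftrightarrow> w \<in> R \<and> (\<exists>c::int. w - scl (of_int c) x \<in> V 2)"
proof
  assume w: "w \<in> L"
  then have wR: "w \<in> R'" "w \<in> V 1" by (auto simp: L_iff)
  have xR: "x \<in> R'" "x \<in> V 1" using x by (auto simp: L_iff)
  then have xRR: "x \<in> R" by (auto intro: R'_R)
  obtain u \<pi> where u: "u \<in> R" "red_trace u = 0" "unit (N u)" using exists_unit_uniformizer by blast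
  have uxO: "u \<star> x \<in> R" "u \<star> x \<in> V 1"
    using V_mul[OF R_V0[OF u(1)] xR(2)] by (intro R_mul u xRR, simp)
  have approx: "\<exists>c d. z - scl (of_int c) x - scl (of_int d) (u \<star> x) \<in> V 2 \<and>
      z - scl (of_int c) x - scl (of_int d) (u \<star> x) \<in> R'" if z: "z \<in> R" "z \<in> V 1" for z
  proof -
    obtain c d where cd: "z - scl (of_int c) x - scl (of_int d) (u \<star> x) \<in> V 2"
      using mul_uniformizer_approx[OF x(2) u z(2)] by blast
    moreover have "z - scl (of_int c) x - scl (of_int d) (u \<star> x) \<in> R"
      by (intro addsubD(2)[OF R_add] addsub_scl_int[OF R_add] uxO xRR z)
    ultimately show ?thesis using R_V2_R' by blast
  qed
  have nux: "u \<star> x \<notin> R'"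
  proof
    assume ux: "u \<star> x \<in> R'"
    have "Ot \<subseteq> R'"
    proof
      fix z assume "z \<in> Ot"
      then obtain e where z: "z \<in> R" "z - cst (of_int e) \<in> V 1" by (auto simp: Ot_iff OT_def)
      have zR: "z - cst (of_int e) \<in> R" by (intro addsubD(2)[OF R_add] addsub_scl_int[OF R_add] R_one z)
      obtain c d where "z - cst (of_int e) - scl (of_int c) x - scl (of_int d) (u \<star> x) \<in> R'"
        using approx[OF zR z(2)] by blast
      then have "(z - cst (of_int e) - scl (of_int c) x - scl (of_int d) (u \<star> x)) + scl (of_int d) (u \<star> x)
        + scl (of_int c) x + cst (of_int e) \<in> R'"
        by (intro addsubD(4)[OF R'_add] addsub_scl_int[OF R'_add] R'_one xR ux)
      then show "z \<in> R'" by simp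
    qed
    then show False using Ot_not_subset by blast
  qed
  obtain c d where cd: "w - scl (of_int c) x - scl (of_int d) (u \<star> x) \<in> V 2"
    "w - scl (of_int c) x - scl (of_int d) (u \<star> x) \<in> R'" using approx[OF R'_R[OF wR(1)] wR(2)] by blast
  have "w - scl (of_int c) x - (w - scl (of_int c) x - scl (of_int d) (u \<star> x)) \<in> R'"
    by (intro addsubD(2)[OF R'_add] addsub_scl_int[OF R'_add] wR xR cd)
  then have dux: "scl (of_int d) (u \<star> x) \<in> R'" by simp
  have "int p dvd d"
  proof (rule ccontr)
    assume "\<not> int p dvd d"
    then have "coprime d (int p)" using prime_imp_coprime[OF prime_int, of d] by (simp add: coprime_commute)
    moreover have "scl (of_int (int p)) (u \<star> x) \<in> R'" using p_Ot_R'[OF V1_Ot[OF uxO]] by simp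
    ultimately show False using coprime_scl_mem[OF R'_add dux] nux by blast
  qed
  then have "vge p 1 (of_int d)" by (simp add: vge_of_int_iff)
  then have "scl (of_int d) (u \<star> x) \<in> V (2 + 1)" by (intro V_scl_1 uxO)
  then have "scl (of_int d) (u \<star> x) \<in> V 2" by (rule V_mono) simp
  from V_add[OF cd(1) this] have "w - scl (of_int c) x \<in> V 2" by simp
  then show "w \<in> R \<and> (\<exists>c::int. w - scl (of_int c) x \<in> V 2)" using R'_R[OF wR(1)] by blast
next
  assume "w \<in> R \<and> (\<exists>c::int. w - scl (of_int c) x \<in> V 2)"
  then obtain c :: int where w: "w \<in> R" "w - scl (of_int c) x \<in> V 2" by blast
  have xR: "x \<in> R" using x R'_R by (auto simp: L_iff)
  have "w - scl (of_int c) x \<in> L"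
    by (intro R_V2_L w addsubD(2)[OF R_add] addsub_scl_int[OF R_add] xR)
  then have "(w - scl (of_int c) x) + scl (of_int c) x \<in> L"
    by (intro addsubD(4)[OF L_add] addsub_scl_int[OF L_add] x)
  then show "w \<in> L" by simp
qed

lemma p_R_L: "x \<in> R \<Longrightarrow> scl (of_nat p) x \<in> L"
  by (intro R_V2_L p_R_V2)

lemma L_R: "x \<in> L \<Longrightarrow> x \<in> R"
  using R'_R by (simp add: L_iff)

text \<open>At p the uniformizer x generates L. At the other primes p is invertible, L and
  \<open>Ot\<close> coincide, and 1 generates.\<close>

lemma L_left_ideal: "is_left_ideal a b Ot L"
  unfolding is_left_ideal_def
proof (intro conjI allI impI)
  have Lf: "full L" by (rule full_of_p[OF L_add p_R_L])
  have Lb: "bdd L" by (rule bdd_mono[OF R_bdd]) (auto simp: L_R)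
  show "is_lattice a b L" unfolding is_lattice_iff using L_add Lf Lb by blast
  have Of: "full Ot" using Ot_order by (simp add: is_order_iff)
  fix l :: nat assume l: "Factorial_Ring.prime l"
  interpret L: rational_prime l by unfold_locales (rule l)
  show "\<exists>x\<in>Units (quat_Qp l a b). localize l a b L = localize l a b Ot #>\<^bsub>quat_Qp l a b\<^esub> x"
  proof (cases "l = p")
    case True
    obtain x where x: "x \<in> L" "uniformizer x" using L_uniformizer by blast
    note x0 = uniformizer_nz[OF x(2)]
    show ?thesis
    proof (rule L.localize_coset[OF L_add Lf Ot_add Of x0])
      fix y assume y: "y \<in> Ot"
      then obtain c where c: "y - cst (of_int c) \<in> V 1" by (auto simp: Ot_iff OT_def)
      then have "(y - cst (of_int c)) \<star> x \<in> V (Suc 1)" by (simp only: mul_uniformizer_V[OF x(2)])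
      then have "y \<star> x - scl (of_int c) x \<in> V 2" by (simp add: qmul_diff_left numeral_2_eq_2)
      moreover have "y \<star> x \<in> R" using y x L_R by (intro R_mul) (auto simp: Ot_iff)
      ultimately show "y \<star> x \<in> L.loc L" using L_approx[OF x] by (intro L.loc_superset) blast
    next
      fix w assume "w \<in> L"
      then have "dv x w \<in> OT" using L_approx[OF x] dv_OT_iff[OF x(2)] by blast
      then show "\<exists>y\<in>L.loc Ot. w = y \<star> x"
        using dv_mul[OF x0, of w] loc_Ot True by (intro bexI[of _ "dv x w"]) auto
    qed
  next
    case False
    have pl: "\<not> int l dvd int p" using l prime primes_dvd_imp_eq False by auto
    show ?thesis
    proof (rule L.localize_coset[OF L_add Lf Ot_add Of, of a b qone])
      show "N qone \<noteq> 0" by simp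
      show "y \<star> qone \<in> L.loc L" if "y \<in> Ot" for y
        using p_R_L[of y] that pl by (intro L.locI[of "int p"]) (auto simp: Ot_iff)
      show "\<exists>y\<in>L.loc Ot. w = y \<star> qone" if "w \<in> L" for w
        using that R'(2) by (intro bexI[of _ w] L.loc_superset) (auto simp: L_iff)
    qed
  qed
qed

text \<open>L is right stable because x times an element of \<open>V 1\<close> falls into
  \<open>V 2\<close>. Conversely, x z in Z x + \<open>V 2\<close> puts z into Z +
  \<open>V 1\<close>; conjugation moves x to the right, where division by it is available.\<close>

lemma L_right_order: "right_order a b L = Ot"
proof -
  obtain x where x: "x \<in> L" "uniformizer x" using L_uniformizer by blast
  have "w \<star> z \<in> L" if w: "w \<in> L" and z: "z \<in> Ot" for w z
  proof -
    obtain c where c: "w - scl (of_int c) x \<in> V 2" using w L_approx[OF x] by blast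
    obtain d where d: "z \<in> R" "z - cst (of_int d) \<in> V 1" using z by (auto simp: Ot_iff OT_def)
    have "(w - scl (of_int c) x) \<star> z \<in> V 2" using V_mul[OF c R_V0[OF d(1)]] by simp
    moreover have "x \<in> V 1" using x by (simp add: L_iff)
    then have "scl (of_int c) (x \<star> (z - cst (of_int d))) \<in> V 2"
      using V_mul[OF _ d(2), of x 1] by (intro V_scl) (simp_all add: numeral_2_eq_2)
    ultimately have "(w - scl (of_int c) x) \<star> z + scl (of_int c) (x \<star> (z - cst (of_int d))) \<in> V 2"
      by (rule V_add)
    then have "w \<star> z - scl (of_int (c * d)) x \<in> V 2"
      by (simp add: qmul_diff_left qmul_diff_right scl_diff_right)
    then show ?thesis unfolding L_approx[OF x] using R_mul[OF L_R[OF w] d(1)] by blast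
  qed
  moreover have "z \<in> Ot" if z: "\<And>w. w \<in> L \<Longrightarrow> w \<star> z \<in> L" for z
  proof -
    obtain c where "x \<star> z - scl (of_int c) x \<in> V 2" using z[OF x(1)] L_approx[OF x] by blast
    then have "x \<star> (z - cst (of_int c)) \<in> V 2" by (simp add: qmul_diff_right)
    then have "(qcnj (z - cst (of_int c))) \<star> qcnj x \<in> V 2"
      using V_qcnj[of "x \<star> (z - cst (of_int c))" 2] by (simp add: qcnj_qmul)
    moreover have "uniformizer (qcnj x)" using x(2) by (simp add: uniformizer_def V_qcnj)
    ultimately have "z - cst (of_int c) \<in> V 1"
      using mul_uniformizer_V[of "qcnj x" "qcnj (z - cst (of_int c))" 1] by (simp add: V_qcnj numeral_2_eq_2)
    then have OT: "z \<in> OT" by (auto simp: OT_def)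
    \<comment> \<open>p itself lies in L, so \<open>p z\<close> does too; this settles integrality
      of z away from p.\<close>
    have "scl (of_nat p) z \<in> R" using z[OF p_R_L[OF R_one]] L_R by simp
    moreover have "z \<in> loc R" using OT_V0[OF OT] by (simp add: loc_R)
    ultimately have "z \<in> R" using loc_pow_mem[OF R_add, of z 1] by simp
    then show ?thesis using OT by (simp add: Ot_iff)
  qed
  ultimately show ?thesis unfolding right_order_def r_coset_def quat_Q_simps by blast
qed

text \<open>That no larger gcd occurs is shown by two elements: p has norm p^2, and a uniformizer
  has norm p m with m prime to p.\<close>

lemma L_norm: "has_norm a b L (of_nat p)"
  unfolding has_norm_def is_rat_gcd_def
proof (intro conjI ballI allI impI)
  show "(0::rat) < of_nat p" by simp
  fix s assume "s \<in> N ` L"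
  then show "int_dvd (of_nat p) s"
    using int_dvd_iff order_norm_Ints[OF R_order L_R] by (auto simp: L_iff V_iff)
next
  fix e assume e: "\<forall>s\<in>N ` L. int_dvd e s"
  obtain x where x: "x \<in> L" "uniformizer x" using L_uniformizer by blast
  obtain n where n: "N x = of_int n" using order_norm_Ints[OF R_order L_R[OF x(1)]] by (auto elim: Ints_cases)
  have "int p ^ 1 dvd n" "\<not> int p ^ 2 dvd n"
    using x(2) unfolding uniformizer_def V_iff n mem_Collect_eq vge_of_int_iff by blast+
  then obtain m where m: "n = int p * m" "\<not> int p dvd m" by (auto simp: power2_eq_square elim!: dvdE)
  have "coprime (int p) m" using prime_imp_coprime[OF prime_int m(2)] .
  then obtain u v where uv: "u * int p + v * m = 1" by (metis bezout_int coprime_iff_gcd_eq_1)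
  have "int_dvd e (N (scl (of_nat p) qone))" "int_dvd e (N x)" using e p_R_L[OF R_one] x(1) by auto
  then obtain j k where j: "of_nat p ^ 2 = of_int j * e" and k: "of_int n = of_int k * e"
    by (auto simp: int_dvd_def n)
  have "(of_nat p :: rat) = of_int (u * int p + v * m) * of_nat p" by (simp add: uv)
  also have "\<dots> = of_int u * of_nat p ^ 2 + of_int v * of_int n" by (simp add: m(1) power2_eq_square algebra_simps)
  also have "\<dots> = of_int (u * j + v * k) * e" by (simp add: j k algebra_simps)
  finally show "int_dvd e (of_nat p)" unfolding int_dvd_def by blast
qed

end

lemma index_p_suborder_ideal:
  assumes "is_order a b R'" "R' \<subseteq> Ot" "lattice_index a b Ot R' = p"
  shows "is_bilateral_ideal a b Ot {x \<in> R'. int_dvd (of_nat p) (red_trace x)}"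
    and "has_norm a b {x \<in> R'. int_dvd (of_nat p) (red_trace x)} (of_nat p)"
  using L_left_ideal[OF assms] L_right_order[OF assms] L_norm[OF assms]
  by (simp_all add: is_bilateral_ideal_def L_def[OF assms])

section \<open>From a bilateral ideal of norm p to a suborder\<close>

context
  fixes P
  assumes bilateral: "is_bilateral_ideal a b Ot P" and norm: "has_norm a b P (of_nat p)"
begin

lemma P_lattice: "addsub P" "full P" "bdd P"
  using bilateral by (auto simp: is_bilateral_ideal_def is_left_ideal_def is_lattice_iff)

lemma P_locally_principal: "Factorial_Ring.prime l \<Longrightarrow>
    \<exists>x \<in> Units (quat_Qp l a b). localize l a b P = localize l a b Ot #>\<^bsub>quat_Qp l a b\<^esub> x"
  using bilateral by (auto simp: is_bilateral_ideal_def is_left_ideal_def)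

lemma P_right: "w \<in> P \<Longrightarrow> z \<in> Ot \<Longrightarrow> w \<star> z \<in> P"
  using bilateral by (auto simp: is_bilateral_ideal_def right_order_def r_coset_def)

lemma Ot_full: "full Ot" and Ot_mul: "x \<in> Ot \<Longrightarrow> y \<in> Ot \<Longrightarrow> x \<star> y \<in> Ot"
  using Ot_order by (auto simp: is_order_iff)

text \<open>Left stability is not part of the definition of an ideal; it holds at each prime by
  local principality.\<close>

lemma P_left: "z \<in> Ot \<Longrightarrow> w \<in> P \<Longrightarrow> z \<star> w \<in> P"
proof (rule global_of_local[OF P_lattice(1)])
  fix l :: nat assume zw: "z \<in> Ot" "w \<in> P" and l: "Factorial_Ring.prime l"
  interpret L: rational_prime l by unfold_locales (rule l)
  obtain x where x: "x \<in> Units (quat_Qp l a b)"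
    "localize l a b P = localize l a b Ot #>\<^bsub>quat_Qp l a b\<^esub> x"
    using P_locally_principal[OF l] by blast
  show "z \<star> w \<in> L.loc P"
    by (rule L.locally_principal_mult[OF P_lattice(1,2) Ot_add Ot_full Ot_mul x zw])
qed

lemma P_norm: "w \<in> P \<Longrightarrow> \<exists>n::int. N w = of_nat p * of_int n"
proof -
  assume "w \<in> P"
  then have "int_dvd (of_nat p) (N w)" using norm by (auto simp: has_norm_def is_rat_gcd_def)
  then show ?thesis by (auto simp: int_dvd_def mult.commute)
qed

text \<open>If l divided N(y) / p for all y in P, then p l would divide all norms, against the gcd
  being p. A y for which it does not has norm of least valuation at l and therefore
  generates.\<close>

lemma P_generator:
  assumes l: "Factorial_Ring.prime l"
  shows "\<exists>y\<in>P. \<exists>n::int. N y = of_nat p * of_int n \<and> \<not> int l dvd n \<and> N y \<noteq> 0 \<and>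
    (\<forall>w\<in>P. dv y w \<in> rational_prime.loc l Ot)"
proof -
  interpret L: rational_prime l by unfold_locales (rule l)
  have "\<exists>y\<in>P. \<exists>n::int. N y = of_nat p * of_int n \<and> \<not> int l dvd n"
  proof (rule ccontr)
    assume n: "\<not> ?thesis"
    have "int_dvd (of_nat p * of_nat l) s" if s: "s \<in> N ` P" for s
    proof -
      obtain w n where w: "w \<in> P" "s = N w" "N w = of_nat p * of_int n" using s P_norm by blast
      then have "int l dvd n" using n by blast
      then obtain m where "n = int l * m" by blast
      then have "s = of_int m * (of_nat p * of_nat l)" using w by simp
      then show ?thesis unfolding int_dvd_def by blast
    qed
    then have "int_dvd (of_nat p * of_nat l) (of_nat p)" using norm by (auto simp: has_norm_def is_rat_gcd_def)
    then obtain k where "of_nat p = of_int k * (of_nat p * of_nat l :: rat)" by (auto simp: int_dvd_def)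
    then have "(of_int (k * int l) :: rat) = of_int 1" by simp
    then have "k * int l = 1" by (simp only: of_int_eq_iff)
    then have "int l dvd 1" by (metis dvd_triv_right)
    then show False by simp
  qed
  then obtain y n where y: "y \<in> P" "N y = of_nat p * of_int n" "\<not> int l dvd n" by blast
  have n0: "n \<noteq> 0" using y(3) by auto
  have "dv y w \<in> L.loc Ot" if "w \<in> P" for w
    unfolding dv_def
  proof (rule L.locally_principal_generator[OF P_lattice Ot_order P_locally_principal[OF l] y(1) _ _ that])
    show "N y \<noteq> 0" using n0 by (simp add: y(2))
    fix w assume "w \<in> P"
    then obtain m where "N w = of_nat p * of_int m" using P_norm by blast
    then have "N w / N y = of_int m / of_int n" by (simp add: y(2))
    then show "N w / N y \<in> lint l" using L.lint_div_int[OF y(3)] by simp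
  qed
  then show ?thesis using y n0 by (intro bexI[of _ y] exI[of _ n]) auto
qed

text \<open>Away from p the norm of the generator y is a unit. Right stability of P gives y z in P,
  hence y z y^-1 in \<open>loc R\<close>; so y normalises R, lies in \<open>loc R\<close> by
  maximality, and is invertible there.\<close>

lemma P_other:
  assumes l: "Factorial_Ring.prime l" "l \<noteq> p"
  shows "P \<subseteq> rational_prime.loc l R" "R \<subseteq> rational_prime.loc l P"
proof -
  interpret L: rational_prime l by unfold_locales (rule l)
  have pl: "\<not> int l dvd int p" using l prime primes_dvd_imp_eq by auto
  have OR: "L.loc Ot = L.loc R" by (rule loc_Ot_other[OF l])
  obtain y n where y: "y \<in> P" "N y = of_nat p * of_int n" "\<not> int l dvd n" "N y \<noteq> 0"
    and gen: "\<And>w. w \<in> P \<Longrightarrow> dv y w \<in> L.loc R" using P_generator[OF l(1)] unfolding OR by blast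
  have Ny: "N y \<in> lint l" "1 / N y \<in> lint l"
    using L.lint_inverse_int[OF L.not_dvd_mult[OF pl y(3)]] by (auto simp: y(2))
  have yR: "y \<in> L.loc R"
  proof (rule L.normalizer_mem[OF maximal a0 b0 anisotropic Ny(1) y(4)])
    fix z assume "z \<in> L.loc R"
    then have "z \<in> L.loc Ot" by (simp add: OR)
    then obtain m where m: "\<not> int l dvd m" "scl (of_int m) z \<in> Ot" by (rule L.locE)
    have "scl (of_int m) (dv y (y \<star> z)) \<in> L.loc R"
      using gen[OF P_right[OF y(1) m(2)]] by (simp add: dv_scl)
    then have "dv y (y \<star> z) \<in> L.loc R" by (rule L.loc_loc[OF L.locI[OF m(1)]])
    then show "scl (1 / N y) (y \<star> z \<star> qcnj y) \<in> L.loc R" by (simp add: dv_def)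
  qed
  show "P \<subseteq> L.loc R"
  proof
    fix w assume "w \<in> P"
    from L.loc_order_qmul[OF R_order gen[OF this] yR] show "w \<in> L.loc R" by (simp only: dv_mul[OF y(4)])
  qed
  show "R \<subseteq> L.loc P"
  proof
    fix z assume "z \<in> R"
    then have "dv y z \<in> L.loc Ot" unfolding dv_def OR
      by (intro L.loc_scl[OF R_add] L.loc_order_qmul[OF R_order] L.loc_qcnj[OF R_order] yR Ny L.loc_superset)
    then have "dv y z \<star> y \<in> L.loc P" 
      using L.loc_qmul[of Ot P a b P "dv y z" y] P_left L.loc_superset[OF y(1)] by blast
    then show "z \<in> L.loc P" by (simp only: dv_mul[OF y(4)])
  qed
qed

text \<open>At p the generator has norm p n with n prime to p, so it is a uniformizer and P is
  described by \<open>dv_OT_iff\<close>. At the other primes P and R agree.\<close>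

lemma P_uniformizer:
  "\<exists>y\<in>P. uniformizer y \<and> (\<forall>x. x \<in> P \<longleftrightarrow> x \<in> R \<and> (\<exists>c::int. x - scl (of_int c) y \<in> V 2))"
proof -
  obtain y n where y: "y \<in> P" "N y = of_nat p * of_int n" "\<not> int p dvd n" "N y \<noteq> 0"
    and gen: "\<And>w. w \<in> P \<Longrightarrow> dv y w \<in> OT" using P_generator[OF prime] unfolding loc_Ot by blast
  have "vge p 1 (of_int (int p * n))" "\<not> vge p 2 (of_int (int p * n))"
    unfolding vge_of_int_iff using y(3) by (auto simp: power2_eq_square)
  then have un: "uniformizer y" by (simp add: uniformizer_def V_iff y(2))
  have "x \<in> R" if x: "x \<in> P" for x
  proof (rule global_of_local[OF R_add])
    fix l :: nat assume l: "Factorial_Ring.prime l"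
    show "x \<in> rational_prime.loc l R"
    proof (cases "l = p")
      case True
      obtain n where "N x = of_nat p * of_int n" using P_norm[OF x] by blast
      then have "x \<in> V 0" by (auto simp: V_iff)
      then show ?thesis unfolding True loc_R .
    next
      case False then show ?thesis using P_other(1)[OF l] x by blast
    qed
  qed
  moreover have "x \<in> P" if x: "x \<in> R" "\<exists>c::int. x - scl (of_int c) y \<in> V 2" for x
  proof (rule global_of_local[OF P_lattice(1)])
    fix l :: nat assume l: "Factorial_Ring.prime l"
    show "x \<in> rational_prime.loc l P"
    proof (cases "l = p")
      case True
      have "dv y x \<in> loc Ot" unfolding loc_Ot dv_OT_iff[OF un] by (rule x)
      then have "dv y x \<star> y \<in> loc P" 
        using loc_qmul[of Ot P a b P "dv y x" y] P_left loc_superset[OF y(1)] by blast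
      then show ?thesis unfolding True by (simp only: dv_mul[OF y(4)])
    next
      case False then show ?thesis using P_other(2)[OF l] x by blast
    qed
  qed
  ultimately show ?thesis using y(1) un gen dv_OT_iff[OF un] by blast
qed

lemma P_V1: "x \<in> P \<Longrightarrow> x \<in> V 1"
  using P_norm by (force simp: V_iff intro: vge_mult_right)

lemma P_R: "x \<in> P \<Longrightarrow> x \<in> R"
  using P_uniformizer by blast

lemma P_Ot: "x \<in> P \<Longrightarrow> x \<in> Ot"
  by (intro V1_Ot P_R P_V1)

lemma Z_plusI: "w \<in> P \<Longrightarrow> cst (of_int n) + w \<in> Z_plus a b P"
  by (auto simp: Z_plus_eq)

lemma Z_plus_add: "addsub (Z_plus a b P)"
  unfolding addsub_def
proof (intro conjI ballI)
  show "0 \<in> Z_plus a b P" using Z_plusI[of 0 0] addsubD(1)[OF P_lattice(1)] by simp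
  fix x y assume "x \<in> Z_plus a b P" "y \<in> Z_plus a b P"
  then obtain m n v w where "v \<in> P" "w \<in> P" "x = cst (of_int m) + v" "y = cst (of_int n) + w"
    by (auto simp: Z_plus_eq)
  then show "x - y \<in> Z_plus a b P"
    using Z_plusI[of "v - w" "m - n"] addsubD(2)[OF P_lattice(1)] by (simp add: scl_diff_left algebra_simps)
qed

lemma Z_plus_subset: "Z_plus a b P \<subseteq> Ot"
proof -
  have "qone \<in> Ot" using Ot_order by (simp add: is_order_iff)
  then show ?thesis
    using P_Ot addsub_scl_int[OF Ot_add] addsubD(4)[OF Ot_add] by (auto simp: Z_plus_eq)
qed

lemma Z_plus_order: "is_order a b (Z_plus a b P)"
  unfolding is_order_iff
proof (intro conjI ballI Z_plus_add)
  show "full (Z_plus a b P)" by (rule full_mono[OF P_lattice(2)]) (use Z_plusI[of _ 0] in auto)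
  show "bdd (Z_plus a b P)" using Ot_order Z_plus_subset bdd_mono by (auto simp: is_order_iff)
  show "qone \<in> Z_plus a b P" using Z_plusI[of 0 1] addsubD(1)[OF P_lattice(1)] by simp
  fix x y assume "x \<in> Z_plus a b P" "y \<in> Z_plus a b P"
  then obtain m n v w where vw: "v \<in> P" "w \<in> P" and xy: "x = cst (of_int m) + v" "y = cst (of_int n) + w"
    by (auto simp: Z_plus_eq)
  have "scl (of_int m) w + scl (of_int n) v + v \<star> w \<in> P"
    using P_left[OF P_Ot[OF vw(1)] vw(2)] vw
    by (intro addsubD(4)[OF P_lattice(1)] addsub_scl_int[OF P_lattice(1)])
  then have "cst (of_int (m * n)) + (scl (of_int m) w + scl (of_int n) v + v \<star> w) \<in> Z_plus a b P"
    by (rule Z_plusI)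
  also have "cst (of_int (m * n)) + (scl (of_int m) w + scl (of_int n) v + v \<star> w) = x \<star> y"
    by (simp add: xy qmul_add_left qmul_add_right scl_add_right algebra_simps)
  finally show "x \<star> y \<in> Z_plus a b P" .
qed

text \<open>Modulo scalars and \<open>V 2\<close> the small order has basis y, u y, and y lies in P;
  so u y generates the quotient.\<close>

lemma Z_plus_index: "lattice_index a b Ot (Z_plus a b P) = p"
proof -
  obtain y where y: "y \<in> P" "uniformizer y"
    and P_iff: "\<And>x. x \<in> P \<longleftrightarrow> x \<in> R \<and> (\<exists>c::int. x - scl (of_int c) y \<in> V 2)"
    using P_uniformizer by blast
  obtain u \<pi> where u: "u \<in> R" "red_trace u = 0" "unit (N u)" using exists_unit_uniformizer by blast
  have v: "u \<star> y \<in> R" "u \<star> y \<in> V 1"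
    using V_mul[OF R_V0[OF u(1)] P_V1[OF y(1)]] by (intro R_mul u P_R y, simp)
  show ?thesis
  proof (rule index_eqI[OF Ot_add Z_plus_add, of p "u \<star> y"])
    show "p > 0" by simp
    show "u \<star> y \<in> Ot" by (rule V1_Ot[OF v])
    have "scl (of_nat p) (u \<star> y) - scl (of_int 0) y \<in> V 2" using p_R_V2(2)[OF v(1)] by simp
    then have "scl (of_nat p) (u \<star> y) \<in> P" using P_iff p_R_V2(1)[OF v(1)] by blast
    then show "scl (of_nat p) (u \<star> y) \<in> Z_plus a b P" using Z_plusI[of _ 0] by simp
  next
    fix k :: int assume "scl (of_int k) (u \<star> y) \<in> Z_plus a b P"
    then obtain n w where nw: "w \<in> P" "scl (of_int k) (u \<star> y) = cst (of_int n) + w" by (auto simp: Z_plus_eq)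
    then have w: "w = scl (of_int k) (u \<star> y) - cst (of_int n)" by simp
    have "cst (of_int n) = scl (of_int k) (u \<star> y) - w" using nw by simp
    also have "\<dots> \<in> V 1" by (intro addsubD(2)[OF addsub_V] V_scl v P_V1 nw) simp
    \<comment> \<open>A scalar has even valuation: once the integer n is in \<open>V 1\<close>, it
      is in \<open>V 2\<close> and disappears from the congruence.\<close>
    finally have n: "cst (of_int n) \<in> V 2" by (intro cst_V2 cst_V1)
    obtain c where "w - scl (of_int c) y \<in> V 2" using nw P_iff by blast
    from V_add[OF this n] have "scl (of_int k) (u \<star> y) - scl (of_int c) y \<in> V (Suc 1)"
      by (simp add: w numeral_2_eq_2)
    then have "(scl (of_int k) u - cst (of_int c)) \<star> y \<in> V (Suc 1)" by (simp add: qmul_diff_left)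
    then have "cst (- of_int c) + scl (of_int k) u \<in> V 1" by (simp only: mul_uniformizer_V[OF y(2)]) simp
    from residue_independent[OF u(2,3) _ _ this] have "vge p 1 (of_int k)" by simp
    then show "int p dvd k" by (simp add: vge_of_int_iff)
  next
    fix x assume "x \<in> Ot"
    then obtain e where e: "x \<in> R" "x - cst (of_int e) \<in> V 1" by (auto simp: Ot_iff OT_def)
    obtain c d where "x - cst (of_int e) - scl (of_int c) y - scl (of_int d) (u \<star> y) \<in> V 2"
      using mul_uniformizer_approx[OF y(2) u e(2)] by blast
    then have "x - cst (of_int e) - scl (of_int d) (u \<star> y) - scl (of_int c) y \<in> V 2"
      by (simp add: algebra_simps)
    moreover have "x - cst (of_int e) - scl (of_int d) (u \<star> y) \<in> R"
      by (intro addsubD(2)[OF R_add] addsub_scl_int[OF R_add] R_one e v)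
    ultimately have "x - cst (of_int e) - scl (of_int d) (u \<star> y) \<in> P" using P_iff by blast
    then have "cst (of_int e) + (x - cst (of_int e) - scl (of_int d) (u \<star> y)) \<in> Z_plus a b P" by (rule Z_plusI)
    then show "\<exists>k::int. x - scl (of_int k) (u \<star> y) \<in> Z_plus a b P" by (auto simp: algebra_simps)
  qed
qed

end

end

theorem proposition2p13:
  fixes p :: nat and a b :: rat and R :: "rat quat set"
  assumes "Factorial_Ring.prime p" and "p > 2"
    and "a \<noteq> 0" and "b \<noteq> 0"
    and "ramified_exactly_at_p_infinity p a b"
    and "is_maximal_order a b R"
  shows "(\<forall>P. is_bilateral_ideal a b (O_tilde p a b R) P \<and> has_norm a b P (of_nat p) \<longrightarrow>
            is_order a b (Z_plus a b P) \<and> Z_plus a b P \<subseteq> O_tilde p a b R \<and>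
            lattice_index a b (O_tilde p a b R) (Z_plus a b P) = p)
       \<and> (\<forall>R'. is_order a b R' \<and> R' \<subseteq> O_tilde p a b R \<and>
              lattice_index a b (O_tilde p a b R) R' = p \<longrightarrow>
            is_bilateral_ideal a b (O_tilde p a b R)
              {x \<in> R'. int_dvd (of_nat p) (red_trace x)} \<and>
            has_norm a b {x \<in> R'. int_dvd (of_nat p) (red_trace x)} (of_nat p))"
proof -
  interpret ramified_order p a b R
    using assms by unfold_locales (auto simp: ramified_exactly_at_p_infinity_def)
  show ?thesis
    using Z_plus_order Z_plus_subset Z_plus_index index_p_suborder_ideal by blast
qed

end
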